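(* For $1\le j\le d$ let $\mathcal N_j\subseteq\mathcal B(\mathcal H_j)$ be von Neumann algebras, $\Phi_j:\mathcal N_j\to\mathcal N_j$ channels, and $\mathcal S_j\subset\mathcal B(\mathcal H_j)$ resource sets. Then $$\mathrm{Cost}^{cb}_{\vee_{j=1}^d\mathcal S_j}(\Phi_1\otimes\cdots\otimes\Phi_d)\le\sum_{j=1}^d\mathrm{Cost}^{cb}_{\widetilde{\mathcal S_j}}(\widetilde{\Phi_j}).$$ Moreover, if $\mathrm{Cost}^{cb}_{\widetilde{\mathcal S_j}}(\widetilde{\Phi_j})=\mathrm{Cost}^{cb}_{\mathcal S_j}(\Phi_j)$ for all $j$, then tensor additivity holds: $$\mathrm{Cost}^{cb}_{\vee_{j=1}^d\mathcal S_j}(\Phi_1\otimes\cdots\otimes\Phi_d)=\sum_{j=1}^d\mathrm{Cost}^{cb}_{\mathcal S_j}(\Phi_j).$$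
   Context: A channel on a von Neumann algebra $\mathcal N$ is a normal unital completely positive map; $\Phi^{(n)}=\mathrm{id}_{\mathbb M_n}\otimes\Phi$. A resource set for $\mathcal N\subseteq\mathcal B(\mathcal H)$ is a finite set $\mathcal S\subseteq\mathcal B(\mathcal H)$ whose commutant $\mathcal S'$ is a von Neumann algebra and such that there is a normal conditional expectation $\mathcal N\to\mathcal S'\cap\mathcal N$. For $x\in\mathbb M_n(\mathcal N)$, $|||x|||_{\mathcal S^{(n)}}=\sup_{s\in\mathcal S}\|[\mathbb I_n\otimes s,x]\|_{op}$, and $$\mathrm{Cost}_{\mathcal S}^{cb}(\Phi)=\sup_{n\ge1}\sup\{\|\Phi^{(n)}(x)-x\|_{op}: x=x^*\in\mathbb M_n(\mathcal N),\ |||x|||_{\mathcal S^{(n)}}\le1\}\in[0,\infty].$$ On the composite system $\bigotimes_{i=1}^d\mathcal N_i$ (von Neumann tensor product, acting on $\bigotimes_i\mathcal H_i$): for $X\in\mathcal S_j$, $\widetilde{X_j}$ is $X$ in the $j$-th tensor position and identities elsewhere; $\widetilde{\mathcal S_j}=\{\widetilde{X_j}:X\in\mathcal S_j\}$; $\vee_{j=1}^d\mathcal S_j=\bigcup_{j=1}^d\widetilde{\mathcal S_j}$; and $\widetilde{\Phi_j}$ is the channel on $\bigotimes_i\mathcal N_i$ acting as $\Phi_j$ on the $j$-th factor and as the identity on the others. The costs $\mathrm{Cost}^{cb}_{\widetilde{\mathcal S_j}}(\widetilde{\Phi_j})$ are computed on $\bigotimes_i\mathcal N_i$ with the semi-norm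 of $\widetilde{\mathcal S_j}$. *)

theory Defs
  imports "HOL-Analysis.Analysis"
begin

section \<open>Complex Hilbert spaces\<close>

text \<open>The complex structure sits on top of the real inner product space, so that norm and topology
  are those of the library. The complex inner product is antilinear in its first argument.\<close>

class complex_inner = real_inner +
  fixes scaleC :: "complex \<Rightarrow> 'a \<Rightarrow> 'a"  (infixr "*\<^sub>C" 75)
    and cinner :: "'a \<Rightarrow> 'a \<Rightarrow> complex"
  assumes scaleC_add_right: "a *\<^sub>C (x + y) = a *\<^sub>C x + a *\<^sub>C y"
    and scaleC_add_left: "(a + b) *\<^sub>C x = a *\<^sub>C x + b *\<^sub>C x"
    and scaleC_scaleC: "a *\<^sub>C b *\<^sub>C x = (a * b) *\<^sub>C x"
    and scaleC_of_real: "complex_of_real r *\<^sub>C x = r *\<^sub>R x"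
    and cinner_commute: "cinner x y = cnj (cinner y x)"
    and cinner_add_right: "cinner x (y + z) = cinner x y + cinner x z"
    and cinner_scaleC_right: "cinner x (a *\<^sub>C y) = a * cinner x y"
    and Re_cinner: "Re (cinner x y) = inner x y"

class chilbert_space = complex_inner + complete_space

text \<open>A family of Hilbert spaces is given by a family of closed complex subspaces of an ambient
  Hilbert space, which is a type. Any family of Hilbert spaces arises in this way up to unitary
  equivalence, from the subspaces of its direct sum.\<close>

definition closed_csubspace :: "'h::chilbert_space set \<Rightarrow> bool" where
  "closed_csubspace H \<longleftrightarrow>
     0 \<in> H \<and> (\<forall>u\<in>H. \<forall>v\<in>H. u + v \<in> H) \<and> (\<forall>c. \<forall>u\<in>H. c *\<^sub>C u \<in> H) \<and> closed H"

definition cspan :: "'h::chilbert_space set \<Rightarrow> 'h set" where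
  "cspan A = {(\<Sum>a\<in>F. c a *\<^sub>C a) | F c. finite F \<and> F \<subseteq> A}"

section \<open>Bounded operators on a closed subspace\<close>

type_synonym 'h operator = "'h \<Rightarrow>\<^sub>L 'h"

text \<open>The algebra of bounded operators on \<open>H\<close>. An operator on \<open>H\<close> is extended by \<open>0\<close> to the
  orthogonal complement of \<open>H\<close>; this identifies it with an element of the corner \<open>p B p\<close>, where
  \<open>B\<close> is the algebra of bounded complex linear operators on the ambient space and \<open>p\<close> is the
  projection onto \<open>H\<close>. The extension preserves the operator norm, products and adjoints, and the
  identity operator of \<open>H\<close> becomes \<open>p\<close>.\<close>

definition bounded_ops :: "'h::chilbert_space set \<Rightarrow> 'h operator set" where
  "bounded_ops H = {T. (\<forall>c v. blinfun_apply T (c *\<^sub>C v) = c *\<^sub>C blinfun_apply T v)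
      \<and> (\<forall>v. blinfun_apply T v \<in> H)
      \<and> (\<forall>v. (\<forall>u\<in>H. cinner u v = 0) \<longrightarrow> blinfun_apply T v = 0)}"

definition id_op :: "'h::chilbert_space set \<Rightarrow> 'h operator" where
  "id_op H = (THE P. P \<in> bounded_ops H \<and> (\<forall>v\<in>H. blinfun_apply P v = v))"

definition scaleC_op :: "complex \<Rightarrow> 'h::chilbert_space operator \<Rightarrow> 'h operator" where
  "scaleC_op c T = Blinfun (\<lambda>v. c *\<^sub>C blinfun_apply T v)"

definition is_adjoint :: "'h::chilbert_space operator \<Rightarrow> 'h operator \<Rightarrow> bool" where
  "is_adjoint T S \<longleftrightarrow> (\<forall>u v. cinner (blinfun_apply S u) v = cinner u (blinfun_apply T v))"

definition positive_op :: "'h::chilbert_space operator \<Rightarrow> bool" where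
  "positive_op T \<longleftrightarrow> (\<forall>v. cinner v (blinfun_apply T v) \<in> \<real>\<^sub>\<ge>\<^sub>0)"

definition commutant :: "'h::chilbert_space set \<Rightarrow> 'h operator set \<Rightarrow> 'h operator set" where
  "commutant H S = {T \<in> bounded_ops H. \<forall>s\<in>S. T o\<^sub>L s = s o\<^sub>L T}"

section \<open>Von Neumann algebras and normal maps\<close>

text \<open>The ultraweak (sigma-weak) topology is the initial topology for the functionals
  \<open>T \<mapsto> \<Sum>k. \<langle>\<xi> k, T (\<eta> k)\<rangle>\<close> with square summable \<open>\<xi>\<close> and \<open>\<eta>\<close>.\<close>

definition square_summable :: "(nat \<Rightarrow> 'h::chilbert_space) \<Rightarrow> bool" where
  "square_summable \<xi> \<longleftrightarrow> summable (\<lambda>k. (norm (\<xi> k))\<^sup>2)"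

definition ultraweak_topology :: "'h::chilbert_space operator topology" where
  "ultraweak_topology = topology_generated_by
     {{T. (\<Sum>k. cinner (\<xi> k) (blinfun_apply T (\<eta> k))) \<in> U} | \<xi> \<eta> U.
        square_summable \<xi> \<and> square_summable \<eta> \<and> open U}"

text \<open>A von Neumann algebra on \<open>H\<close> is an ultraweakly closed \<open>*\<close>-subalgebra of the bounded operators
  on \<open>H\<close> that contains the identity operator of \<open>H\<close>.\<close>

definition von_neumann_algebra :: "'h::chilbert_space set \<Rightarrow> 'h operator set \<Rightarrow> bool" where
  "von_neumann_algebra H N \<longleftrightarrow>
     closed_csubspace H \<and> N \<subseteq> bounded_ops H \<and> id_op H \<in> N
     \<and> (\<forall>x\<in>N. \<forall>y\<in>N. x + y \<in> N) \<and> (\<forall>c. \<forall>x\<in>N. scaleC_op c x \<in> N)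
     \<and> (\<forall>x\<in>N. \<forall>y\<in>N. x o\<^sub>L y \<in> N) \<and> (\<forall>x\<in>N. \<exists>y\<in>N. is_adjoint x y)
     \<and> closedin ultraweak_topology N"

definition linear_map_on ::
    "'h::chilbert_space operator set \<Rightarrow> ('h operator \<Rightarrow> 'h operator) \<Rightarrow> bool" where
  "linear_map_on N \<Phi> \<longleftrightarrow>
     (\<forall>x\<in>N. \<forall>y\<in>N. \<Phi> (x + y) = \<Phi> x + \<Phi> y) \<and> (\<forall>c. \<forall>x\<in>N. \<Phi> (scaleC_op c x) = scaleC_op c (\<Phi> x))"

definition normal_map :: "'h::chilbert_space operator set \<Rightarrow> 'h operator set \<Rightarrow>
    ('h operator \<Rightarrow> 'h operator) \<Rightarrow> bool" where
  "normal_map N M \<Phi> \<longleftrightarrow>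
     continuous_map (subtopology ultraweak_topology N) (subtopology ultraweak_topology M) \<Phi>"

definition normal_conditional_expectation :: "'h::chilbert_space operator set \<Rightarrow>
    'h operator set \<Rightarrow> ('h operator \<Rightarrow> 'h operator) \<Rightarrow> bool" where
  "normal_conditional_expectation N M E \<longleftrightarrow>
     M \<subseteq> N \<and> E \<in> N \<rightarrow> M \<and> linear_map_on N E \<and> (\<forall>x\<in>N. positive_op x \<longrightarrow> positive_op (E x))
     \<and> (\<forall>a\<in>M. E a = a) \<and> (\<forall>a\<in>M. \<forall>b\<in>M. \<forall>x\<in>N. E (a o\<^sub>L x o\<^sub>L b) = a o\<^sub>L E x o\<^sub>L b)
     \<and> normal_map N M E"

section \<open>Matrices over an operator algebra\<close>

text \<open>An \<open>n \<times> n\<close> matrix \<open>x\<close> of operators on \<open>H\<close> is a function of two indices of which only the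
  entries \<open>x i j\<close> with \<open>i, j < n\<close> matter. It acts on the \<open>n\<close>-fold Hilbert space sum of \<open>H\<close>.\<close>

type_synonym 'h opmat = "nat \<Rightarrow> nat \<Rightarrow> 'h operator"

definition matrices :: "nat \<Rightarrow> 'h::chilbert_space operator set \<Rightarrow> 'h opmat set" where
  "matrices n N = {x. \<forall>i<n. \<forall>j<n. x i j \<in> N}"

definition mat_apply :: "nat \<Rightarrow> 'h::chilbert_space opmat \<Rightarrow> (nat \<Rightarrow> 'h) \<Rightarrow> nat \<Rightarrow> 'h" where
  "mat_apply n x \<xi> = (\<lambda>i. \<Sum>j<n. blinfun_apply (x i j) (\<xi> j))"

definition mat_norm :: "nat \<Rightarrow> 'h::chilbert_space opmat \<Rightarrow> real" where
  "mat_norm n x = (SUP \<xi>\<in>{\<xi>. L2_set (\<lambda>i. norm (\<xi> i)) {..<n} \<le> 1}.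
                     L2_set (\<lambda>i. norm (mat_apply n x \<xi> i)) {..<n})"

definition mat_mult :: "nat \<Rightarrow> 'h::chilbert_space opmat \<Rightarrow> 'h opmat \<Rightarrow> 'h opmat" where
  "mat_mult n x y = (\<lambda>i j. \<Sum>k<n. x i k o\<^sub>L y k j)"

definition mat_commutator :: "nat \<Rightarrow> 'h::chilbert_space opmat \<Rightarrow> 'h opmat \<Rightarrow> 'h opmat" where
  "mat_commutator n x y = (\<lambda>i j. mat_mult n x y i j - mat_mult n y x i j)"

definition mat_selfadjoint :: "nat \<Rightarrow> 'h::chilbert_space opmat \<Rightarrow> bool" where
  "mat_selfadjoint n x \<longleftrightarrow> (\<forall>i<n. \<forall>j<n. is_adjoint (x i j) (x j i))"

definition mat_positive :: "nat \<Rightarrow> 'h::chilbert_space opmat \<Rightarrow> bool" where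
  "mat_positive n x \<longleftrightarrow> (\<forall>\<xi>. (\<Sum>i<n. cinner (\<xi> i) (mat_apply n x \<xi> i)) \<in> \<real>\<^sub>\<ge>\<^sub>0)"

text \<open>The matrix of \<open>I_n \<otimes> s\<close>.\<close>

definition mat_diag :: "'h::chilbert_space operator \<Rightarrow> 'h opmat" where
  "mat_diag s = (\<lambda>i j. if i = j then s else 0)"

text \<open>The amplification \<open>id \<otimes> \<Phi>\<close>.\<close>

definition amplify ::
    "('h::chilbert_space operator \<Rightarrow> 'h operator) \<Rightarrow> 'h opmat \<Rightarrow> 'h opmat" where
  "amplify \<Phi> x = (\<lambda>i j. \<Phi> (x i j))"

section \<open>Channels, resource sets and the complete cost\<close>

definition completely_positive ::
    "'h::chilbert_space operator set \<Rightarrow> ('h operator \<Rightarrow> 'h operator) \<Rightarrow> bool" where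
  "completely_positive N \<Phi> \<longleftrightarrow>
     (\<forall>n. \<forall>x\<in>matrices n N. mat_positive n x \<longrightarrow> mat_positive n (amplify \<Phi> x))"

definition channel :: "'h::chilbert_space set \<Rightarrow> 'h operator set \<Rightarrow>
    ('h operator \<Rightarrow> 'h operator) \<Rightarrow> bool" where
  "channel H N \<Phi> \<longleftrightarrow> \<Phi> \<in> N \<rightarrow> N \<and> linear_map_on N \<Phi> \<and> \<Phi> (id_op H) = id_op H
     \<and> completely_positive N \<Phi> \<and> normal_map N N \<Phi>"

definition resource_set :: "'h::chilbert_space set \<Rightarrow> 'h operator set \<Rightarrow> 'h operator set \<Rightarrow> bool"
  where
  "resource_set H N S \<longleftrightarrow> finite S \<and> S \<subseteq> bounded_ops H \<and> von_neumann_algebra H (commutant H S)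
     \<and> (\<exists>E. normal_conditional_expectation N (commutant H S \<inter> N) E)"

text \<open>The supremum is taken in \<open>ennreal\<close>, so it is \<open>0\<close> if \<open>S\<close> is empty.\<close>

definition resource_seminorm ::
    "nat \<Rightarrow> 'h::chilbert_space operator set \<Rightarrow> 'h opmat \<Rightarrow> ennreal" where
  "resource_seminorm n S x = (SUP s\<in>S. ennreal (mat_norm n (mat_commutator n (mat_diag s) x)))"

definition cost_cb :: "'h::chilbert_space operator set \<Rightarrow> 'h operator set \<Rightarrow>
    ('h operator \<Rightarrow> 'h operator) \<Rightarrow> ennreal" where
  "cost_cb N S \<Phi> = (SUP n\<in>{1..}.
     SUP x\<in>{x \<in> matrices n N. mat_selfadjoint n x \<and> resource_seminorm n S x \<le> 1}.
       ennreal (mat_norm n (\<lambda>i j. amplify \<Phi> x i j - x i j)))"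

section \<open>Tensor products\<close>

text \<open>\<open>K\<close> with the elementary tensors \<open>t \<xi> = \<xi> 1 \<otimes> \<dots> \<otimes> \<xi> d\<close> is a Hilbert space tensor product of
  \<open>H 1, \<dots>, H d\<close>. This determines \<open>(K, t)\<close> up to a unique unitary; multilinearity of \<open>t\<close> is implied
  by the formula for the inner product.\<close>

definition hilbert_tensor :: "nat \<Rightarrow> (nat \<Rightarrow> 'h::chilbert_space set) \<Rightarrow>
    'k::chilbert_space set \<Rightarrow> ((nat \<Rightarrow> 'h) \<Rightarrow> 'k) \<Rightarrow> bool" where
  "hilbert_tensor d H K t \<longleftrightarrow> closed_csubspace K
     \<and> (\<forall>\<xi>\<in>Pi {1..d} H. \<forall>\<eta>\<in>Pi {1..d} H. cinner (t \<xi>) (t \<eta>) = (\<Prod>j=1..d. cinner (\<xi> j) (\<eta> j)))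
     \<and> closure (cspan (t ` Pi {1..d} H)) = K"

definition op_tensor :: "nat \<Rightarrow> (nat \<Rightarrow> 'h::chilbert_space set) \<Rightarrow> 'k::chilbert_space set \<Rightarrow>
    ((nat \<Rightarrow> 'h) \<Rightarrow> 'k) \<Rightarrow> (nat \<Rightarrow> 'h operator) \<Rightarrow> 'k operator" where
  "op_tensor d H K t x = (THE T. T \<in> bounded_ops K \<and>
     (\<forall>\<xi>\<in>Pi {1..d} H. blinfun_apply T (t \<xi>) = t (\<lambda>j. blinfun_apply (x j) (\<xi> j))))"

definition vn_tensor :: "nat \<Rightarrow> (nat \<Rightarrow> 'h::chilbert_space set) \<Rightarrow> 'k::chilbert_space set \<Rightarrow>
    ((nat \<Rightarrow> 'h) \<Rightarrow> 'k) \<Rightarrow> (nat \<Rightarrow> 'h operator set) \<Rightarrow> 'k operator set" where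
  "vn_tensor d H K t N =
     \<Inter> {M. von_neumann_algebra K M \<and> op_tensor d H K t ` Pi {1..d} N \<subseteq> M}"

definition tensor_position :: "nat \<Rightarrow> (nat \<Rightarrow> 'h::chilbert_space set) \<Rightarrow> 'k::chilbert_space set \<Rightarrow>
    ((nat \<Rightarrow> 'h) \<Rightarrow> 'k) \<Rightarrow> nat \<Rightarrow> 'h operator \<Rightarrow> 'k operator" where
  "tensor_position d H K t j X = op_tensor d H K t (\<lambda>i. if i = j then X else id_op (H i))"

definition resource_join :: "nat \<Rightarrow> (nat \<Rightarrow> 'h::chilbert_space set) \<Rightarrow> 'k::chilbert_space set \<Rightarrow>
    ((nat \<Rightarrow> 'h) \<Rightarrow> 'k) \<Rightarrow> (nat \<Rightarrow> 'h operator set) \<Rightarrow> 'k operator set" where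
  "resource_join d H K t S = (\<Union>j\<in>{1..d}. tensor_position d H K t j ` S j)"

text \<open>\<open>\<Psi>\<close> is the channel \<open>\<Phi> 1 \<otimes> \<dots> \<otimes> \<Phi> d\<close> on the von Neumann tensor product. It is a relation because
  maps are only determined on the algebra; there \<open>\<Psi>\<close> is unique, since it is ultraweakly continuous
  and the elementary tensors span an ultraweakly dense subspace.\<close>

definition is_tensor_channel :: "nat \<Rightarrow> (nat \<Rightarrow> 'h::chilbert_space set) \<Rightarrow>
    'k::chilbert_space set \<Rightarrow> ((nat \<Rightarrow> 'h) \<Rightarrow> 'k) \<Rightarrow> (nat \<Rightarrow> 'h operator set) \<Rightarrow>
    (nat \<Rightarrow> 'h operator \<Rightarrow> 'h operator) \<Rightarrow> ('k operator \<Rightarrow> 'k operator) \<Rightarrow> bool" where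
  "is_tensor_channel d H K t N \<Phi> \<Psi> \<longleftrightarrow> channel K (vn_tensor d H K t N) \<Psi>
     \<and> (\<forall>x\<in>Pi {1..d} N. \<Psi> (op_tensor d H K t x) = op_tensor d H K t (\<lambda>j. \<Phi> j (x j)))"

text \<open>\<open>\<Psi>\<close> is the channel acting as \<open>\<phi>\<close> on the factor \<open>j\<close> and as the identity on the others.\<close>

definition is_position_channel :: "nat \<Rightarrow> (nat \<Rightarrow> 'h::chilbert_space set) \<Rightarrow>
    'k::chilbert_space set \<Rightarrow> ((nat \<Rightarrow> 'h) \<Rightarrow> 'k) \<Rightarrow> (nat \<Rightarrow> 'h operator set) \<Rightarrow> nat \<Rightarrow>
    ('h operator \<Rightarrow> 'h operator) \<Rightarrow> ('k operator \<Rightarrow> 'k operator) \<Rightarrow> bool" where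
  "is_position_channel d H K t N j \<phi> \<Psi> \<longleftrightarrow>
     is_tensor_channel d H K t N (\<lambda>i. if i = j then \<phi> else id) \<Psi>"

end

theory Submission
  imports Defs
begin

text \<open>For the upper bound, the channel \<open>\<Phi> 1 \<otimes> \<dots> \<otimes> \<Phi> d\<close> is the composition of the channels in the single
  positions, because both are normal and agree on elementary tensors. Telescoping the composition
  bounds its displacement of a self-adjoint matrix by the sum of the single displacements, since
  unital completely positive maps do not increase the norm of a self-adjoint matrix.

  For the lower bound, take self-adjoint \<open>x j\<close> over \<open>N j\<close> with semi-norm at most \<open>1\<close> and consider the
  sum of the \<open>x j\<close> acting in their tensor positions. An element of \<open>S j\<close> in position \<open>j\<close> commutes with
  all summands but the \<open>j\<close>-th, so the semi-norm of the sum is still at most \<open>1\<close>. The displacement of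
  \<open>x j\<close> is self-adjoint, so after a change of sign of \<open>x j\<close> its norm is a supremum of values of its
  quadratic form at unit vectors; on the tensor product of such vectors these values add up.

  The extension of an operator to one tensor position, and the fact that this does not increase the
  norm of a matrix of operators, come from the Schur product theorem for positive kernels.\<close>

section \<open>Complex inner products\<close>

text \<open>The algebra \<open>vn_tensor\<close> is an intersection of von Neumann algebras, which
  by itself says nothing about density. Its elements come within reach once the ultraweakly closed
  span of the elementary tensors is seen to be an algebra already; normal linear maps that agree on
  elementary tensors then agree everywhere. Multiplication is ultraweakly continuous in each
  variable separately, which shapes that argument. Costs may be infinite, so suprema live in
  \<open>ennreal\<close>, where a negative value would be truncated to \<open>0\<close>. The lower
  bound adds up nonnegative values of quadratic forms rather than norms: the norm of a sum of
  operators in different positions is a priori just subadditive, whereas one product vector reaches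
  all the forms at once. The matrices may have different sizes, so their sum lives over
  multi-indices. A zero space has no unit vector and is treated apart. An operator on
  \<open>H\<close> is an operator on the ambient space that vanishes on the complement of
  \<open>H\<close>. The unit is thus a projection, and many estimates first compress vectors to
  \<open>H\<close>.\<close>

lemma cinner_add_left: "cinner (x + y) z = cinner x z + cinner y z"
  by (metis cinner_commute cinner_add_right complex_cnj_add)

lemma cinner_scaleC_left: "cinner (a *\<^sub>C x) y = cnj a * cinner x y"
  by (metis cinner_commute cinner_scaleC_right complex_cnj_mult)

lemma cinner_self: "cinner x x = complex_of_real ((norm x)\<^sup>2)"
proof -
  have "Im (cinner x x) = 0"
    using cinner_commute[of x x] by (metis Reals_cnj_iff complex_is_Real_iff)
  then show ?thesis
    by (simp add: complex_eq_iff Re_cinner power2_norm_eq_inner)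
qed

lemma norm_scaleC: "norm (c *\<^sub>C x) = cmod c * norm x"
proof -
  have "complex_of_real ((norm (c *\<^sub>C x))\<^sup>2) = complex_of_real ((cmod c * norm x)\<^sup>2)"
    unfolding cinner_self[symmetric] cinner_scaleC_left cinner_scaleC_right
    by (simp add: cinner_self power_mult_distrib complex_norm_square mult_ac
        del: of_real_power)
  then show ?thesis
    by (metis of_real_eq_iff mult_nonneg_nonneg norm_ge_zero power2_eq_imp_eq)
qed

lemma cmod_cinner_le: "cmod (cinner x y) \<le> norm x * norm y"
proof (cases "cinner x y = 0")
  case False
  \<comment> \<open>The phase that turns \<open>cinner x y\<close> into its modulus, so that the
    real Cauchy-Schwarz inequality applies to \<open>x\<close> and
    \<open>c *\<^sub>C y\<close>.\<close>
  define c where "c = cnj (cinner x y) / cmod (cinner x y)"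
  have c: "cmod c = 1"
    using False by (simp add: c_def norm_divide)
  have "cinner x (c *\<^sub>C y) = cmod (cinner x y)"
    using False unfolding cinner_scaleC_right c_def
    by (simp add: complex_norm_square[symmetric] power2_eq_square mult.commute[of "cnj _"])
  then have "cmod (cinner x y) = inner x (c *\<^sub>C y)"
    by (metis Re_cinner Re_complex_of_real)
  also have "\<dots> \<le> norm x * norm (c *\<^sub>C y)"
    by (rule norm_cauchy_schwarz)
  finally show ?thesis
    by (simp add: norm_scaleC c)
qed auto

text \<open>Antilinearity in the first argument is still real linearity, so over the reals the
  product is bilinear; the rules for sums, differences and limits follow.\<close>

lemma bounded_bilinear_cinner: "bounded_bilinear (cinner :: 'a::complex_inner \<Rightarrow> 'a \<Rightarrow> complex)"
proof
  show "cinner (r *\<^sub>R a) b = r *\<^sub>R cinner a b" and "cinner a (r *\<^sub>R b) = r *\<^sub>R cinner a b"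
    for r and a b :: 'a
    by (simp_all add: scaleC_of_real[symmetric] cinner_scaleC_left cinner_scaleC_right scaleR_conv_of_real)
  show "\<exists>K. \<forall>a b :: 'a. cmod (cinner a b) \<le> norm a * norm b * K"
    using cmod_cinner_le by (metis mult.right_neutral)
qed (simp_all add: cinner_add_left cinner_add_right)

interpretation cinner: bounded_bilinear "cinner :: 'a::complex_inner \<Rightarrow> 'a \<Rightarrow> complex"
  by (rule bounded_bilinear_cinner)

lemma bounded_bilinear_scaleC: "bounded_bilinear (scaleC :: complex \<Rightarrow> 'a::complex_inner \<Rightarrow> 'a)"
proof
  show "(r *\<^sub>R c) *\<^sub>C b = r *\<^sub>R (c *\<^sub>C b)" and "c *\<^sub>C (r *\<^sub>R b) = r *\<^sub>R (c *\<^sub>C b)"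
    for r c and b :: 'a
    by (simp_all add: scaleC_of_real[symmetric] scaleC_scaleC scaleR_conv_of_real mult.commute)
  show "\<exists>K. \<forall>c (b :: 'a). norm (c *\<^sub>C b) \<le> norm c * norm b * K"
    by (intro exI[of _ 1]) (simp add: norm_scaleC)
qed (simp_all add: scaleC_add_left scaleC_add_right)

interpretation scaleC: bounded_bilinear "scaleC :: complex \<Rightarrow> 'a::complex_inner \<Rightarrow> 'a"
  by (rule bounded_bilinear_scaleC)

lemma scaleC_1 [simp]: "1 *\<^sub>C x = (x :: 'a::complex_inner)"
  using scaleC_of_real[of 1 x] by simp

lemma scaleC_uminus_1 [simp]: "(- 1) *\<^sub>C x = - (x :: 'a::complex_inner)"
  using scaleC_of_real[of "-1" x] by simp

lemma cinner_eq_0_commute: "cinner x y = 0 \<longleftrightarrow> cinner y x = 0"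
  by (metis cinner_commute complex_cnj_zero)

lemma cinner_self_eq_0 [simp]: "cinner x x = 0 \<longleftrightarrow> x = 0"
  by (simp add: cinner_self)

lemma cinner_eqI: "x = y" if "\<And>u. cinner u x = cinner u y"
proof -
  have "cinner (x - y) (x - y) = 0"
    using that[of "x - y"] by (simp add: cinner.diff_right)
  then show ?thesis
    by simp
qed

section \<open>The projection theorem and adjoints\<close>

text \<open>A minimising sequence for the distance is Cauchy by the parallelogram identity, because
  midpoints stay in \<open>S\<close>. Its limit is a nearest point, and minimality along each line
  through it gives orthogonality.\<close>

lemma closed_subspace_projection:
  fixes S :: "'a::{real_inner,complete_space} set"
  assumes S: "subspace S" and "closed S"
  shows "\<exists>p\<in>S. \<forall>u\<in>S. inner u (v - p) = 0"
proof -
  define D where "D = infdist v S"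
  have ne: "S \<noteq> {}"
    using S subspace_0 by auto
  have D: "D \<le> norm (v - q)" if "q \<in> S" for q
    using infdist_le[OF that, of v] by (simp add: D_def dist_norm)
  have D0: "D \<ge> 0"
    by (simp add: D_def infdist_nonneg)
  have "\<exists>q\<in>S. norm (v - q) < D + 1 / Suc n" for n
  proof -
    have "(INF a\<in>S. dist v a) < D + 1 / Suc n"
      using ne by (simp add: D_def infdist_def)
    moreover have "bdd_below (dist v ` S)"
      by (rule bdd_belowI[of _ 0]) auto
    ultimately show ?thesis
      using ne by (subst (asm) cINF_less_iff) (auto simp: dist_norm)
  qed
  then obtain p where pS: "\<And>n. p n \<in> S" and p: "\<And>n. norm (v - p n) < D + 1 / Suc n"
    by metis
  have par: "(norm (p m - p n))\<^sup>2 \<le> 2 * (norm (v - p m))\<^sup>2 + 2 * (norm (v - p n))\<^sup>2 - 4 * D\<^sup>2" for m n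
  proof -
    have "(1/2) *\<^sub>R (p m + p n) \<in> S"
      using S pS by (intro subspace_scale subspace_add) auto
    then have "D \<le> norm (v - (1/2) *\<^sub>R (p m + p n))"
      by (rule D)
    then have "4 * D\<^sup>2 \<le> 4 * (norm (v - (1/2) *\<^sub>R (p m + p n)))\<^sup>2"
      using D0 by (simp add: power_mono)
    also have "\<dots> = 2 * (norm (v - p m))\<^sup>2 + 2 * (norm (v - p n))\<^sup>2 - (norm (p m - p n))\<^sup>2"
      unfolding power2_norm_eq_inner by (simp add: inner_simps inner_commute algebra_simps)
    finally show ?thesis
      by simp
  qed
  have lim: "(\<lambda>n. 1 / real (Suc n)) \<longlonglongrightarrow> 0"
    by (rule LIMSEQ_Suc[OF lim_1_over_n])
  have nlim: "(\<lambda>n. norm (v - p n)) \<longlonglongrightarrow> D"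
  proof (rule tendsto_sandwich[where f = "\<lambda>_. D" and h = "\<lambda>n. D + 1 / Suc n"])
    show "(\<lambda>n. D + 1 / Suc n) \<longlonglongrightarrow> D"
      using tendsto_add[OF tendsto_const lim, of D] by simp
    show "\<forall>\<^sub>F n in sequentially. D \<le> norm (v - p n)"
      using D pS by simp
    show "\<forall>\<^sub>F n in sequentially. norm (v - p n) \<le> D + 1 / Suc n"
      using p by (intro always_eventually allI less_imp_le)
  qed simp
  have "Cauchy p"
  proof (rule metric_CauchyI)
    fix e :: real
    assume e: "e > 0"
    have "(\<lambda>n. (norm (v - p n))\<^sup>2) \<longlonglongrightarrow> D\<^sup>2"
      by (intro tendsto_power nlim)
    then have "\<forall>\<^sub>F n in sequentially. (norm (v - p n))\<^sup>2 < D\<^sup>2 + e\<^sup>2 / 4"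
      using e by (intro order_tendstoD(2)) auto
    then obtain M where M: "\<And>n. n \<ge> M \<Longrightarrow> (norm (v - p n))\<^sup>2 < D\<^sup>2 + e\<^sup>2 / 4"
      by (auto simp: eventually_sequentially)
    have "dist (p m) (p n) < e" if "m \<ge> M" "n \<ge> M" for m n
    proof -
      have "(norm (p m - p n))\<^sup>2 < e\<^sup>2"
        using par[of m n] M[OF that(1)] M[OF that(2)] by simp
      then show ?thesis
        using e by (simp add: dist_norm power2_less_imp_less)
    qed
    then show "\<exists>M. \<forall>m\<ge>M. \<forall>n\<ge>M. dist (p m) (p n) < e"
      by blast
  qed
  then obtain q where q: "p \<longlonglongrightarrow> q"
    by (auto simp: Cauchy_convergent_iff convergent_def)
  have qS: "q \<in> S"
    using \<open>closed S\<close> pS q by (metis closed_sequentially)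
  have "(\<lambda>n. norm (v - p n)) \<longlonglongrightarrow> norm (v - q)"
    by (intro tendsto_intros q)
  then have nq: "norm (v - q) = D"
    using nlim LIMSEQ_unique by blast
  have "inner u (v - q) = 0" if "u \<in> S" for u
  proof (cases "u = 0")
    case False
    \<comment> \<open>The length at which moving from \<open>q\<close> along \<open>u\<close> comes
      closest to \<open>v\<close>; the distance would drop below \<open>D\<close> unless the inner
      product is \<open>0\<close>.\<close>
    define a where "a = inner u (v - q) / (norm u)\<^sup>2"
    have "q + a *\<^sub>R u \<in> S"
      using S qS that by (intro subspace_add subspace_scale) auto
    then have "(norm (v - q))\<^sup>2 \<le> (norm (v - (q + a *\<^sub>R u)))\<^sup>2"
      using D nq by (intro power_mono) auto
    also have "\<dots> = (norm (v - q))\<^sup>2 - (inner u (v - q))\<^sup>2 / (norm u)\<^sup>2"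
      using False unfolding power2_norm_eq_inner a_def
      by (simp add: inner_simps inner_commute field_simps power2_eq_square)
    finally show ?thesis
      using False by (simp add: divide_le_0_iff)
  qed simp
  with qS show ?thesis
    by blast
qed

text \<open>If \<open>f\<close> is not zero, its kernel has codimension one. The part
  \<open>z\<close> of \<open>v0\<close> orthogonal to the kernel spans the complement, and a
  multiple of \<open>z\<close> represents \<open>f\<close>.\<close>

lemma riesz_representation:
  fixes f :: "'a::{real_inner,complete_space} \<Rightarrow> real"
  assumes "bounded_linear f"
  shows "\<exists>w. \<forall>v. f v = inner w v"
proof (cases "\<forall>v. f v = 0")
  case True
  then show ?thesis
    by (intro exI[of _ 0]) simp
next
  case False
  interpret f: bounded_linear f
    by fact
  let ?S = "{v. f v = 0}"
  obtain v0 where v0: "f v0 \<noteq> 0"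
    using False by auto
  have "subspace ?S"
    by (auto simp: subspace_def f.zero f.add f.scaleR)
  moreover have "closed ?S"
    by (intro closed_Collect_eq continuous_intros f.continuous_on) 
  ultimately obtain p where p: "p \<in> ?S" "\<And>u. u \<in> ?S \<Longrightarrow> inner u (v0 - p) = 0"
    using closed_subspace_projection by metis
  define z where "z = v0 - p"
  have fz: "f z \<noteq> 0"
    using p v0 by (simp add: z_def f.diff)
  then have z: "z \<noteq> 0"
    by (auto simp: f.zero)
  have "f v = inner ((f z / (norm z)\<^sup>2) *\<^sub>R z) v" for v
  proof -
    have "inner (v - (f v / f z) *\<^sub>R z) z = 0"
      using p(2)[of "v - (f v / f z) *\<^sub>R z"] fz by (simp add: z_def[symmetric] f.diff f.scaleR)
    then have "inner z v = f v / f z * (norm z)\<^sup>2"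
      using fz by (simp add: inner_diff_left power2_norm_eq_inner inner_commute[of z v])
    then show ?thesis
      using fz z by simp
  qed
  then show ?thesis
    by blast
qed

lemma inner_adjoint_exists:
  fixes T :: "'a::{real_inner,complete_space} \<Rightarrow>\<^sub>L 'a"
  shows "\<exists>S::'a \<Rightarrow>\<^sub>L 'a. \<forall>u v. inner (S u) v = inner u (T v)"
proof -
  have "\<exists>w. \<forall>v. inner u (T v) = inner w v" for u
    by (rule riesz_representation)
      (intro bounded_linear_inner_right_comp blinfun.bounded_linear_right)
  then obtain S where S: "\<And>u v. inner (S u) v = inner u (T v)"
    by metis
  have "bounded_linear S"
  proof
    show "S (u + v) = S u + S v" for u v
      using S by (intro vector_eq_rdot[THEN iffD1]) (auto simp: inner_simps inner_commute)
    show "S (r *\<^sub>R u) = r *\<^sub>R S u" for r u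
      using S by (intro vector_eq_rdot[THEN iffD1]) (auto simp: inner_simps inner_commute)
    have "norm (S u) \<le> norm u * norm T" for u
    proof (cases "S u = 0")
      case False
      have "(norm (S u))\<^sup>2 = inner u (T (S u))"
        by (simp add: S[symmetric] power2_norm_eq_inner)
      also have "\<dots> \<le> norm u * (norm T * norm (S u))"
        by (rule order_trans[OF norm_cauchy_schwarz]) (intro mult_left_mono norm_blinfun norm_ge_zero)
      finally show ?thesis
        using False by (simp add: power2_eq_square)
    qed auto
    then show "\<exists>K. \<forall>u. norm (S u) \<le> norm u * K"
      by blast
  qed
  then show ?thesis
    using S by (intro exI[of _ "Blinfun S"]) (simp add: bounded_linear_Blinfun_apply)
qed

text \<open>The adjoint for the real inner product is already the complex one: up to sign, the
  imaginary part of \<open>cinner x y\<close> is the real inner product of \<open>x\<close> with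
  \<open>\<i> *\<^sub>C y\<close>, and \<open>T\<close> commutes with \<open>\<i>\<close>.\<close>

lemma adjoint_exists:
  fixes T :: "'h::chilbert_space operator"
  assumes T: "\<And>c v. T (c *\<^sub>C v) = c *\<^sub>C T v"
  shows "\<exists>S. is_adjoint T S"
proof -
  obtain S :: "'h operator" where S: "\<And>u v. inner (S u) v = inner u (T v)"
    using inner_adjoint_exists by blast
  have "cinner (S u) v = cinner u (T v)" for u v
  proof (rule complex_eqI)
    show "Re (cinner (S u) v) = Re (cinner u (T v))"
      by (simp add: Re_cinner S)
    have "Im (cinner x y) = - inner x (\<i> *\<^sub>C y)" for x y :: 'h
      by (simp add: Re_cinner[symmetric] cinner_scaleC_right)
    then show "Im (cinner (S u) v) = Im (cinner u (T v))"
      by (simp add: S T)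
  qed
  then show ?thesis
    unfolding is_adjoint_def by blast
qed

lemma is_adjoint_unique: "is_adjoint T S \<Longrightarrow> is_adjoint T S' \<Longrightarrow> S = S'"
  unfolding is_adjoint_def
  by (intro blinfun_eqI cinner_eqI) (metis cinner_commute)

lemma is_adjoint_sym: "is_adjoint T S \<Longrightarrow> is_adjoint S T"
  unfolding is_adjoint_def by (metis cinner_commute)

lemma is_adjoint_add: "is_adjoint T S \<Longrightarrow> is_adjoint T' S' \<Longrightarrow> is_adjoint (T + T') (S + S')"
  by (simp add: is_adjoint_def blinfun.add_left cinner_add_left cinner_add_right)

lemma is_adjoint_diff: "is_adjoint T S \<Longrightarrow> is_adjoint T' S' \<Longrightarrow> is_adjoint (T - T') (S - S')"
  by (simp add: is_adjoint_def blinfun.diff_left cinner.diff_left cinner.diff_right)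

lemma is_adjoint_0 [simp]: "is_adjoint 0 0"
  by (simp add: is_adjoint_def cinner.zero_left cinner.zero_right)

lemma is_adjoint_sum:
  "(\<And>i. i \<in> A \<Longrightarrow> is_adjoint (T i) (S i)) \<Longrightarrow> is_adjoint (\<Sum>i\<in>A. T i) (\<Sum>i\<in>A. S i)"
  by (induction A rule: infinite_finite_induct) (auto intro: is_adjoint_add)

lemma scaleC_op_apply [simp]: "blinfun_apply (scaleC_op c T) v = c *\<^sub>C T v"
  unfolding scaleC_op_def
  by (subst bounded_linear_Blinfun_apply)
    (intro bounded_linear_compose[OF scaleC.bounded_linear_right] blinfun.bounded_linear_right refl)+

lemma scaleC_op_uminus_1: "scaleC_op (- 1) T = - T"
  by (rule blinfun_eqI) (simp add: blinfun.minus_left)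

lemma is_adjoint_scaleC_op: "is_adjoint T S \<Longrightarrow> is_adjoint (scaleC_op c T) (scaleC_op (cnj c) S)"
  by (simp add: is_adjoint_def cinner_scaleC_left cinner_scaleC_right)

lemma is_adjoint_compose: "is_adjoint T S \<Longrightarrow> is_adjoint T' S' \<Longrightarrow> is_adjoint (T o\<^sub>L T') (S' o\<^sub>L S)"
  by (simp add: is_adjoint_def)

section \<open>Operators on a closed subspace\<close>

lemma csubspace_sum:
  assumes "closed_csubspace H" "\<And>i. i \<in> A \<Longrightarrow> u i \<in> H"
  shows "(\<Sum>i\<in>A. u i) \<in> H"
  using assms(2)
  by (induction A rule: infinite_finite_induct) (use assms(1) in \<open>auto simp: closed_csubspace_def\<close>)

lemma csubspace_diff: "closed_csubspace H \<Longrightarrow> u \<in> H \<Longrightarrow> v \<in> H \<Longrightarrow> u - v \<in> H"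
  by (metis closed_csubspace_def diff_conv_add_uminus scaleC_uminus_1)

lemma csubspace_subspace: "closed_csubspace H \<Longrightarrow> subspace H"
  unfolding closed_csubspace_def subspace_def by (metis scaleC_of_real)

lemma csubspace_orthogonal_decomposition:
  fixes H :: "'h::chilbert_space set"
  assumes H: "closed_csubspace H"
  shows "\<exists>p\<in>H. \<forall>u\<in>H. cinner u (v - p) = 0"
proof -
  obtain p where p: "p \<in> H" "\<And>u. u \<in> H \<Longrightarrow> inner u (v - p) = 0"
    using closed_subspace_projection[OF csubspace_subspace[OF H]] H unfolding closed_csubspace_def
    by metis
  have "cinner u (v - p) = 0" if u: "u \<in> H" for u
  proof (rule complex_eqI)
    \<comment> \<open>Real orthogonality to \<open>\<i> *\<^sub>C u\<close> as well as to
      \<open>u\<close> amounts to complex orthogonality to \<open>u\<close>.\<close>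
    have "\<i> *\<^sub>C u \<in> H"
      using H u by (simp add: closed_csubspace_def)
    then have "Re (cinner (\<i> *\<^sub>C u) (v - p)) = 0"
      unfolding Re_cinner by (rule p)
    then show "Im (cinner u (v - p)) = Im 0"
      by (simp add: cinner_scaleC_left)
  qed (simp add: Re_cinner p u)
  with p show ?thesis
    by blast
qed

lemma bounded_opsD:
  assumes "T \<in> bounded_ops H"
  shows "T (c *\<^sub>C v) = c *\<^sub>C T v" "T v \<in> H" "(\<And>u. u \<in> H \<Longrightarrow> cinner u v = 0) \<Longrightarrow> T v = 0"
  using assms by (auto simp: bounded_ops_def)

text \<open>\<open>P v\<close> is the only point of \<open>H\<close> whose difference from
  \<open>v\<close> is orthogonal to \<open>H\<close>. Additivity, homogeneity and the values of
  \<open>P\<close> are all read off from this uniqueness.\<close>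

lemma id_op_exists:
  fixes H :: "'h::chilbert_space set"
  assumes H: "closed_csubspace H"
  shows "\<exists>P \<in> bounded_ops H. \<forall>v\<in>H. blinfun_apply P v = v"
proof -
  obtain P where P: "\<And>v. P v \<in> H" "\<And>u v. u \<in> H \<Longrightarrow> cinner u (v - P v) = 0"
    using csubspace_orthogonal_decomposition[OF H] by metis
  have uniq: "P v = p" if "p \<in> H" "\<And>u. u \<in> H \<Longrightarrow> cinner u (v - p) = 0" for v p
  proof -
    have d: "P v - p \<in> H"
      by (rule csubspace_diff[OF H P(1) that(1)])
    have "cinner (P v - p) (P v - p) = cinner (P v - p) (v - p) - cinner (P v - p) (v - P v)"
      by (simp add: cinner.diff_right)
    also have "\<dots> = 0"
      using that(2)[OF d] P(2)[OF d] by simp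
    finally show ?thesis
      by simp
  qed
  have cl: "P (c *\<^sub>C v) = c *\<^sub>C P v" for c v
  proof (rule uniq)
    show "c *\<^sub>C P v \<in> H"
      using H P by (simp add: closed_csubspace_def)
    show "cinner u (c *\<^sub>C v - c *\<^sub>C P v) = 0" if "u \<in> H" for u
      using P(2)[OF that, of v] by (simp add: scaleC.diff_right[symmetric] cinner_scaleC_right)
  qed
  have "bounded_linear P"
  proof
    show "P (v + w) = P v + P w" for v w
    proof (rule uniq)
      show "P v + P w \<in> H"
        using H P by (simp add: closed_csubspace_def)
      show "cinner u (v + w - (P v + P w)) = 0" if "u \<in> H" for u
        using P(2)[OF that, of v] P(2)[OF that, of w] by (simp add: cinner.diff_right cinner.add_right)
    qed
    show "P (r *\<^sub>R v) = r *\<^sub>R P v" for r v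
      using cl[of "of_real r" v] by (simp add: scaleC_of_real)
    have "norm (P v) \<le> norm v * 1" for v
    proof (cases "P v = 0")
      case False
      have "(norm (P v))\<^sup>2 = Re (cinner (P v) v)"
        using P(2)[OF P(1), of v v] by (simp add: cinner.diff_right cinner_self)
      also have "\<dots> \<le> norm (P v) * norm v"
        unfolding Re_cinner by (rule norm_cauchy_schwarz)
      finally show ?thesis
        using False by (simp add: power2_eq_square)
    qed auto
    then show "\<exists>K. \<forall>v. norm (P v) \<le> norm v * K"
      by blast
  qed
  then have ap: "blinfun_apply (Blinfun P) = P"
    by (rule bounded_linear_Blinfun_apply)
  have "P v = 0" if "\<forall>u\<in>H. cinner u v = 0" for v
    using that H by (intro uniq) (auto simp: closed_csubspace_def)
  moreover have "P v = v" if "v \<in> H" for v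
    using that by (intro uniq) (auto simp: cinner.zero_right)
  ultimately show ?thesis
    using cl P(1) by (intro bexI[of _ "Blinfun P"]) (auto simp: bounded_ops_def ap)
qed

lemma bounded_ops_eqI:
  assumes H: "closed_csubspace H" and "T \<in> bounded_ops H" "T' \<in> bounded_ops H"
    and eq: "\<And>v. v \<in> H \<Longrightarrow> blinfun_apply T v = blinfun_apply T' v"
  shows "T = T'"
proof (rule blinfun_eqI)
  fix v
  obtain p where p: "p \<in> H" "\<And>u. u \<in> H \<Longrightarrow> cinner u (v - p) = 0"
    using csubspace_orthogonal_decomposition[OF H] by metis
  have "T (v - p) = 0" "T' (v - p) = 0"
    using assms p(2) by (auto intro: bounded_opsD)
  then show "T v = T' v"
    using eq[OF p(1)] by (simp add: blinfun.diff_right)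
qed

lemma id_op:
  assumes "closed_csubspace H"
  shows "id_op H \<in> bounded_ops H" "v \<in> H \<Longrightarrow> id_op H v = v"
proof -
  obtain P where P: "P \<in> bounded_ops H" "\<forall>v\<in>H. blinfun_apply P v = v"
    using id_op_exists[OF assms] by blast
  have "id_op H \<in> bounded_ops H \<and> (\<forall>v\<in>H. id_op H v = v)"
    unfolding id_op_def
  proof (rule theI)
    show "Q = P" if "Q \<in> bounded_ops H \<and> (\<forall>v\<in>H. blinfun_apply Q v = v)" for Q
      using that P by (intro bounded_ops_eqI[OF assms]) auto
  qed (use P in auto)
  then show "id_op H \<in> bounded_ops H" "v \<in> H \<Longrightarrow> id_op H v = v"
    by auto
qed

lemma cinner_id_op:
  assumes H: "closed_csubspace H" and "u \<in> H"
  shows "cinner u (id_op H v) = cinner u v"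
proof -
  obtain p where p: "p \<in> H" "\<And>u. u \<in> H \<Longrightarrow> cinner u (v - p) = 0"
    using csubspace_orthogonal_decomposition[OF H] by metis
  have "id_op H (v - p) = 0"
    using id_op(1)[OF H] p(2) by (rule bounded_opsD)
  then have "id_op H v = p"
    using id_op(2)[OF H p(1)] by (simp add: blinfun.diff_right)
  then show ?thesis
    using p(2)[OF \<open>u \<in> H\<close>] by (simp add: cinner.diff_right)
qed

lemma bounded_ops_id_op:
  assumes H: "closed_csubspace H" and T: "T \<in> bounded_ops H"
  shows "T (id_op H v) = T v"
proof -
  have "T (id_op H v - v) = 0"
    using T by (rule bounded_opsD) (simp add: cinner.diff_right cinner_id_op[OF H])
  then show ?thesis
    by (simp add: blinfun.diff_right)
qed

lemma is_adjoint_id_op: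
  assumes H: "closed_csubspace H"
  shows "is_adjoint (id_op H) (id_op H)"
  unfolding is_adjoint_def
  by (metis H cinner_id_op cinner_commute id_op(1) bounded_opsD(2))

lemma norm_id_op_le:
  assumes H: "closed_csubspace H"
  shows "norm (id_op H v) \<le> norm v"
proof -
  have "(norm (id_op H v))\<^sup>2 = Re (cinner (id_op H v) v)"
    using cinner_id_op[OF H, of "id_op H v" v] id_op(1)[OF H] by (metis Re_complex_of_real cinner_self bounded_opsD(2))
  also have "\<dots> \<le> norm (id_op H v) * norm v"
    unfolding Re_cinner by (rule norm_cauchy_schwarz)
  finally show ?thesis
    by (cases "id_op H v = 0") (auto simp: power2_eq_square)
qed

lemma bounded_ops_closed:
  assumes H: "closed_csubspace H"
  shows "0 \<in> bounded_ops H"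
    and "T \<in> bounded_ops H \<Longrightarrow> S \<in> bounded_ops H \<Longrightarrow> T + S \<in> bounded_ops H"
    and "T \<in> bounded_ops H \<Longrightarrow> scaleC_op c T \<in> bounded_ops H"
    and "T \<in> bounded_ops H \<Longrightarrow> S \<in> bounded_ops H \<Longrightarrow> T o\<^sub>L S \<in> bounded_ops H"
    and "T \<in> bounded_ops H \<Longrightarrow> S \<in> bounded_ops H \<Longrightarrow> T - S \<in> bounded_ops H"
  using H csubspace_diff[OF H]
  by (auto simp: bounded_ops_def closed_csubspace_def blinfun.add_left blinfun.diff_left
      scaleC_add_right scaleC.diff_right scaleC_scaleC mult.commute scaleC.zero_right blinfun.zero_right)

lemma bounded_ops_adjoint:
  assumes H: "closed_csubspace H" and T: "T \<in> bounded_ops H" and S: "is_adjoint T S"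
  shows "S \<in> bounded_ops H"
proof -
  \<comment> \<open>\<open>T\<close> absorbs the self-adjoint projection on the right, so its
    adjoint absorbs it on the left.\<close>
  have "S = id_op H o\<^sub>L S"
    using is_adjoint_compose[OF _ is_adjoint_id_op[OF H], of T S] S T
    by (metis (no_types, lifting) H bounded_ops_id_op blinfun_apply_blinfun_compose blinfun_eqI is_adjoint_unique)
  then have "S v \<in> H" for v
    by (metis blinfun_apply_blinfun_compose bounded_opsD(2) id_op(1)[OF H])
  moreover have "S (c *\<^sub>C v) = c *\<^sub>C S v" for c v
    using S by (intro cinner_eqI) (metis is_adjoint_sym[OF S] is_adjoint_def cinner_scaleC_right)
  moreover have "S v = 0" if "\<forall>u\<in>H. cinner u v = 0" for v
  proof (rule cinner_eqI)
    show "cinner u (S v) = cinner u 0" for u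
      using that bounded_opsD(2)[OF T, of u] is_adjoint_sym[OF S]
      by (simp add: is_adjoint_def cinner.zero_right) (metis)
  qed
  ultimately show ?thesis
    by (auto simp: bounded_ops_def)
qed

section \<open>The ultraweak topology\<close>

lemma topspace_ultraweak [simp]: "topspace ultraweak_topology = UNIV"
proof -
  have "square_summable (\<lambda>_. 0)"
    by (simp add: square_summable_def)
  then show ?thesis
    unfolding ultraweak_topology_def topology_generated_by_topspace by blast
qed

lemma continuous_map_ultraweak_functional:
  assumes "square_summable \<xi>" "square_summable \<eta>"
  shows "continuous_map ultraweak_topology euclidean (\<lambda>T. \<Sum>k. cinner (\<xi> k) (blinfun_apply T (\<eta> k)))"
  unfolding continuous_map
proof (intro conjI allI impI)
  fix U :: "complex set"
  assume "openin euclidean U"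
  then show "openin ultraweak_topology {x \<in> topspace ultraweak_topology.
      (\<Sum>k. cinner (\<xi> k) (blinfun_apply x (\<eta> k))) \<in> U}"
    unfolding topspace_ultraweak unfolding ultraweak_topology_def
    using assms by (intro topology_generated_by_Basis) auto
qed auto

lemma continuous_map_into_ultraweak:
  fixes f :: "'a \<Rightarrow> 'h::chilbert_space operator"
  assumes "\<And>\<xi> \<eta>. square_summable \<xi> \<Longrightarrow> square_summable \<eta> \<Longrightarrow>
    continuous_map X euclidean (\<lambda>x. \<Sum>k. cinner (\<xi> k) (blinfun_apply (f x) (\<eta> k)))"
  shows "continuous_map X ultraweak_topology f"
  unfolding ultraweak_topology_def
proof (rule continuous_on_generated_topo)
  show "openin X (f -` U \<inter> topspace X)"
    if "U \<in> {{T. (\<Sum>k. cinner (\<xi> k) (blinfun_apply T (\<eta> k))) \<in> U} | \<xi> \<eta> U.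
          square_summable \<xi> \<and> square_summable \<eta> \<and> open U}" for U
  proof -
    from that obtain \<xi> \<eta> W where "square_summable \<xi>" "square_summable \<eta>" "open W"
      and U: "U = {T. (\<Sum>k. cinner (\<xi> k) (blinfun_apply T (\<eta> k))) \<in> W}"
      by auto
    then have "openin X {x \<in> topspace X. (\<Sum>k. cinner (\<xi> k) (blinfun_apply (f x) (\<eta> k))) \<in> W}"
      by (intro openin_continuous_map_preimage[OF assms]) auto
    moreover have "f -` U \<inter> topspace X
        = {x \<in> topspace X. (\<Sum>k. cinner (\<xi> k) (blinfun_apply (f x) (\<eta> k))) \<in> W}"
      using U by auto
    ultimately show ?thesis
      by simp
  qed
  show "f ` topspace X \<subseteq> \<Union> {{T. (\<Sum>k. cinner (\<xi> k) (blinfun_apply T (\<eta> k))) \<in> U} | \<xi> \<eta> U.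
          square_summable \<xi> \<and> square_summable \<eta> \<and> open U}"
    using topspace_ultraweak[where 'a='h]
    unfolding ultraweak_topology_def topology_generated_by_topspace by (simp only: subset_UNIV)
qed

text \<open>Two summands, because the homogeneity of \<open>T\<close> is the vanishing of such a
  sum, with \<open>- cnj c *\<^sub>C u\<close> for \<open>u'\<close>.\<close>

lemma continuous_map_matrix_coefficients:
  "continuous_map ultraweak_topology euclidean
     (\<lambda>T. cinner u (blinfun_apply T v) + cinner u' (blinfun_apply T v'))"
proof -
  define \<xi> where "\<xi> = (\<lambda>k::nat. if k = 0 then u else if k = 1 then u' else 0)"
  define \<eta> where "\<eta> = (\<lambda>k::nat. if k = 0 then v else if k = 1 then v' else 0)"
  have "square_summable \<xi>" "square_summable \<eta>"
    unfolding square_summable_def \<xi>_def \<eta>_def by (rule summable_finite[of "{0,1}"]; simp)+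
  then have "continuous_map ultraweak_topology euclidean
      (\<lambda>T. \<Sum>k. cinner (\<xi> k) (blinfun_apply T (\<eta> k)))"
    by (rule continuous_map_ultraweak_functional)
  moreover have "(\<Sum>k. cinner (\<xi> k) (blinfun_apply T (\<eta> k)))
      = cinner u (blinfun_apply T v) + cinner u' (blinfun_apply T v')" for T
    by (subst suminf_finite[of "{0,1}"]) (auto simp: \<xi>_def \<eta>_def cinner.zero_left)
  ultimately show ?thesis
    by simp
qed

lemma continuous_map_matrix_coefficient:
  "continuous_map ultraweak_topology euclidean (\<lambda>T. cinner u (blinfun_apply T v))"
  using continuous_map_matrix_coefficients[of u v 0 0] by (simp add: cinner.zero_left)

lemma Hausdorff_space_ultraweak: "Hausdorff_space (ultraweak_topology :: 'h::chilbert_space operator topology)"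
  unfolding Hausdorff_space_def
proof (intro allI impI, elim conjE)
  fix x y :: "'h operator"
  assume "x \<noteq> y"
  then obtain u v where uv: "cinner u (x v) \<noteq> cinner u (y v)"
    by (metis blinfun_eqI cinner_eqI)
  then obtain U V where UV: "open U" "open V" "cinner u (x v) \<in> U" "cinner u (y v) \<in> V" "U \<inter> V = {}"
    by (metis hausdorff)
  let ?P = "\<lambda>U. {T::'h operator. cinner u (T v) \<in> U}"
  have "openin ultraweak_topology (?P W)" if "open W" for W
    using openin_continuous_map_preimage[OF continuous_map_matrix_coefficient[of u v], of W] that
    by simp
  then show "\<exists>U V. openin ultraweak_topology U \<and> openin ultraweak_topology V \<and> x \<in> U \<and> y \<in> V \<and> disjnt U V"
    using UV by (intro exI[of _ "?P U"] exI[of _ "?P V"]) (auto simp: disjnt_def)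
qed

lemma square_summable_blinfun:
  assumes "square_summable \<xi>"
  shows "square_summable (\<lambda>k. blinfun_apply T (\<xi> k))"
  unfolding square_summable_def
proof (rule summable_comparison_test)
  show "summable (\<lambda>k. (norm T)\<^sup>2 * (norm (\<xi> k))\<^sup>2)"
    using assms by (auto simp: square_summable_def)
  show "\<exists>N. \<forall>k\<ge>N. norm ((norm (blinfun_apply T (\<xi> k)))\<^sup>2) \<le> (norm T)\<^sup>2 * (norm (\<xi> k))\<^sup>2"
    by (auto simp: power_mult_distrib[symmetric] intro!: power_mono norm_blinfun)
qed

lemma continuous_map_compose_right:
  "continuous_map ultraweak_topology ultraweak_topology (\<lambda>T. T o\<^sub>L e)"
proof (rule continuous_map_into_ultraweak)
  fix \<xi> \<eta> :: "nat \<Rightarrow> 'a"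
  assume "square_summable \<xi>" "square_summable \<eta>"
  then show "continuous_map ultraweak_topology euclidean
      (\<lambda>T. \<Sum>k. cinner (\<xi> k) (blinfun_apply (T o\<^sub>L e) (\<eta> k)))"
    using continuous_map_ultraweak_functional[OF _ square_summable_blinfun] by simp
qed

lemma continuous_map_compose_left:
  assumes "is_adjoint e e'"
  shows "continuous_map ultraweak_topology ultraweak_topology (\<lambda>T. e o\<^sub>L T)"
proof (rule continuous_map_into_ultraweak)
  fix \<xi> \<eta> :: "nat \<Rightarrow> 'a"
  assume "square_summable \<xi>" "square_summable \<eta>"
  then have "continuous_map ultraweak_topology euclidean
      (\<lambda>T. \<Sum>k. cinner (e' (\<xi> k)) (blinfun_apply T (\<eta> k)))"
    by (intro continuous_map_ultraweak_functional square_summable_blinfun)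
  then show "continuous_map ultraweak_topology euclidean
      (\<lambda>T. \<Sum>k. cinner (\<xi> k) (blinfun_apply (e o\<^sub>L T) (\<eta> k)))"
    using assms by (simp add: is_adjoint_def)
qed

lemma summable_ultraweak_functional:
  assumes "square_summable \<xi>" "square_summable \<eta>"
  shows "summable (\<lambda>k. cinner (\<xi> k) (\<eta> k))"
proof (rule summable_comparison_test)
  show "summable (\<lambda>k. (norm (\<xi> k))\<^sup>2 + (norm (\<eta> k))\<^sup>2)"
    using assms by (auto simp: square_summable_def intro: summable_add)
  have "norm (cinner (\<xi> k) (\<eta> k)) \<le> (norm (\<xi> k))\<^sup>2 + (norm (\<eta> k))\<^sup>2" for k
  proof -
    have "norm (cinner (\<xi> k) (\<eta> k)) \<le> norm (\<xi> k) * norm (\<eta> k)"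
      by (rule cmod_cinner_le)
    also have "\<dots> \<le> 2 * norm (\<xi> k) * norm (\<eta> k)"
      by simp
    also have "\<dots> \<le> (norm (\<xi> k))\<^sup>2 + (norm (\<eta> k))\<^sup>2"
      by (rule sum_squares_bound)
    finally show ?thesis .
  qed
  then show "\<exists>N. \<forall>k\<ge>N. norm (cinner (\<xi> k) (\<eta> k)) \<le> (norm (\<xi> k))\<^sup>2 + (norm (\<eta> k))\<^sup>2"
    by blast
qed

text \<open>The functionals of the adjoint are conjugates of functionals with the two sequences
  exchanged. The domain is cut down to \<open>B\<close> because \<open>adj\<close> is specified
  there alone.\<close>

lemma continuous_map_adjoint:
  assumes adj: "\<And>T. T \<in> B \<Longrightarrow> is_adjoint T (adj T)"
  shows "continuous_map (subtopology ultraweak_topology B) ultraweak_topology adj"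
proof (rule continuous_map_into_ultraweak)
  fix \<xi> \<eta> :: "nat \<Rightarrow> 'a"
  assume sq: "square_summable \<xi>" "square_summable \<eta>"
  have "continuous_map euclidean euclidean cnj"
    by (simp add: continuous_on_cnj continuous_on_id)
  then have "continuous_map ultraweak_topology euclidean
      (cnj \<circ> (\<lambda>T. \<Sum>k. cinner (\<eta> k) (blinfun_apply T (\<xi> k))))"
    using continuous_map_ultraweak_functional[OF sq(2,1)] continuous_map_compose by blast
  then have "continuous_map (subtopology ultraweak_topology B) euclidean
      (cnj \<circ> (\<lambda>T. \<Sum>k. cinner (\<eta> k) (blinfun_apply T (\<xi> k))))"
    by (rule continuous_map_from_subtopology)
  then show "continuous_map (subtopology ultraweak_topology B) euclidean
      (\<lambda>T. \<Sum>k. cinner (\<xi> k) (blinfun_apply (adj T) (\<eta> k)))"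
  proof (rule continuous_map_eq)
    fix T :: "'a operator"
    assume "T \<in> topspace (subtopology ultraweak_topology B)"
    then have T: "is_adjoint T (adj T)"
      using adj by simp
    \<comment> \<open>Convergence lets conjugation pass through the series.\<close>
    have "summable (\<lambda>k. cinner (\<eta> k) (blinfun_apply T (\<xi> k)))"
      using sq by (intro summable_ultraweak_functional square_summable_blinfun)
    then have "cnj (\<Sum>k. cinner (\<eta> k) (blinfun_apply T (\<xi> k)))
        = (\<Sum>k. cnj (cinner (\<eta> k) (blinfun_apply T (\<xi> k))))"
      by (rule bounded_linear.suminf[OF bounded_linear_cnj])
    also have "\<dots> = (\<Sum>k. cinner (\<xi> k) (blinfun_apply (adj T) (\<eta> k)))"
      using T by (intro suminf_cong) (metis is_adjoint_def cinner_commute)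
    finally show "(cnj \<circ> (\<lambda>T. \<Sum>k. cinner (\<eta> k) (blinfun_apply T (\<xi> k)))) T
        = (\<Sum>k. cinner (\<xi> k) (blinfun_apply (adj T) (\<eta> k)))"
      by simp
  qed
qed

lemma closedin_matrix_coefficients_eq_0:
  "closedin ultraweak_topology {T. cinner u (blinfun_apply T v) + cinner u' (blinfun_apply T v') = 0}"
  using closedin_continuous_map_preimage[OF continuous_map_matrix_coefficients[of u v u' v'],
      where C = "{0}"]
  by simp

text \<open>A closed subspace is its own double orthogonal complement. This turns membership in
  \<open>H\<close> into the vanishing of inner products, an ultraweakly closed condition on
  operators.\<close>

lemma csubspace_memI:
  fixes H :: "'h::chilbert_space set"
  assumes H: "closed_csubspace H" and v: "\<And>w. (\<And>u. u \<in> H \<Longrightarrow> cinner u w = 0) \<Longrightarrow> cinner w v = 0"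
  shows "v \<in> H"
proof -
  obtain p where p: "p \<in> H" "\<And>u. u \<in> H \<Longrightarrow> cinner u (v - p) = 0"
    using csubspace_orthogonal_decomposition[OF H] by metis
  have "cinner (v - p) v = 0"
    using p(2) by (rule v)
  moreover have "cinner (v - p) p = 0"
    using p by (metis cinner_eq_0_commute)
  ultimately have "cinner (v - p) (v - p) = 0"
    by (simp add: cinner.diff_right)
  then show ?thesis
    using p(1) by simp
qed

text \<open>Each clause of \<open>bounded_ops\<close> says that certain matrix coefficients vanish.
  Intersecting all zero sets that contain \<open>bounded_ops H\<close> treats the clauses uniformly:
  a member of the intersection is tested against whichever zero set a clause calls for.\<close>

lemma closedin_bounded_ops:
  fixes H :: "'h::chilbert_space set"
  assumes H: "closed_csubspace H"
  shows "closedin ultraweak_topology (bounded_ops H)"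
proof -
  let ?Z = "\<lambda>u v u' v'. {T :: 'h operator. cinner u (T v) + cinner u' (T v') = 0}"
  let ?O = "{v. \<forall>u\<in>H. cinner u v = 0}"
  define F where "F = {?Z u v u' v' | u v u' v'. bounded_ops H \<subseteq> ?Z u v u' v'}"
  have "bounded_ops H = \<Inter>F"
  proof (intro equalityI subsetI)
    fix T
    assume T: "T \<in> \<Inter>F"
    have Z: "cinner u (T v) + cinner u' (T v') = 0"
      if "\<And>S. S \<in> bounded_ops H \<Longrightarrow> cinner u (S v) + cinner u' (S v') = 0" for u v u' v'
    proof -
      have "?Z u v u' v' \<in> F"
        using that unfolding F_def by blast
      then show ?thesis
        using T by blast
    qed
    have "T (c *\<^sub>C v) = c *\<^sub>C T v" for c v
    proof (rule cinner_eqI)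
      fix u
      have "cinner u (T (c *\<^sub>C v)) + cinner (- cnj c *\<^sub>C u) (T v) = 0"
        by (rule Z) (simp add: bounded_opsD(1) cinner_scaleC_left cinner_scaleC_right)
      then show "cinner u (T (c *\<^sub>C v)) = cinner u (c *\<^sub>C T v)"
        by (simp add: cinner_scaleC_left cinner_scaleC_right)
    qed
    moreover have "T v \<in> H" for v
    proof (rule csubspace_memI[OF H])
      fix w
      assume w: "\<And>u. u \<in> H \<Longrightarrow> cinner u w = 0"
      have "cinner w (T v) + cinner 0 (T v) = 0"
        using w bounded_opsD(2)[of _ H] by (intro Z) (simp add: cinner.zero_left cinner_eq_0_commute[of w])
      then show "cinner w (T v) = 0"
        by (simp add: cinner.zero_left)
    qed
    moreover have "T v = 0" if "\<forall>u\<in>H. cinner u v = 0" for v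
    proof (rule cinner_eqI)
      fix u
      have "cinner u (T v) + cinner 0 (T v) = 0"
        using that bounded_opsD(3)[of _ H v] by (intro Z) (simp add: cinner.zero_left cinner.zero_right)
      then show "cinner u (T v) = cinner u 0"
        by (simp add: cinner.zero_left cinner.zero_right)
    qed
    ultimately show "T \<in> bounded_ops H"
      by (simp add: bounded_ops_def)
  qed (auto simp: F_def)
  also have "closedin ultraweak_topology (\<Inter>F)"
  proof (rule closedin_Inter)
    have "bounded_ops H \<subseteq> ?Z 0 0 0 0"
      by (simp add: cinner.zero_left)
    then have "?Z 0 0 0 0 \<in> F"
      unfolding F_def by blast
    then show "F \<noteq> {}"
      by blast
  qed (use closedin_matrix_coefficients_eq_0 in \<open>auto simp: F_def\<close>)
  finally show ?thesis .
qed

section \<open>Ultraweakly closed spans and the algebras they generate\<close>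

definition ultraweakly_closed_subspace :: "'h::chilbert_space operator set \<Rightarrow> bool" where
  "ultraweakly_closed_subspace V \<longleftrightarrow> closedin ultraweak_topology V
     \<and> (\<forall>x\<in>V. \<forall>y\<in>V. x + y \<in> V) \<and> (\<forall>c. \<forall>x\<in>V. scaleC_op c x \<in> V)"

text \<open>The ultraweak closure of the linear span. As an intersection it comes with an induction
  principle: a property passes from \<open>E\<close> to the span if it cuts out an ultraweakly
  closed subspace.\<close>

definition ultraweak_span :: "'h::chilbert_space operator set \<Rightarrow> 'h operator set" where
  "ultraweak_span E = \<Inter> {V. ultraweakly_closed_subspace V \<and> E \<subseteq> V}"

lemma ultraweak_span_least: "ultraweakly_closed_subspace V \<Longrightarrow> E \<subseteq> V \<Longrightarrow> ultraweak_span E \<subseteq> V"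
  unfolding ultraweak_span_def by blast

lemma ultraweak_span_superset: "E \<subseteq> ultraweak_span E"
  unfolding ultraweak_span_def by blast

lemma ultraweakly_closed_subspace_span: "ultraweakly_closed_subspace (ultraweak_span E)"
proof -
  have "ultraweakly_closed_subspace UNIV"
    unfolding ultraweakly_closed_subspace_def using closedin_topspace[of ultraweak_topology] by simp
  then have "closedin ultraweak_topology (ultraweak_span E)"
    unfolding ultraweak_span_def
    by (intro closedin_Inter) (auto simp: ultraweakly_closed_subspace_def)
  then show ?thesis
    unfolding ultraweakly_closed_subspace_def ultraweak_span_def by blast
qed

lemma von_neumann_algebra_closed_subspace:
  "von_neumann_algebra K M \<Longrightarrow> ultraweakly_closed_subspace M"
  by (simp add: von_neumann_algebra_def ultraweakly_closed_subspace_def)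

lemma ultraweakly_closed_subspace_bounded_ops:
  "closed_csubspace H \<Longrightarrow> ultraweakly_closed_subspace (bounded_ops H)"
  by (simp add: ultraweakly_closed_subspace_def closedin_bounded_ops bounded_ops_closed)

lemma closedin_preimage_Int:
  assumes "continuous_map ultraweak_topology ultraweak_topology f" and V: "closedin ultraweak_topology V"
  shows "closedin ultraweak_topology {x \<in> V. f x \<in> V}"
proof -
  have "closedin ultraweak_topology (V \<inter> {x \<in> topspace ultraweak_topology. f x \<in> V})"
    using assms by (intro closedin_Int closedin_continuous_map_preimage[of _ ultraweak_topology])
  also have "V \<inter> {x \<in> topspace ultraweak_topology. f x \<in> V} = {x \<in> V. f x \<in> V}"
    by auto
  finally show ?thesis .
qed

lemma compose_add_left: "(x + y) o\<^sub>L z = (x o\<^sub>L z) + (y o\<^sub>L z)"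
  by (rule blinfun_eqI) (simp add: blinfun.add_left)

lemma compose_add_right: "z o\<^sub>L (x + y) = (z o\<^sub>L x) + (z o\<^sub>L y)"
  by (rule blinfun_eqI) (simp add: blinfun.add_left blinfun.add_right)

lemma compose_scaleC_left: "scaleC_op c x o\<^sub>L z = scaleC_op c (x o\<^sub>L z)"
  by (rule blinfun_eqI) simp

lemma compose_scaleC_right: "z \<in> bounded_ops H \<Longrightarrow> z o\<^sub>L scaleC_op c x = scaleC_op c (z o\<^sub>L x)"
  by (rule blinfun_eqI) (simp add: bounded_opsD(1))

text \<open>Multiplication is continuous in one variable at a time, so closure under products is
  reached in two stages, one for each factor. Closure under adjoints follows from the continuity of
  the adjoint.\<close>

lemma von_neumann_algebra_ultraweak_span:
  fixes K :: "'k::chilbert_space set"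
  assumes K: "closed_csubspace K" and EK: "E \<subseteq> bounded_ops K" and "id_op K \<in> E"
    and mult: "\<And>x y. x \<in> E \<Longrightarrow> y \<in> E \<Longrightarrow> x o\<^sub>L y \<in> E"
    and adj: "\<And>x. x \<in> E \<Longrightarrow> \<exists>y\<in>E. is_adjoint x y"
  shows "von_neumann_algebra K (ultraweak_span E)"
proof -
  let ?M = "ultraweak_span E"
  have ME: "E \<subseteq> ?M"
    by (rule ultraweak_span_superset)
  have sub: "ultraweakly_closed_subspace ?M"
    by (rule ultraweakly_closed_subspace_span)
  then have Mcl: "closedin ultraweak_topology ?M" and Madd: "\<And>x y. x \<in> ?M \<Longrightarrow> y \<in> ?M \<Longrightarrow> x + y \<in> ?M"
    and Mscale: "\<And>c x. x \<in> ?M \<Longrightarrow> scaleC_op c x \<in> ?M"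
    by (auto simp: ultraweakly_closed_subspace_def)
  have MB: "?M \<subseteq> bounded_ops K"
    using EK by (intro ultraweak_span_least ultraweakly_closed_subspace_bounded_ops[OF K])
  \<comment> \<open>First stage: a left factor \<open>e\<close> in \<open>E\<close> is kept fixed.
    Multiplication by it is continuous because \<open>e\<close> has an adjoint to move to the other
    side.\<close>
  have left: "e o\<^sub>L y \<in> ?M" if e: "e \<in> E" and y: "y \<in> ?M" for e y
  proof -
    obtain e' where e': "is_adjoint e e'"
      using adj[OF e] by blast
    have eB: "e \<in> bounded_ops K"
      using e EK by blast
    have "ultraweakly_closed_subspace {y \<in> ?M. e o\<^sub>L y \<in> ?M}"
      unfolding ultraweakly_closed_subspace_def
      using closedin_preimage_Int[OF continuous_map_compose_left[OF e'] Mcl]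
      by (simp add: compose_add_right compose_scaleC_right[OF eB] Madd Mscale)
    moreover have "E \<subseteq> {y \<in> ?M. e o\<^sub>L y \<in> ?M}"
      using ME mult[OF e] by auto
    ultimately have "?M \<subseteq> {y \<in> ?M. e o\<^sub>L y \<in> ?M}"
      by (rule ultraweak_span_least)
    then show ?thesis
      using y by blast
  qed
  \<comment> \<open>Second stage: the right factor \<open>y\<close> is an arbitrary fixed element of
    the span, and the left factor passes from \<open>E\<close> to the span.\<close>
  have mult': "x o\<^sub>L y \<in> ?M" if x: "x \<in> ?M" and y: "y \<in> ?M" for x y
  proof -
    have "ultraweakly_closed_subspace {x \<in> ?M. x o\<^sub>L y \<in> ?M}"
      unfolding ultraweakly_closed_subspace_def
      using closedin_preimage_Int[OF continuous_map_compose_right[of y] Mcl]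
      by (simp add: compose_add_left compose_scaleC_left Madd Mscale)
    moreover have "E \<subseteq> {x \<in> ?M. x o\<^sub>L y \<in> ?M}"
      using ME left[OF _ y] by auto
    ultimately have "?M \<subseteq> {x \<in> ?M. x o\<^sub>L y \<in> ?M}"
      by (rule ultraweak_span_least)
    then show ?thesis
      using x by blast
  qed
  obtain ad :: "'k operator \<Rightarrow> 'k operator"
    where ad: "\<And>T. T \<in> bounded_ops K \<Longrightarrow> is_adjoint T (ad T)"
    using adjoint_exists bounded_opsD(1) by metis
  \<comment> \<open>The preimage of the span under the adjoint. It is closed relative to
    \<open>bounded_ops K\<close>, hence closed; uniqueness of adjoints makes it a subspace.\<close>
  define V where "V = {x \<in> bounded_ops K. ad x \<in> ?M}"
  have "closedin (subtopology ultraweak_topology (bounded_ops K)) V"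
    using closedin_continuous_map_preimage[OF continuous_map_adjoint[OF ad] Mcl]
    by (simp add: V_def)
  then have "closedin ultraweak_topology V"
    using closedin_bounded_ops[OF K] closedin_trans_full by blast
  moreover have "x + y \<in> V" if "x \<in> V" "y \<in> V" for x y
  proof -
    have "ad (x + y) = ad x + ad y"
      using that ad bounded_ops_closed(2)[OF K, of x y] unfolding V_def
      by (intro is_adjoint_unique[of "x + y"] is_adjoint_add) auto
    then show ?thesis
      using that bounded_ops_closed(2)[OF K, of x y] Madd by (simp add: V_def)
  qed
  moreover have "scaleC_op c x \<in> V" if "x \<in> V" for c x
  proof -
    have "ad (scaleC_op c x) = scaleC_op (cnj c) (ad x)"
      using that ad bounded_ops_closed(3)[OF K, of x] unfolding V_def
      by (intro is_adjoint_unique[of "scaleC_op c x"] is_adjoint_scaleC_op) auto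
    then show ?thesis
      using that bounded_ops_closed(3)[OF K, of x] Mscale by (simp add: V_def)
  qed
  moreover have "E \<subseteq> V"
  proof
    fix x
    assume x: "x \<in> E"
    then obtain y where "y \<in> E" "is_adjoint x y"
      using adj by blast
    then show "x \<in> V"
      using x EK ME ad is_adjoint_unique unfolding V_def by blast
  qed
  ultimately have "?M \<subseteq> V"
    by (intro ultraweak_span_least) (auto simp: ultraweakly_closed_subspace_def)
  then have "\<exists>y\<in>?M. is_adjoint x y" if "x \<in> ?M" for x
    using that ad unfolding V_def by blast
  then show ?thesis
    using K MB ME[THEN subsetD, OF \<open>id_op K \<in> E\<close>] Madd Mscale mult' Mcl
    by (simp add: von_neumann_algebra_def)
qed

text \<open>The set where \<open>f\<close> and \<open>g\<close> agree is closed in \<open>M\<close>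
  since the topology is Hausdorff, and closed outright since \<open>M\<close> is; so the induction
  principle of the span applies.\<close>

lemma normal_linear_maps_eq:
  assumes M: "ultraweakly_closed_subspace M" and "M = ultraweak_span E"
    and lin: "linear_map_on M f" "linear_map_on M g" and normal: "normal_map M M f" "normal_map M M g"
    and eq: "\<And>x. x \<in> E \<Longrightarrow> f x = g x" and "x \<in> M"
  shows "f x = g x"
proof -
  let ?V = "{x \<in> M. f x = g x}"
  have "closedin (subtopology ultraweak_topology M) {x \<in> topspace (subtopology ultraweak_topology M). f x = g x}"
    using normal unfolding normal_map_def
    by (intro closedin_continuous_maps_eq[OF Hausdorff_space_subtopology[OF Hausdorff_space_ultraweak]])
  then have "closedin ultraweak_topology ?V"
    using M closedin_trans_full by (auto simp: ultraweakly_closed_subspace_def)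
  then have "ultraweakly_closed_subspace ?V"
    using M lin unfolding ultraweakly_closed_subspace_def linear_map_on_def by auto
  moreover have "E \<subseteq> ?V"
    using eq ultraweak_span_superset[of E] \<open>M = ultraweak_span E\<close> by auto
  ultimately have "M \<subseteq> ?V"
    using ultraweak_span_least \<open>M = ultraweak_span E\<close> by blast
  then show ?thesis
    using \<open>x \<in> M\<close> by blast
qed

section \<open>Matrices of operators\<close>

abbreviation vec_norm :: "nat \<Rightarrow> (nat \<Rightarrow> 'h::real_normed_vector) \<Rightarrow> real" where
  "vec_norm n \<xi> \<equiv> L2_set (\<lambda>i. norm (\<xi> i)) {..<n}"

lemma vec_norm_sq: "(vec_norm n \<xi>)\<^sup>2 = (\<Sum>i<n. (norm (\<xi> i))\<^sup>2)"
  by (simp add: L2_set_def sum_nonneg)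

lemma L2_set_zero [simp]: "L2_set (\<lambda>i. 0) A = 0"
  by (simp add: L2_set_def)

lemma vec_norm_triangle: "vec_norm n (\<lambda>i. \<xi> i + \<eta> i) \<le> vec_norm n \<xi> + vec_norm n \<eta>"
  by (rule order_trans[OF L2_set_mono L2_set_triangle_ineq]) (auto intro: norm_triangle_ineq)

lemma vec_norm_scaleR: "vec_norm n (\<lambda>i. r *\<^sub>R \<xi> i) = \<bar>r\<bar> * vec_norm n \<xi>"
  by (simp add: L2_set_right_distrib)

lemma mat_apply_scaleR: "mat_apply n x (\<lambda>i. r *\<^sub>R \<xi> i) = (\<lambda>i. r *\<^sub>R mat_apply n x \<xi> i)"
  by (simp add: mat_apply_def blinfun.scaleR_right scaleR_sum_right)

lemma mat_apply_add_left:
  "mat_apply n (\<lambda>i j. x i j + y i j) \<xi> = (\<lambda>i. mat_apply n x \<xi> i + mat_apply n y \<xi> i)"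
  by (simp add: mat_apply_def blinfun.add_left sum.distrib)

text \<open>The constant is crude; it guarantees that \<open>mat_norm\<close> is the supremum of a
  bounded set of reals.\<close>

lemma mat_apply_bounded: "\<exists>C\<ge>0. \<forall>\<xi>. vec_norm n (mat_apply n x \<xi>) \<le> C * vec_norm n \<xi>"
proof (intro exI[of _ "\<Sum>i<n. \<Sum>j<n. norm (x i j)"] conjI allI)
  fix \<xi>
  have "norm (mat_apply n x \<xi> i) \<le> (\<Sum>j<n. norm (x i j)) * vec_norm n \<xi>" for i
  proof -
    have "norm (mat_apply n x \<xi> i) \<le> (\<Sum>j<n. norm (x i j) * norm (\<xi> j))"
      unfolding mat_apply_def by (rule sum_norm_le) (rule norm_blinfun)
    also have "\<dots> \<le> (\<Sum>j<n. norm (x i j) * vec_norm n \<xi>)"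
      by (intro sum_mono mult_left_mono member_le_L2_set) auto
    finally show ?thesis
      by (simp add: sum_distrib_right)
  qed
  then have "(\<Sum>i<n. norm (mat_apply n x \<xi> i)) \<le> (\<Sum>i<n. \<Sum>j<n. norm (x i j)) * vec_norm n \<xi>"
    unfolding sum_distrib_right[of _ "{..<n}" "vec_norm n \<xi>"] by (intro sum_mono) (simp add: sum_distrib_right)
  then show "vec_norm n (mat_apply n x \<xi>) \<le> (\<Sum>i<n. \<Sum>j<n. norm (x i j)) * vec_norm n \<xi>"
    by (rule order_trans[OF L2_set_le_sum, rotated]) simp
qed (simp add: sum_nonneg)

lemma mat_norm_le:
  assumes "\<And>\<xi>. vec_norm n (mat_apply n x \<xi>) \<le> C * vec_norm n \<xi>" "C \<ge> 0"
  shows "mat_norm n x \<le> C"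
  unfolding mat_norm_def
proof (rule cSUP_least)
  show "{\<xi>. vec_norm n \<xi> \<le> 1} \<noteq> {}"
    by (auto intro!: exI[of _ "\<lambda>_. 0"])
  show "vec_norm n (mat_apply n x \<xi>) \<le> C" if "\<xi> \<in> {\<xi>. vec_norm n \<xi> \<le> 1}" for \<xi>
    using assms(1)[of \<xi>] mult_left_mono[OF _ assms(2), of "vec_norm n \<xi>" 1] that by simp
qed

lemma mat_norm_upper:
  assumes "vec_norm n \<xi> \<le> 1"
  shows "vec_norm n (mat_apply n x \<xi>) \<le> mat_norm n x"
proof -
  obtain C where C: "C \<ge> 0" "\<And>\<xi>. vec_norm n (mat_apply n x \<xi>) \<le> C * vec_norm n \<xi>"
    using mat_apply_bounded by blast
  have "vec_norm n (mat_apply n x \<xi>) \<le> C * 1" if "vec_norm n \<xi> \<le> 1" for \<xi>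
    using that by (rule order_trans[OF C(2) mult_left_mono[OF _ C(1)]])
  then have "bdd_above ((\<lambda>\<xi>. vec_norm n (mat_apply n x \<xi>)) ` {\<xi>. vec_norm n \<xi> \<le> 1})"
    by (intro bdd_aboveI[of _ "C * 1"]) auto
  then show ?thesis
    unfolding mat_norm_def using assms by (intro cSUP_upper) auto
qed

lemma mat_norm_nonneg: "0 \<le> mat_norm n x"
  by (rule order_trans[OF L2_set_nonneg mat_norm_upper[where \<xi> = "\<lambda>_. 0"]]) simp

lemma mat_norm_bound: "vec_norm n (mat_apply n x \<xi>) \<le> mat_norm n x * vec_norm n \<xi>"
proof (cases "vec_norm n \<xi> = 0")
  case True
  then show ?thesis
    using mat_apply_bounded[of n x] by (metis mult_zero_right)
next
  case False
  then have pos: "vec_norm n \<xi> > 0"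
    by (simp add: less_le)
  have "vec_norm n (mat_apply n x (\<lambda>i. (1 / vec_norm n \<xi>) *\<^sub>R \<xi> i)) \<le> mat_norm n x"
    using pos by (intro mat_norm_upper) (simp only: vec_norm_scaleR, simp)
  then have "(1 / vec_norm n \<xi>) * vec_norm n (mat_apply n x \<xi>) \<le> mat_norm n x"
    using pos by (simp only: mat_apply_scaleR vec_norm_scaleR) simp
  then show ?thesis
    using pos by (simp add: field_simps)
qed

lemma mat_norm_triangle: "mat_norm n (\<lambda>i j. x i j + y i j) \<le> mat_norm n x + mat_norm n y"
proof (rule mat_norm_le)
  fix \<xi>
  have "vec_norm n (mat_apply n (\<lambda>i j. x i j + y i j) \<xi>)
      \<le> vec_norm n (mat_apply n x \<xi>) + vec_norm n (mat_apply n y \<xi>)"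
    unfolding mat_apply_add_left by (rule vec_norm_triangle)
  also have "\<dots> \<le> (mat_norm n x + mat_norm n y) * vec_norm n \<xi>"
    using mat_norm_bound[of n x \<xi>] mat_norm_bound[of n y \<xi>] by (simp add: distrib_right)
  finally show "vec_norm n (mat_apply n (\<lambda>i j. x i j + y i j) \<xi>) \<le> (mat_norm n x + mat_norm n y) * vec_norm n \<xi>" .
qed (simp add: mat_norm_nonneg)

lemma mat_apply_cong:
  "(\<And>i j. i < n \<Longrightarrow> j < n \<Longrightarrow> x i j = y i j) \<Longrightarrow> i < n \<Longrightarrow> mat_apply n x \<xi> i = mat_apply n y \<xi> i"
  by (simp add: mat_apply_def)

lemma mat_norm_cong:
  assumes "\<And>i j. i < n \<Longrightarrow> j < n \<Longrightarrow> x i j = y i j"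
  shows "mat_norm n x = mat_norm n y"
proof -
  have "vec_norm n (mat_apply n x \<xi>) = vec_norm n (mat_apply n y \<xi>)" for \<xi>
    by (intro L2_set_cong) (auto simp: mat_apply_cong[OF assms])
  then show ?thesis
    by (simp add: mat_norm_def)
qed

lemma mat_norm_uminus: "mat_norm n (\<lambda>i j. - x i j) = mat_norm n x"
  by (simp add: mat_norm_def mat_apply_def blinfun.minus_left sum_negf)

lemma mat_norm_0 [simp]: "mat_norm n (\<lambda>i j. 0) = 0"
  by (intro antisym mat_norm_le mat_norm_nonneg) (simp_all add: mat_apply_def)

section \<open>Sesquilinear forms of operator matrices and the numerical radius\<close>

definition mat_form :: "nat \<Rightarrow> 'h::chilbert_space opmat \<Rightarrow> (nat \<Rightarrow> 'h) \<Rightarrow> (nat \<Rightarrow> 'h) \<Rightarrow> complex" where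
  "mat_form n x \<xi> \<eta> = (\<Sum>i<n. cinner (\<xi> i) (mat_apply n x \<eta> i))"

lemma mat_form_expand: "mat_form n x \<xi> \<eta> = (\<Sum>i<n. \<Sum>j<n. cinner (\<xi> i) (x i j (\<eta> j)))"
  by (simp add: mat_form_def mat_apply_def cinner.sum_right)

lemma mat_form_add: "mat_form n (\<lambda>i j. x i j + y i j) \<xi> \<eta> = mat_form n x \<xi> \<eta> + mat_form n y \<xi> \<eta>"
  by (simp add: mat_form_expand blinfun.add_left cinner.add_right sum.distrib)

lemma mat_form_hermitian:
  assumes "mat_selfadjoint n x"
  shows "mat_form n x \<eta> \<xi> = cnj (mat_form n x \<xi> \<eta>)"
proof -
  have "cnj (mat_form n x \<xi> \<eta>) = (\<Sum>i<n. \<Sum>j<n. cinner (x i j (\<eta> j)) (\<xi> i))"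
    by (simp add: mat_form_expand cinner_commute[symmetric])
  also have "\<dots> = (\<Sum>i<n. \<Sum>j<n. cinner (\<eta> j) (x j i (\<xi> i)))"
    using assms by (intro sum.cong refl) (auto simp: mat_selfadjoint_def is_adjoint_def)
  also have "\<dots> = mat_form n x \<eta> \<xi>"
    unfolding mat_form_expand by (rule sum.swap)
  finally show ?thesis ..
qed

text \<open>Polarisation: a sesquilinear form whose quadratic form is real is Hermitian. Vectors
  supported in one coordinate isolate the single entries.\<close>

lemma mat_selfadjointI:
  fixes x :: "'h::chilbert_space opmat"
  assumes lin: "\<And>i j c v. i < n \<Longrightarrow> j < n \<Longrightarrow> x i j (c *\<^sub>C v) = c *\<^sub>C x i j v"
    and real: "\<And>\<xi>. mat_form n x \<xi> \<xi> \<in> \<real>"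
  shows "mat_selfadjoint n x"
  unfolding mat_selfadjoint_def is_adjoint_def
proof (intro allI impI)
  fix i j u v
  assume ij: "i < n" "j < n"
  define e where "e = (\<lambda>(i::nat) (u::'h) (k::nat). if k = i then u else 0)"
  have form: "mat_form n x (e i u) (e j v) = cinner u (x i j v)" if "i < n" "j < n" for i j u v
  proof -
    have "mat_apply n x (e j v) k = (\<Sum>l<n. if l = j then x k j v else 0)" for k
      unfolding mat_apply_def e_def by (intro sum.cong refl) (simp add: blinfun.zero_right)
    then have "mat_form n x (e i u) (e j v) = (\<Sum>k<n. if k = i then cinner u (x k j v) else 0)"
      unfolding mat_form_def e_def using that
      by (intro sum.cong refl) (simp add: cinner.zero_left)
    then show ?thesis
      using that by simp
  qed
  have polar: "Im (cinner u (x i j v) + cinner v (x j i u)) = 0" for u v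
  proof -
    let ?w = "\<lambda>k. e i u k + e j v k"
    have "mat_form n x ?w ?w = mat_form n x (e i u) (e i u) + mat_form n x (e i u) (e j v)
        + mat_form n x (e j v) (e i u) + mat_form n x (e j v) (e j v)"
      by (simp add: mat_form_expand cinner.add_left cinner.add_right blinfun.add_right sum.distrib)
    then have "Im (mat_form n x (e i u) (e j v) + mat_form n x (e j v) (e i u)) = 0"
      using real[of ?w] real[of "e i u"] real[of "e j v"] by (auto simp: complex_is_Real_iff)
    then show ?thesis
      using ij by (simp add: form)
  qed
  have "cinner u (x i j v) = cnj (cinner v (x j i u))"
  proof (rule complex_eqI)
    show "Im (cinner u (x i j v)) = Im (cnj (cinner v (x j i u)))"
      using polar[of u v] by simp
    \<comment> \<open>Putting \<open>\<i> *\<^sub>C v\<close> for \<open>v\<close> in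
      \<open>polar\<close> trades imaginary parts for real parts.\<close>
    have "Im (\<i> * cinner u (x i j v) - \<i> * cinner v (x j i u)) = 0"
      using polar[of u "\<i> *\<^sub>C v"] ij by (simp add: lin cinner_scaleC_left cinner_scaleC_right)
    then show "Re (cinner u (x i j v)) = Re (cnj (cinner v (x j i u)))"
      by simp
  qed
  then show "cinner (x j i u) v = cinner u (x i j v)"
    by (simp add: cinner_commute[symmetric])
qed

lemma Re_mat_form_le: "Re (mat_form n x \<xi> \<xi>) \<le> vec_norm n \<xi> * vec_norm n (mat_apply n x \<xi>)"
proof -
  have "Re (mat_form n x \<xi> \<xi>) \<le> (\<Sum>i<n. \<bar>norm (\<xi> i)\<bar> * \<bar>norm (mat_apply n x \<xi> i)\<bar>)"
    unfolding mat_form_def Re_sum Re_cinner by (intro sum_mono) (simp add: norm_cauchy_schwarz)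
  also have "\<dots> \<le> vec_norm n \<xi> * vec_norm n (mat_apply n x \<xi>)"
    by (rule L2_set_mult_ineq)
  finally show ?thesis .
qed

lemma Re_mat_form_le_mat_norm: "Re (mat_form n x \<xi> \<xi>) \<le> mat_norm n x * (vec_norm n \<xi>)\<^sup>2"
proof -
  have "Re (mat_form n x \<xi> \<xi>) \<le> vec_norm n \<xi> * (mat_norm n x * vec_norm n \<xi>)"
    by (rule order_trans[OF Re_mat_form_le]) (intro mult_left_mono mat_norm_bound L2_set_nonneg)
  then show ?thesis
    by (simp add: power2_eq_square mult_ac)
qed

lemma mat_form_uminus: "mat_form n (\<lambda>i j. - x i j) \<xi> \<eta> = - mat_form n x \<xi> \<eta>"
  by (simp add: mat_form_expand blinfun.minus_left cinner.minus_right sum_negf)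

lemma abs_mat_form_le_mat_norm: "\<bar>Re (mat_form n x \<xi> \<xi>)\<bar> \<le> mat_norm n x * (vec_norm n \<xi>)\<^sup>2"
  using Re_mat_form_le_mat_norm[of n x \<xi>] Re_mat_form_le_mat_norm[of n "\<lambda>i j. - x i j" \<xi>]
  by (simp add: mat_norm_uminus mat_form_uminus)

text \<open>For a Hermitian form, the values at \<open>\<xi> + r y\<close> and
  \<open>\<xi> - r y\<close> with \<open>y\<close> the image of \<open>\<xi>\<close> differ by
  \<open>4 r\<close> times the squared norm of \<open>y\<close>. Bounding both values and applying
  the parallelogram identity compares the norms of \<open>y\<close> and
  \<open>\<xi>\<close>.\<close>

lemma mat_norm_le_numerical_radius:
  assumes sa: "mat_selfadjoint n x" and c: "c \<ge> 0"
    and num: "\<And>\<xi>. \<bar>Re (mat_form n x \<xi> \<xi>)\<bar> \<le> c * (vec_norm n \<xi>)\<^sup>2"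
  shows "mat_norm n x \<le> c"
proof (rule mat_norm_le[OF _ c])
  fix \<xi>
  let ?y = "mat_apply n x \<xi>"
  let ?M = "(vec_norm n \<xi>)\<^sup>2" and ?N = "(vec_norm n ?y)\<^sup>2"
  have key: "2 * r * ?N \<le> c * (?M + r\<^sup>2 * ?N)" for r
  proof -
    let ?\<eta> = "\<lambda>i. r *\<^sub>R ?y i"
    let ?p = "\<lambda>i. \<xi> i + ?\<eta> i" and ?m = "\<lambda>i. \<xi> i - ?\<eta> i"
    have "mat_form n x ?p ?p - mat_form n x ?m ?m = 2 * (mat_form n x \<xi> ?\<eta> + mat_form n x ?\<eta> \<xi>)"
      unfolding mat_form_expand
      by (simp add: cinner.add_left cinner.add_right cinner.diff_left cinner.diff_right
          blinfun.add_right blinfun.diff_right sum.distrib sum_subtractf algebra_simps)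
    also have "Re \<dots> = 4 * Re (mat_form n x ?\<eta> \<xi>)"
      using mat_form_hermitian[OF sa, of \<xi> ?\<eta>] by simp
    also have "Re (mat_form n x ?\<eta> \<xi>) = r * ?N"
      unfolding mat_form_def vec_norm_sq Re_sum Re_cinner sum_distrib_left
      by (intro sum.cong refl) (simp add: power2_norm_eq_inner)
    finally have "4 * (r * ?N) = Re (mat_form n x ?p ?p) - Re (mat_form n x ?m ?m)"
      by simp
    also have "\<dots> \<le> c * (vec_norm n ?p)\<^sup>2 + c * (vec_norm n ?m)\<^sup>2"
      using num[of ?p] num[of ?m] by linarith
    also have "\<dots> = c * ((vec_norm n ?p)\<^sup>2 + (vec_norm n ?m)\<^sup>2)"
      by (rule distrib_left[symmetric])
    also have "(vec_norm n ?p)\<^sup>2 + (vec_norm n ?m)\<^sup>2 = 2 * ?M + 2 * (r\<^sup>2 * ?N)"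
      unfolding vec_norm_sq sum_distrib_left sum.distrib[symmetric]
    proof (intro sum.cong refl)
      have "(norm (a + b))\<^sup>2 + (norm (a - b))\<^sup>2 = 2 * (norm a)\<^sup>2 + 2 * (norm b)\<^sup>2" for a b :: 'a
        unfolding power2_norm_eq_inner by (simp add: inner_simps inner_commute)
      then show "(norm (?p i))\<^sup>2 + (norm (?m i))\<^sup>2 = 2 * (norm (\<xi> i))\<^sup>2 + 2 * (r\<^sup>2 * (norm (?y i))\<^sup>2)" for i
        by (simp add: power_mult_distrib)
    qed
    also have "c * (2 * ?M + 2 * (r\<^sup>2 * ?N)) = 2 * (c * (?M + r\<^sup>2 * ?N))"
      by (simp only: distrib_left mult.left_commute)
    finally have "2 * (2 * r * ?N) \<le> 2 * (c * (?M + r\<^sup>2 * ?N))"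
      by simp
    then show ?thesis
      by (simp only: mult_le_cancel_left_pos zero_less_numeral)
  qed
  have "?N \<le> c\<^sup>2 * ?M"
  proof (cases "c = 0")
    case True
    then show ?thesis
      using key[of 1] by simp
  next
    case False
    \<comment> \<open>The choice \<open>r = 1 / c\<close> makes the inequality \<open>key\<close>
      sharpest.\<close>
    have "2 * (1 / c) * ?N \<le> c * ?M + (1 / c) * ?N"
      using key[of "1 / c"] False by (simp add: power2_eq_square distrib_left)
    then have "(1 / c) * ?N \<le> c * ?M"
      by (simp add: algebra_simps)
    then show ?thesis
      using False c by (simp add: field_simps power2_eq_square)
  qed
  then have "?N \<le> (c * vec_norm n \<xi>)\<^sup>2"
    by (simp add: power_mult_distrib)
  then show "vec_norm n ?y \<le> c * vec_norm n \<xi>"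
    using c by (intro power2_le_imp_le[of "vec_norm n ?y"]) auto
qed

lemma mat_positive_iff: "mat_positive n x \<longleftrightarrow> (\<forall>\<xi>. mat_form n x \<xi> \<xi> \<in> \<real>\<^sub>\<ge>\<^sub>0)"
  by (simp add: mat_positive_def mat_form_def)

lemma mat_form_diag: "mat_form n (mat_diag s) \<xi> \<eta> = (\<Sum>i<n. cinner (\<xi> i) (s (\<eta> i)))"
proof -
  have "mat_form n (mat_diag s) \<xi> \<eta> = (\<Sum>i<n. \<Sum>j<n. if j = i then cinner (\<xi> i) (s (\<eta> i)) else 0)"
    unfolding mat_form_expand mat_diag_def
    by (intro sum.cong refl) (auto simp: cinner.zero_right)
  then show ?thesis
    by simp
qed

lemma mat_commutator_diag:
  assumes "i < n" "j < n"
  shows "mat_commutator n (mat_diag s) x i j = (s o\<^sub>L x i j) - (x i j o\<^sub>L s)"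
proof -
  have "mat_mult n (mat_diag s) x i j = (\<Sum>k<n. if k = i then s o\<^sub>L x i j else 0)"
    unfolding mat_mult_def mat_diag_def by (intro sum.cong refl) auto
  moreover have "mat_mult n x (mat_diag s) i j = (\<Sum>k<n. if k = j then x i j o\<^sub>L s else 0)"
    unfolding mat_mult_def mat_diag_def by (intro sum.cong refl) auto
  ultimately show ?thesis
    using assms by (simp add: mat_commutator_def)
qed

lemma closed_subspace_uminus: "ultraweakly_closed_subspace M \<Longrightarrow> x \<in> M \<Longrightarrow> - x \<in> M"
  unfolding ultraweakly_closed_subspace_def by (metis scaleC_op_uminus_1)

lemma closed_subspace_diff: "ultraweakly_closed_subspace M \<Longrightarrow> x \<in> M \<Longrightarrow> y \<in> M \<Longrightarrow> x - y \<in> M"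
  using closed_subspace_uminus unfolding ultraweakly_closed_subspace_def
  by (metis diff_conv_add_uminus ultraweakly_closed_subspace_def)

lemma linear_map_on_uminus:
  assumes "linear_map_on M \<Phi>" "x \<in> M"
  shows "\<Phi> (- x) = - \<Phi> x"
proof -
  have "\<Phi> (scaleC_op (- 1) x) = scaleC_op (- 1) (\<Phi> x)"
    using assms by (simp add: linear_map_on_def)
  then show ?thesis
    by (simp add: scaleC_op_uminus_1)
qed

lemma linear_map_on_diff:
  assumes "ultraweakly_closed_subspace M" "linear_map_on M \<Phi>" "x \<in> M" "y \<in> M"
  shows "\<Phi> (x - y) = \<Phi> x - \<Phi> y"
proof -
  have "\<Phi> (x + - y) = \<Phi> x + \<Phi> (- y)"
    using assms closed_subspace_uminus by (metis linear_map_on_def)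
  then show ?thesis
    using assms by (simp add: linear_map_on_uminus)
qed

lemma closed_subspace_0: "ultraweakly_closed_subspace M \<Longrightarrow> x \<in> M \<Longrightarrow> 0 \<in> M"
  using closed_subspace_diff[of M x x] by simp

text \<open>Entries map into \<open>H\<close> and annihilate its complement, so the form sees just
  the projections of both vectors. Bounds can thereby be stated with projected vectors.\<close>

lemma mat_form_id_op:
  assumes H: "closed_csubspace H" and x: "x \<in> matrices n (bounded_ops H)"
  shows "mat_form n x \<xi> \<eta> = mat_form n x (\<lambda>i. id_op H (\<xi> i)) (\<lambda>i. id_op H (\<eta> i))"
  unfolding mat_form_expand
proof (intro sum.cong refl)
  fix i j
  assume "i \<in> {..<n}" "j \<in> {..<n}"
  then have xB: "x i j \<in> bounded_ops H"
    using x by (auto simp: matrices_def)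
  have "cinner (id_op H (\<xi> i)) (x i j (id_op H (\<eta> j))) = cinner (\<xi> i) (id_op H (x i j (\<eta> j)))"
    using is_adjoint_id_op[OF H] by (simp add: is_adjoint_def bounded_ops_id_op[OF H xB])
  then show "cinner (\<xi> i) (x i j (\<eta> j)) = cinner (id_op H (\<xi> i)) (x i j (id_op H (\<eta> j)))"
    by (simp add: id_op(2)[OF H] bounded_opsD(2)[OF xB])
qed

text \<open>With \<open>C\<close> the norm of \<open>x\<close>, the matrices \<open>C + x\<close>
  and \<open>C - x\<close> are positive, and so are their images, while the unit is fixed. The form
  of the image is therefore real, which gives self-adjointness, and at most \<open>C\<close> on unit
  vectors, which bounds the norm through the numerical radius.\<close>

lemma channel_selfadjoint_contraction:
  fixes K :: "'k::chilbert_space set"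
  assumes vn: "von_neumann_algebra K M" and ch: "channel K M \<Phi>"
    and x: "x \<in> matrices n M" and sa: "mat_selfadjoint n x"
  shows "amplify \<Phi> x \<in> matrices n M" (is ?mat)
    and "mat_selfadjoint n (amplify \<Phi> x)" (is ?sa)
    and "mat_norm n (amplify \<Phi> x) \<le> mat_norm n x" (is ?contr)
proof -
  have K: "closed_csubspace K" and MB: "M \<subseteq> bounded_ops K" and P: "id_op K \<in> M"
    using vn by (auto simp: von_neumann_algebra_def)
  have sub: "ultraweakly_closed_subspace M"
    using vn by (rule von_neumann_algebra_closed_subspace)
  have \<Phi>M: "\<And>y. y \<in> M \<Longrightarrow> \<Phi> y \<in> M" and lin: "linear_map_on M \<Phi>" and unital: "\<Phi> (id_op K) = id_op K"
    and cp: "completely_positive M \<Phi>"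
    using ch by (auto simp: channel_def)
  have [simp]: "\<Phi> (y + z) = \<Phi> y + \<Phi> z" "\<Phi> (scaleC_op c y) = scaleC_op c (\<Phi> y)" if "y \<in> M" "z \<in> M" for y z c
    using lin that by (auto simp: linear_map_on_def)
  have z: "0 \<in> M"
    using closed_subspace_0[OF sub P] .
  have \<Phi>0: "\<Phi> 0 = 0"
    using linear_map_on_diff[OF sub lin P P] by simp
  show ?mat
    using x \<Phi>M by (simp add: matrices_def amplify_def)
  let ?C = "mat_norm n x"
  \<comment> \<open>The scalar \<open>c\<close> in the matrix algebra over \<open>M\<close>. Its
    unit has the projections \<open>id_op K\<close> on the diagonal, so its form measures projected
    vectors.\<close>
  define D where "D = (\<lambda>c i j. mat_diag (scaleC_op (complex_of_real c) (id_op K)) i j)"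
  have Dmat: "D c \<in> matrices n M" for c
    using z P sub by (auto simp: matrices_def D_def mat_diag_def ultraweakly_closed_subspace_def)
  have D: "mat_form n (D c) \<xi> \<xi> = complex_of_real (c * (vec_norm n (\<lambda>i. id_op K (\<xi> i)))\<^sup>2)" for c \<xi>
  proof -
    have "cinner v (id_op K v) = complex_of_real ((norm (id_op K v))\<^sup>2)" for v
      using is_adjoint_id_op[OF K] id_op[OF K] cinner_self
      by (metis is_adjoint_def bounded_opsD(2))
    then show ?thesis
      by (simp add: D_def mat_form_diag vec_norm_sq scaleC_of_real cinner.scaleR_right sum_distrib_left)
        (simp add: scaleR_conv_of_real)
  qed
  have \<Phi>D: "\<Phi> (D c i j) = D c i j" for c i j
    using P by (simp add: D_def mat_diag_def \<Phi>0 unital)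
  have form_real: "mat_form n x \<xi> \<xi> = complex_of_real (Re (mat_form n x \<xi> \<xi>))" for \<xi>
    using mat_form_hermitian[OF sa, of \<xi> \<xi>] by (metis Reals_cnj_iff of_real_Re)
  have xB: "x \<in> matrices n (bounded_ops K)"
    using x MB by (auto simp: matrices_def)
  \<comment> \<open>Comparison with \<open>D ?C\<close> calls for projected vectors on the right, a
    stronger bound than the one with \<open>\<xi>\<close> itself.\<close>
  have bound: "\<bar>Re (mat_form n x \<xi> \<xi>)\<bar> \<le> ?C * (vec_norm n (\<lambda>i. id_op K (\<xi> i)))\<^sup>2" for \<xi>
    unfolding mat_form_id_op[OF K xB, of \<xi> \<xi>] by (rule abs_mat_form_le_mat_norm)
  have pos: "mat_form n (amplify \<Phi> y) \<xi> \<xi> + mat_form n (D ?C) \<xi> \<xi> \<in> \<real>\<^sub>\<ge>\<^sub>0"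
    if y: "y = x \<or> y = (\<lambda>i j. - x i j)" for y \<xi>
  proof -
    have ymat: "y \<in> matrices n M"
      using x y closed_subspace_uminus[OF sub] by (auto simp: matrices_def)
    have "mat_positive n (\<lambda>i j. y i j + D ?C i j)"
      unfolding mat_positive_iff
    proof
      fix \<xi>
      have "mat_form n y \<xi> \<xi> = complex_of_real (Re (mat_form n y \<xi> \<xi>))"
        "\<bar>Re (mat_form n y \<xi> \<xi>)\<bar> \<le> ?C * (vec_norm n (\<lambda>i. id_op K (\<xi> i)))\<^sup>2"
        using y form_real[of \<xi>] bound[of \<xi>] by (auto simp: mat_form_uminus)
      then have "mat_form n y \<xi> \<xi> + mat_form n (D ?C) \<xi> \<xi>
          = complex_of_real (Re (mat_form n y \<xi> \<xi>) + ?C * (vec_norm n (\<lambda>i. id_op K (\<xi> i)))\<^sup>2)"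
        "0 \<le> Re (mat_form n y \<xi> \<xi>) + ?C * (vec_norm n (\<lambda>i. id_op K (\<xi> i)))\<^sup>2"
        unfolding D by (simp_all del: of_real_mult of_real_power)
      then show "mat_form n (\<lambda>i j. y i j + D ?C i j) \<xi> \<xi> \<in> \<real>\<^sub>\<ge>\<^sub>0"
        unfolding mat_form_add by (metis nonneg_Reals_of_real_iff)
    qed
    moreover have "(\<lambda>i j. y i j + D ?C i j) \<in> matrices n M"
      using ymat Dmat[of ?C] sub by (simp add: matrices_def ultraweakly_closed_subspace_def)
    ultimately have "mat_form n (amplify \<Phi> (\<lambda>i j. y i j + D ?C i j)) \<xi> \<xi> \<in> \<real>\<^sub>\<ge>\<^sub>0"
      using cp by (simp add: completely_positive_def mat_positive_iff)
    also have "mat_form n (amplify \<Phi> (\<lambda>i j. y i j + D ?C i j)) \<xi> \<xi>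
        = mat_form n (\<lambda>i j. amplify \<Phi> y i j + D ?C i j) \<xi> \<xi>"
      unfolding mat_form_expand
      using ymat Dmat[of ?C] by (intro sum.cong refl) (simp add: matrices_def amplify_def \<Phi>D)
    finally show ?thesis
      by (simp add: mat_form_add)
  qed
  have neg: "mat_form n (amplify \<Phi> (\<lambda>i j. - x i j)) \<xi> \<xi> = - mat_form n (amplify \<Phi> x) \<xi> \<xi>" for \<xi>
    unfolding mat_form_uminus[symmetric] unfolding mat_form_expand
    using x by (intro sum.cong refl) (simp add: matrices_def amplify_def linear_map_on_uminus[OF lin])
  have real: "mat_form n (amplify \<Phi> x) \<xi> \<xi> \<in> \<real>" for \<xi>
    using pos[of x \<xi>] unfolding D by (auto simp: complex_nonneg_Reals_iff complex_is_Real_iff)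
  have "\<bar>Re (mat_form n (amplify \<Phi> x) \<xi> \<xi>)\<bar> \<le> ?C * (vec_norm n \<xi>)\<^sup>2" for \<xi>
  proof -
    have "\<bar>Re (mat_form n (amplify \<Phi> x) \<xi> \<xi>)\<bar> \<le> ?C * (vec_norm n (\<lambda>i. id_op K (\<xi> i)))\<^sup>2"
      using pos[of x \<xi>] pos[of "\<lambda>i j. - x i j" \<xi>] unfolding D neg
      by (auto simp: complex_nonneg_Reals_iff)
    also have "\<dots> \<le> ?C * (vec_norm n \<xi>)\<^sup>2"
      by (intro mult_left_mono power_mono L2_set_mono norm_id_op_le[OF K] mat_norm_nonneg) auto
    finally show ?thesis .
  qed
  moreover show ?sa
  proof (rule mat_selfadjointI[OF _ real])
    show "amplify \<Phi> x i j (c *\<^sub>C v) = c *\<^sub>C amplify \<Phi> x i j v" if "i < n" "j < n" for i j c v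
    proof -
      have "amplify \<Phi> x i j \<in> bounded_ops K"
        using that x \<Phi>M MB by (auto simp: matrices_def amplify_def)
      then show ?thesis
        by (rule bounded_opsD(1))
    qed
  qed
  ultimately show ?contr
    by (intro mat_norm_le_numerical_radius mat_norm_nonneg)
qed

lemma mat_selfadjoint_diff:
  "mat_selfadjoint n x \<Longrightarrow> mat_selfadjoint n y \<Longrightarrow> mat_selfadjoint n (\<lambda>i j. x i j - y i j)"
  by (simp add: mat_selfadjoint_def is_adjoint_diff)

lemma matrices_diff:
  "ultraweakly_closed_subspace M \<Longrightarrow> x \<in> matrices n M \<Longrightarrow> y \<in> matrices n M
    \<Longrightarrow> (\<lambda>i j. x i j - y i j) \<in> matrices n M"
  by (simp add: matrices_def closed_subspace_diff)

section \<open>Schur products of positive kernels\<close>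

definition psd_kernel :: "'i set \<Rightarrow> ('i \<Rightarrow> 'i \<Rightarrow> complex) \<Rightarrow> bool" where
  "psd_kernel I B \<longleftrightarrow> (\<forall>c. (\<Sum>p\<in>I. \<Sum>q\<in>I. cnj (c p) * c q * B p q) \<in> \<real>\<^sub>\<ge>\<^sub>0)"

text \<open>Gram-Schmidt, one vector at a time; a vector whose remainder \<open>u\<close> vanishes
  leaves \<open>E\<close> unchanged. The expansion writes inner products as finite sums of products
  of coordinates.\<close>

lemma finite_orthonormal_expansion:
  fixes A :: "'a::complex_inner set"
  assumes "finite A"
  shows "\<exists>E. finite E \<and> (\<forall>e\<in>E. \<forall>f\<in>E. cinner e f = (if e = f then 1 else 0))
    \<and> (\<forall>a\<in>A. a = (\<Sum>e\<in>E. cinner e a *\<^sub>C e))"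
  using assms
proof induction
  case empty
  then show ?case
    by (intro exI[of _ "{}"]) auto
next
  case (insert v A)
  then obtain E where fin: "finite E"
    and orth: "\<And>e f. e \<in> E \<Longrightarrow> f \<in> E \<Longrightarrow> cinner e f = (if e = f then 1 else 0)"
    and exp: "\<And>a. a \<in> A \<Longrightarrow> a = (\<Sum>e\<in>E. cinner e a *\<^sub>C e)"
    by blast
  define u where "u = v - (\<Sum>e\<in>E. cinner e v *\<^sub>C e)"
  have eu: "cinner e u = 0" if e: "e \<in> E" for e
  proof -
    have "cinner e (\<Sum>f\<in>E. cinner f v *\<^sub>C f) = (\<Sum>f\<in>E. if f = e then cinner f v else 0)"
      unfolding cinner.sum_right using e by (intro sum.cong refl) (simp add: cinner_scaleC_right orth)
    also have "\<dots> = cinner e v"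
      using fin e by simp
    finally show ?thesis
      by (simp add: u_def cinner.diff_right)
  qed
  show ?case
  proof (cases "u = 0")
    case True
    then show ?thesis
      using fin orth exp by (intro exI[of _ E]) (auto simp: u_def)
  next
    case False
    define w where "w = (1 / norm u) *\<^sub>R u"
    have ew: "cinner e w = 0" "cinner w e = 0" if "e \<in> E" for e
      using eu[OF that] by (auto simp: w_def cinner.scaleR_right cinner.scaleR_left cinner_eq_0_commute[of u])
    have ww: "cinner w w = 1"
      using False by (simp add: cinner_self w_def)
    have wE: "w \<notin> E"
      using ew ww by force
    have sum_w: "(\<Sum>e\<in>insert w E. cinner e a *\<^sub>C e) = cinner w a *\<^sub>C w + (\<Sum>e\<in>E. cinner e a *\<^sub>C e)" for a
      using fin wE by simp
    have span_w: "cinner w (\<Sum>e\<in>E. g e *\<^sub>C e) = 0" for g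
      by (simp add: cinner.sum_right cinner_scaleC_right ew)
    have "a = (\<Sum>e\<in>insert w E. cinner e a *\<^sub>C e)" if "a \<in> A" for a
      using exp[OF that] span_w[of "\<lambda>e. cinner e a"] by (simp add: sum_w scaleC.zero_left)
    moreover have "v = (\<Sum>e\<in>insert w E. cinner e v *\<^sub>C e)"
    proof -
      have "cinner w v = cinner w u"
        using span_w[of "\<lambda>e. cinner e v"] by (simp add: u_def cinner.diff_right)
      also have "\<dots> = norm u"
        using False by (simp add: w_def cinner.scaleR_left cinner_self scaleR_conv_of_real power2_eq_square)
      finally have "cinner w v *\<^sub>C w = u"
        using False by (simp add: w_def scaleC_of_real)
      then show ?thesis
        by (simp add: sum_w u_def)
    qed
    ultimately show ?thesis
      using fin orth ew ww wE by (intro exI[of _ "insert w E"] conjI ballI) auto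
  qed
qed

lemma nonneg_Reals_sum: "(\<And>a. a \<in> A \<Longrightarrow> f a \<in> \<real>\<^sub>\<ge>\<^sub>0) \<Longrightarrow> (\<Sum>a\<in>A. f a :: complex) \<in> \<real>\<^sub>\<ge>\<^sub>0"
  by (induction A rule: infinite_finite_induct) auto

text \<open>The Schur product theorem with one factor a Gram kernel. Expanding the vectors in an
  orthonormal family makes the Gram kernel a sum of rank-one kernels, and each of these is absorbed
  into the coefficients \<open>c\<close>.\<close>

lemma psd_kernel_mult_gram:
  assumes "finite I" and B: "psd_kernel I B"
  shows "psd_kernel I (\<lambda>p q. B p q * cinner (v p) (v q))"
  unfolding psd_kernel_def
proof
  fix c
  obtain E where E: "\<And>a. a \<in> v ` I \<Longrightarrow> a = (\<Sum>e\<in>E. cinner e a *\<^sub>C e)"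
    using finite_orthonormal_expansion[of "v ` I"] \<open>finite I\<close> by (metis finite_imageI)
  have gram: "cinner (v p) (v q) = (\<Sum>e\<in>E. cnj (cinner e (v p)) * cinner e (v q))" if "q \<in> I" for p q
  proof -
    have "cinner (v p) (v q) = cinner (v p) (\<Sum>e\<in>E. cinner e (v q) *\<^sub>C e)"
      using E[of "v q"] that by simp
    then show ?thesis
      by (simp add: cinner.sum_right cinner_scaleC_right cinner_commute[symmetric] mult.commute)
  qed
  have "(\<Sum>p\<in>I. \<Sum>q\<in>I. cnj (c p) * c q * (B p q * cinner (v p) (v q)))
      = (\<Sum>p\<in>I. \<Sum>q\<in>I. \<Sum>e\<in>E. cnj (c p * cinner e (v p)) * (c q * cinner e (v q)) * B p q)"
    by (intro sum.cong refl) (simp add: gram sum_distrib_left mult_ac)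
  also have "\<dots> = (\<Sum>p\<in>I. \<Sum>e\<in>E. \<Sum>q\<in>I. cnj (c p * cinner e (v p)) * (c q * cinner e (v q)) * B p q)"
    by (intro sum.cong refl sum.swap)
  also have "\<dots> = (\<Sum>e\<in>E. \<Sum>p\<in>I. \<Sum>q\<in>I. cnj (c p * cinner e (v p)) * (c q * cinner e (v q)) * B p q)"
    by (rule sum.swap)
  also have "\<dots> \<in> \<real>\<^sub>\<ge>\<^sub>0"
  proof (rule nonneg_Reals_sum)
    show "(\<Sum>p\<in>I. \<Sum>q\<in>I. cnj (c p * cinner e (v p)) * (c q * cinner e (v q)) * B p q) \<in> \<real>\<^sub>\<ge>\<^sub>0" for e
      using B unfolding psd_kernel_def by (rule spec)
  qed
  finally show "(\<Sum>p\<in>I. \<Sum>q\<in>I. cnj (c p) * c q * (B p q * cinner (v p) (v q))) \<in> \<real>\<^sub>\<ge>\<^sub>0" .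
qed

lemma psd_kernel_mult_gram_prod:
  assumes "finite I" "psd_kernel I B"
  shows "psd_kernel I (\<lambda>p q. B p q * (\<Prod>i\<in>J. cinner (v i p) (v i q)))"
proof (induction J rule: infinite_finite_induct)
  case (insert i J)
  then show ?case
    using psd_kernel_mult_gram[OF \<open>finite I\<close> insert.IH, of "v i"] by (simp add: mult_ac)
qed (use assms in auto)

lemma norm_sum_scaleC:
  "complex_of_real ((norm (\<Sum>p\<in>I. c p *\<^sub>C w p))\<^sup>2) = (\<Sum>p\<in>I. \<Sum>q\<in>I. cnj (c p) * c q * cinner (w p) (w q))"
  unfolding cinner_self[symmetric] cinner.sum_left cinner.sum_right
  by (subst sum.swap) (simp add: cinner_scaleC_left cinner_scaleC_right mult_ac)

text \<open>Hypothesis \<open>dom\<close> says that the difference of two Gram kernels,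
  \<open>D\<close>, is positive. Multiplied by the Gram kernels of the \<open>v i\<close> it stays
  positive, and it becomes the difference of the kernels of \<open>X\<close> and \<open>Z\<close>.
  The sums over \<open>A\<close> and \<open>B\<close> accommodate all rows of a matrix at
  once.\<close>

lemma schur_domination:
  fixes z :: "'a \<Rightarrow> 'i \<Rightarrow> 'h::complex_inner" and x :: "'b \<Rightarrow> 'i \<Rightarrow> 'h"
    and Z :: "'a \<Rightarrow> 'i \<Rightarrow> 'k::complex_inner" and X :: "'b \<Rightarrow> 'i \<Rightarrow> 'k" and v :: "'j \<Rightarrow> 'i \<Rightarrow> 'h"
  assumes I: "finite I"
    and dom: "\<And>c. (\<Sum>a\<in>A. (norm (\<Sum>p\<in>I. c p *\<^sub>C z a p))\<^sup>2) \<le> (\<Sum>b\<in>B. (norm (\<Sum>p\<in>I. c p *\<^sub>C x b p))\<^sup>2)"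
    and Z: "\<And>a p q. a \<in> A \<Longrightarrow> p \<in> I \<Longrightarrow> q \<in> I \<Longrightarrow>
      cinner (Z a p) (Z a q) = cinner (z a p) (z a q) * (\<Prod>i\<in>J. cinner (v i p) (v i q))"
    and X: "\<And>b p q. b \<in> B \<Longrightarrow> p \<in> I \<Longrightarrow> q \<in> I \<Longrightarrow>
      cinner (X b p) (X b q) = cinner (x b p) (x b q) * (\<Prod>i\<in>J. cinner (v i p) (v i q))"
  shows "(\<Sum>a\<in>A. (norm (\<Sum>p\<in>I. c p *\<^sub>C Z a p))\<^sup>2) \<le> (\<Sum>b\<in>B. (norm (\<Sum>p\<in>I. c p *\<^sub>C X b p))\<^sup>2)"
proof -
  define D where "D = (\<lambda>p q. (\<Sum>b\<in>B. cinner (x b p) (x b q)) - (\<Sum>a\<in>A. cinner (z a p) (z a q)))"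
  have kernel: "(\<Sum>p\<in>I. \<Sum>q\<in>I. cnj (c p) * c q * ((\<Sum>b\<in>B. f b p q) - (\<Sum>a\<in>A. g a p q)))
      = (\<Sum>b\<in>B. \<Sum>p\<in>I. \<Sum>q\<in>I. cnj (c p) * c q * f b p q) - (\<Sum>a\<in>A. \<Sum>p\<in>I. \<Sum>q\<in>I. cnj (c p) * c q * g a p q)"
    for c f and g :: "'a \<Rightarrow> 'i \<Rightarrow> 'i \<Rightarrow> complex"
  proof -
    have swap: "(\<Sum>p\<in>I. \<Sum>q\<in>I. cnj (c p) * c q * (\<Sum>s\<in>S. h s p q))
        = (\<Sum>s\<in>S. \<Sum>p\<in>I. \<Sum>q\<in>I. cnj (c p) * c q * h s p q)" for S and h :: "'s \<Rightarrow> 'i \<Rightarrow> 'i \<Rightarrow> complex"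
    proof -
      have "(\<Sum>p\<in>I. \<Sum>q\<in>I. cnj (c p) * c q * (\<Sum>s\<in>S. h s p q))
          = (\<Sum>p\<in>I. \<Sum>s\<in>S. \<Sum>q\<in>I. cnj (c p) * c q * h s p q)"
        unfolding sum_distrib_left by (intro sum.cong refl sum.swap)
      also have "\<dots> = (\<Sum>s\<in>S. \<Sum>p\<in>I. \<Sum>q\<in>I. cnj (c p) * c q * h s p q)"
        by (rule sum.swap)
      finally show ?thesis .
    qed
    show ?thesis
      by (simp only: right_diff_distrib sum_subtractf swap)
  qed
  have "psd_kernel I D"
    unfolding psd_kernel_def
  proof
    fix c
    have "(\<Sum>p\<in>I. \<Sum>q\<in>I. cnj (c p) * c q * D p q)
        = complex_of_real ((\<Sum>b\<in>B. (norm (\<Sum>p\<in>I. c p *\<^sub>C x b p))\<^sup>2) - (\<Sum>a\<in>A. (norm (\<Sum>p\<in>I. c p *\<^sub>C z a p))\<^sup>2))"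
      unfolding D_def kernel by (simp only: of_real_diff of_real_sum norm_sum_scaleC)
    then show "(\<Sum>p\<in>I. \<Sum>q\<in>I. cnj (c p) * c q * D p q) \<in> \<real>\<^sub>\<ge>\<^sub>0"
      using dom[of c] by (simp only: nonneg_Reals_of_real_iff diff_ge_0_iff_ge)
  qed
  then have "psd_kernel I (\<lambda>p q. D p q * (\<Prod>i\<in>J. cinner (v i p) (v i q)))"
    by (rule psd_kernel_mult_gram_prod[OF I])
  then have "(\<Sum>p\<in>I. \<Sum>q\<in>I. cnj (c p) * c q * (D p q * (\<Prod>i\<in>J. cinner (v i p) (v i q)))) \<in> \<real>\<^sub>\<ge>\<^sub>0"
    by (simp add: psd_kernel_def)
  also have "(\<Sum>p\<in>I. \<Sum>q\<in>I. cnj (c p) * c q * (D p q * (\<Prod>i\<in>J. cinner (v i p) (v i q))))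
      = (\<Sum>p\<in>I. \<Sum>q\<in>I. cnj (c p) * c q * ((\<Sum>b\<in>B. cinner (X b p) (X b q)) - (\<Sum>a\<in>A. cinner (Z a p) (Z a q))))"
    by (intro sum.cong refl) (simp add: D_def X Z left_diff_distrib sum_distrib_right)
  also have "\<dots> = complex_of_real ((\<Sum>b\<in>B. (norm (\<Sum>p\<in>I. c p *\<^sub>C X b p))\<^sup>2) - (\<Sum>a\<in>A. (norm (\<Sum>p\<in>I. c p *\<^sub>C Z a p))\<^sup>2))"
    unfolding kernel by (simp only: of_real_diff of_real_sum norm_sum_scaleC)
  finally show ?thesis
    by (simp only: nonneg_Reals_of_real_iff diff_ge_0_iff_ge)
qed

section \<open>Bounded linear relations\<close>

text \<open>The map is given as a relation because elementary tensors can be linearly dependent: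
  applied to differences, the norm bound yields well-definedness together with continuity.\<close>

lemma extend_bounded_relation:
  fixes R :: "('k::chilbert_space \<times> 'k) set"
  assumes K: "closed_csubspace K"
    and add: "\<And>v w v' w'. (v, w) \<in> R \<Longrightarrow> (v', w') \<in> R \<Longrightarrow> (v + v', w + w') \<in> R"
    and scale: "\<And>c v w. (v, w) \<in> R \<Longrightarrow> (c *\<^sub>C v, c *\<^sub>C w) \<in> R"
    and bound: "\<And>v w. (v, w) \<in> R \<Longrightarrow> norm w \<le> C * norm v"
    and range: "\<And>v w. (v, w) \<in> R \<Longrightarrow> w \<in> K"
    and dense: "closure (Domain R) = K"
  shows "\<exists>T\<in>bounded_ops K. \<forall>(v, w)\<in>R. blinfun_apply T v = w"
proof -
  \<comment> \<open>The closure of \<open>R\<close>. The bound makes it single-valued, and density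
    with completeness makes it defined on all of \<open>K\<close>.\<close>
  define L where "L = (\<lambda>v w. \<exists>a b. (\<forall>n::nat. (a n, b n) \<in> R) \<and> a \<longlonglongrightarrow> v \<and> b \<longlonglongrightarrow> w)"
  have RL: "L v w" if "(v, w) \<in> R" for v w
    unfolding L_def using that by (intro exI[of _ "\<lambda>_. v"] exI[of _ "\<lambda>_. w"]) auto
  have Ladd: "L (v + v') (w + w')" if vw: "L v w" "L v' w'" for v w v' w'
  proof -
    obtain a b where ab: "\<And>n. (a n, b n) \<in> R" "a \<longlonglongrightarrow> v" "b \<longlonglongrightarrow> w"
      using vw(1) unfolding L_def by blast
    obtain a' b' where ab': "\<And>n. (a' n, b' n) \<in> R" "a' \<longlonglongrightarrow> v'" "b' \<longlonglongrightarrow> w'"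
      using vw(2) unfolding L_def by blast
    show ?thesis
      unfolding L_def
      by (intro exI[of _ "\<lambda>n. a n + a' n"] exI[of _ "\<lambda>n. b n + b' n"] conjI allI tendsto_add add ab ab')
  qed
  have Lscale: "L (c *\<^sub>C v) (c *\<^sub>C w)" if vw: "L v w" for c v w
  proof -
    obtain a b where ab: "\<And>n. (a n, b n) \<in> R" "a \<longlonglongrightarrow> v" "b \<longlonglongrightarrow> w"
      using vw unfolding L_def by blast
    show ?thesis
      unfolding L_def
      by (intro exI[of _ "\<lambda>n. c *\<^sub>C a n"] exI[of _ "\<lambda>n. c *\<^sub>C b n"] conjI allI
          scaleC.tendsto tendsto_const scale ab)
  qed
  have Lbound: "norm w \<le> C * norm v" if vw: "L v w" for v w
  proof -
    obtain a b where ab: "\<And>n. (a n, b n) \<in> R" "a \<longlonglongrightarrow> v" "b \<longlonglongrightarrow> w"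
      using vw unfolding L_def by blast
    show ?thesis
      using ab bound by (intro LIMSEQ_le[of "\<lambda>n. norm (b n)" _ "\<lambda>n. C * norm (a n)"] tendsto_intros) auto
  qed
  have Lrange: "w \<in> K" if "L v w" for v w
    using that range K unfolding L_def closed_csubspace_def by (meson closed_sequentially)
  have Lex: "\<exists>w. L v w" if "v \<in> K" for v
  proof -
    obtain a where a: "\<And>n. a n \<in> Domain R" "a \<longlonglongrightarrow> v"
      using \<open>v \<in> K\<close> dense by (metis closure_sequential)
    obtain b where b: "\<And>n. (a n, b n) \<in> R"
      using a(1) unfolding Domain_iff by metis
    have diff: "norm (b m - b n) \<le> C * norm (a m - a n)" for m n
      using bound[OF add[OF b[of m] scale[OF b[of n], of "- 1"]]] by simp
    have "Cauchy b"
    proof (rule metric_CauchyI)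
      fix e :: real
      assume "e > 0"
      then have "e / (\<bar>C\<bar> + 1) > 0"
        by simp
      then obtain M where M: "\<And>m n. m \<ge> M \<Longrightarrow> n \<ge> M \<Longrightarrow> dist (a m) (a n) < e / (\<bar>C\<bar> + 1)"
        using LIMSEQ_imp_Cauchy[OF a(2)] unfolding Cauchy_def by metis
      have "dist (b m) (b n) < e" if "m \<ge> M" "n \<ge> M" for m n
      proof -
        have "norm (b m - b n) \<le> (\<bar>C\<bar> + 1) * norm (a m - a n)"
          by (rule order_trans[OF diff]) (intro mult_right_mono; simp)
        also have "\<dots> < e"
          using M[OF that] by (simp add: dist_norm field_simps)
        finally show ?thesis
          by (simp add: dist_norm)
      qed
      then show "\<exists>M. \<forall>m\<ge>M. \<forall>n\<ge>M. dist (b m) (b n) < e"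
        by blast
    qed
    then obtain w where "b \<longlonglongrightarrow> w"
      by (auto simp: Cauchy_convergent_iff convergent_def)
    then show ?thesis
      using a b unfolding L_def by blast
  qed
  have Luniq: "w = w'" if "L v w" "L v w'" for v w w'
    using Lbound[OF Ladd[OF that(1) Lscale[OF that(2), of "- 1"]]] by simp
  \<comment> \<open>Precomposition with the projection extends the operator by \<open>0\<close> to
    the complement of \<open>K\<close>.\<close>
  let ?P = "id_op K"
  have PK: "?P v \<in> K" for v
    by (rule bounded_opsD(2)[OF id_op(1)[OF K]])
  obtain f where f: "\<And>v. L (?P v) (f v)"
    using Lex[OF PK] by metis
  have f_scale: "f (c *\<^sub>C v) = c *\<^sub>C f v" for c v
    using f[of "c *\<^sub>C v"] Lscale[OF f[of v], of c] by (intro Luniq) (auto simp: bounded_opsD(1)[OF id_op(1)[OF K]])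
  have "bounded_linear f"
  proof
    show "f (v + w) = f v + f w" for v w
      using f[of "v + w"] Ladd[OF f f] by (intro Luniq) (auto simp: blinfun.add_right)
    show "f (r *\<^sub>R v) = r *\<^sub>R f v" for r v
      using f_scale[of "of_real r" v] by (simp add: scaleC_of_real)
    have "norm (f v) \<le> norm v * \<bar>C\<bar>" for v
    proof -
      have "norm (f v) \<le> C * norm (?P v)"
        by (rule Lbound[OF f])
      also have "\<dots> \<le> \<bar>C\<bar> * norm v"
        by (intro mult_mono norm_id_op_le[OF K]) auto
      finally show ?thesis
        by (simp add: mult.commute)
    qed
    then show "\<exists>K. \<forall>v. norm (f v) \<le> norm v * K"
      by blast
  qed
  then have ap: "blinfun_apply (Blinfun f) = f"
    by (rule bounded_linear_Blinfun_apply)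
  have "f v = 0" if "\<forall>u\<in>K. cinner u v = 0" for v
  proof -
    have "?P v = 0"
      using that bounded_opsD(3)[OF id_op(1)[OF K]] by blast
    then show ?thesis
      using Lbound[OF f[of v]] by simp
  qed
  moreover have "f v \<in> K" for v
    using Lrange f by blast
  moreover have "f v = w" if "(v, w) \<in> R" for v w
  proof -
    have "v \<in> K"
      using that dense closure_subset[of "Domain R"] by blast
    then show ?thesis
      using f[of v] RL[OF that] by (intro Luniq) (auto simp: id_op(2)[OF K])
  qed
  ultimately show ?thesis
    using f_scale by (intro bexI[of _ "Blinfun f"]) (auto simp: bounded_ops_def ap)
qed

section \<open>Tensor products of operators\<close>

locale hilbert_tensor_product =
  fixes d :: nat and H :: "nat \<Rightarrow> 'h::chilbert_space set" and K :: "'k::chilbert_space set"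
    and t :: "(nat \<Rightarrow> 'h) \<Rightarrow> 'k"
  assumes tensor: "hilbert_tensor d H K t"
    and factor: "\<And>j. j \<in> {1..d} \<Longrightarrow> closed_csubspace (H j)"
begin

abbreviation "simple \<equiv> Pi {1..d} H"

lemma K: "closed_csubspace K"
  using tensor by (simp add: hilbert_tensor_def)

lemma cinner_t:
  "\<xi> \<in> simple \<Longrightarrow> \<eta> \<in> simple \<Longrightarrow> cinner (t \<xi>) (t \<eta>) = (\<Prod>j=1..d. cinner (\<xi> j) (\<eta> j))"
  using tensor unfolding hilbert_tensor_def by blast

lemma closure_cspan: "closure (cspan (t ` simple)) = K"
  using tensor by (simp add: hilbert_tensor_def)

text \<open>Operators on the factors act on a family \<open>k\<close> rather than on
  \<open>t k\<close>, and different families can have the same tensor. Combinations are therefore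
  indexed by families: one family is picked for each tensor, and conversely the coefficients of
  equal tensors are merged.\<close>

lemma cspan_t: "cspan (t ` simple) = {\<Sum>k\<in>F. c k *\<^sub>C t k | F c. finite F \<and> F \<subseteq> simple}"
proof (intro equalityI subsetI)
  fix v
  assume "v \<in> cspan (t ` simple)"
  then obtain A c where A: "finite A" "A \<subseteq> t ` simple" and v: "v = (\<Sum>a\<in>A. c a *\<^sub>C a)"
    unfolding cspan_def by blast
  obtain F where F: "F \<subseteq> simple" "finite F" "A = t ` F" "inj_on t F"
    using A by (metis finite_subset_image subset_image_inj finite_imageD)
  have "v = (\<Sum>k\<in>F. c (t k) *\<^sub>C t k)"
    unfolding v F(3) by (simp add: sum.reindex[OF F(4)])
  then show "v \<in> {\<Sum>k\<in>F. c k *\<^sub>C t k | F c. finite F \<and> F \<subseteq> simple}"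
    using F by (intro CollectI exI[of _ F] exI[of _ "\<lambda>k. c (t k)"]) auto
next
  fix v
  assume "v \<in> {\<Sum>k\<in>F. c k *\<^sub>C t k | F c. finite F \<and> F \<subseteq> simple}"
  then obtain F c where F: "finite F" "F \<subseteq> simple" and v: "v = (\<Sum>k\<in>F. c k *\<^sub>C t k)"
    by blast
  have "v = (\<Sum>a\<in>t ` F. \<Sum>k\<in>{k\<in>F. t k = a}. c k *\<^sub>C t k)"
    unfolding v by (rule sum.image_gen[OF F(1)])
  also have "\<dots> = (\<Sum>a\<in>t ` F. (\<Sum>k\<in>{k\<in>F. t k = a}. c k) *\<^sub>C a)"
    by (intro sum.cong refl) (simp add: scaleC.sum_left)
  finally show "v \<in> cspan (t ` simple)"
    unfolding cspan_def using F
    by (intro CollectI exI[of _ "t ` F"] exI[of _ "\<lambda>a. \<Sum>k\<in>{k\<in>F. t k = a}. c k"]) auto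
qed

lemma t_in_K: "\<xi> \<in> simple \<Longrightarrow> t \<xi> \<in> K"
proof -
  assume "\<xi> \<in> simple"
  then have "t \<xi> \<in> cspan (t ` simple)"
    unfolding cspan_t by (intro CollectI exI[of _ "{\<xi>}"] exI[of _ "\<lambda>_. 1"]) auto
  then show ?thesis
    using closure_subset closure_cspan by blast
qed

lemma closed_contains_K:
  assumes "closed {w. P w}" and P: "\<And>F c. finite F \<Longrightarrow> F \<subseteq> simple \<Longrightarrow> P (\<Sum>k\<in>F. c k *\<^sub>C t k)" and "v \<in> K"
  shows "P v"
proof -
  have "cspan (t ` simple) \<subseteq> {w. P w}"
    unfolding cspan_t using P by blast
  then have "K \<subseteq> {w. P w}"
    using assms(1) closure_minimal closure_cspan by blast
  then show ?thesis
    using \<open>v \<in> K\<close> by blast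
qed

lemma tensor_ext:
  assumes "u \<in> K" "v \<in> K" and eq: "\<And>\<xi>. \<xi> \<in> simple \<Longrightarrow> cinner (t \<xi>) u = cinner (t \<xi>) v"
  shows "u = v"
proof -
  have "cinner (u - v) (u - v) = 0"
  proof (rule closed_contains_K[where P = "\<lambda>w. cinner w (u - v) = 0"])
    show "closed {w. cinner w (u - v) = 0}"
      by (intro closed_Collect_eq continuous_intros cinner.continuous_on)
    show "cinner (\<Sum>k\<in>F. c k *\<^sub>C t k) (u - v) = 0" if "F \<subseteq> simple" for F c
    proof -
      have "cinner (t k) (u - v) = 0" if "k \<in> F" for k
        using eq[of k] that \<open>F \<subseteq> simple\<close> by (auto simp: cinner.diff_right)
      then show ?thesis
        by (simp add: cinner.sum_left cinner_scaleC_left)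
    qed
    show "u - v \<in> K"
      using assms by (intro csubspace_diff[OF K])
  qed
  then show ?thesis
    by simp
qed

text \<open>Elements of \<open>K\<close> are determined by their inner products with elementary
  tensors, and these involve the coordinates in \<open>{1..d}\<close> alone.\<close>

lemma t_cong:
  assumes "\<xi> \<in> simple" and eq: "\<And>i. i \<in> {1..d} \<Longrightarrow> \<xi> i = \<eta> i"
  shows "t \<xi> = t \<eta>"
proof -
  have \<eta>: "\<eta> \<in> simple"
    using assms by (metis Pi_iff)
  show ?thesis
  proof (rule tensor_ext[OF t_in_K t_in_K])
    show "cinner (t \<zeta>) (t \<xi>) = cinner (t \<zeta>) (t \<eta>)" if "\<zeta> \<in> simple" for \<zeta>
      unfolding cinner_t[OF that \<open>\<xi> \<in> simple\<close>] cinner_t[OF that \<eta>] by (intro prod.cong refl) (simp add: eq)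
  qed fact+
qed

lemma bounded_ops_tensor_eqI:
  assumes T: "T \<in> bounded_ops K" and T': "T' \<in> bounded_ops K"
    and eq: "\<And>\<xi>. \<xi> \<in> simple \<Longrightarrow> T (t \<xi>) = T' (t \<xi>)"
  shows "T = T'"
proof (rule bounded_ops_eqI[OF K T T'])
  fix v
  assume v: "v \<in> K"
  show "T v = T' v"
  proof (rule closed_contains_K[where P = "\<lambda>w. T w = T' w", OF _ _ v])
    show "closed {w. T w = T' w}"
      by (intro closed_Collect_eq continuous_intros)
    show "T (\<Sum>k\<in>F. c k *\<^sub>C t k) = T' (\<Sum>k\<in>F. c k *\<^sub>C t k)" if "F \<subseteq> simple" for F c
      using that eq unfolding blinfun.sum_right
      by (intro sum.cong refl) (auto simp: bounded_opsD(1)[OF T] bounded_opsD(1)[OF T'])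
  qed
qed

lemma fun_upd_simple: "\<xi> \<in> simple \<Longrightarrow> (j \<in> {1..d} \<Longrightarrow> v \<in> H j) \<Longrightarrow> \<xi>(j := v) \<in> simple"
  by (auto simp: Pi_def)

lemma cinner_t_upd:
  assumes "j \<in> {1..d}" "\<xi> \<in> simple" "\<eta> \<in> simple" "v \<in> H j" "w \<in> H j"
  shows "cinner (t (\<xi>(j := v))) (t (\<eta>(j := w))) = cinner v w * (\<Prod>i\<in>{1..d} - {j}. cinner (\<xi> i) (\<eta> i))"
proof -
  have "cinner (t (\<xi>(j := v))) (t (\<eta>(j := w))) = (\<Prod>i=1..d. cinner ((\<xi>(j := v)) i) ((\<eta>(j := w)) i))"
    using assms by (intro cinner_t fun_upd_simple) auto
  also have "\<dots> = cinner v w * (\<Prod>i\<in>{1..d} - {j}. cinner ((\<xi>(j := v)) i) ((\<eta>(j := w)) i))"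
    using \<open>j \<in> {1..d}\<close> by (subst prod.remove[of _ j]) auto
  also have "(\<Prod>i\<in>{1..d} - {j}. cinner ((\<xi>(j := v)) i) ((\<eta>(j := w)) i)) = (\<Prod>i\<in>{1..d} - {j}. cinner (\<xi> i) (\<eta> i))"
    by (intro prod.cong refl) auto
  finally show ?thesis .
qed

text \<open>The Schur product argument: the bound for \<open>y\<close> on \<open>H j\<close> says that a certain kernel is positive,
  and its product with the Gram kernels of the other factors is the corresponding kernel on \<open>K\<close>.\<close>

lemma amplified_bound_simple:
  assumes j: "j \<in> {1..d}" and F: "finite F" "F \<subseteq> simple"
    and y: "\<And>a b. a < n \<Longrightarrow> b < n \<Longrightarrow> y a b \<in> bounded_ops (H j)"
  shows "(\<Sum>a<n. (norm (\<Sum>b<n. \<Sum>k\<in>F. c b k *\<^sub>C t (k(j := y a b (k j)))))\<^sup>2)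
    \<le> (mat_norm n y)\<^sup>2 * (\<Sum>b<n. (norm (\<Sum>k\<in>F. c b k *\<^sub>C t k))\<^sup>2)"
proof -
  let ?C = "mat_norm n y"
  let ?I = "{..<n} \<times> F"
  let ?c = "\<lambda>p. c (fst p) (snd p)"
  \<comment> \<open>The bound on the right has to be a sum of squared norms of combinations over the
    pairs \<open>(b, k)\<close>. \<open>x\<close> and \<open>X\<close> achieve this by keeping, for
    each \<open>b\<close>, just the terms of row \<open>b\<close>, scaled by
    \<open>?C\<close>.\<close>
  define x where "x = (\<lambda>(b::nat) p. if fst p = b then ?C *\<^sub>R (snd p j :: 'h) else 0)"
  define z where "z = (\<lambda>a p. y a (fst p) (snd p j))"
  define X where "X = (\<lambda>(b::nat) p. if fst p = b then ?C *\<^sub>R t (snd p) else 0)"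
  define Z where "Z = (\<lambda>a p. t ((snd p)(j := y a (fst p) (snd p j))))"
  have "(\<Sum>a<n. (norm (\<Sum>p\<in>?I. ?c p *\<^sub>C Z a p))\<^sup>2) \<le> (\<Sum>b<n. (norm (\<Sum>p\<in>?I. ?c p *\<^sub>C X b p))\<^sup>2)"
  proof (rule schur_domination[where z = z and x = x and J = "{1..d} - {j}" and v = "\<lambda>i p. snd p i"])
    show "finite ?I"
      using F by simp
    show "(\<Sum>a<n. (norm (\<Sum>p\<in>?I. e p *\<^sub>C z a p))\<^sup>2) \<le> (\<Sum>b<n. (norm (\<Sum>p\<in>?I. e p *\<^sub>C x b p))\<^sup>2)" for e
    proof -
      define \<eta> where "\<eta> = (\<lambda>b. \<Sum>k\<in>F. e (b, k) *\<^sub>C (k j :: 'h))"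
      have "(\<Sum>p\<in>?I. e p *\<^sub>C z a p) = mat_apply n y \<eta> a" if "a < n" for a
      proof -
        have "y a b (\<eta> b) = (\<Sum>k\<in>F. e (b, k) *\<^sub>C y a b (k j))" if "b < n" for b
          unfolding \<eta>_def blinfun.sum_right
          using y[OF \<open>a < n\<close> that] by (simp add: bounded_opsD(1))
        then show ?thesis
          by (simp add: mat_apply_def z_def sum.cartesian_product')
      qed
      then have "(\<Sum>a<n. (norm (\<Sum>p\<in>?I. e p *\<^sub>C z a p))\<^sup>2) = (vec_norm n (mat_apply n y \<eta>))\<^sup>2"
        unfolding vec_norm_sq by (intro sum.cong refl) simp
      also have "\<dots> \<le> (?C * vec_norm n \<eta>)\<^sup>2"
        by (intro power_mono mat_norm_bound) simp
      also have "\<dots> = (\<Sum>b<n. (norm (\<Sum>p\<in>?I. e p *\<^sub>C x b p))\<^sup>2)"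
      proof -
        have "(\<Sum>p\<in>?I. e p *\<^sub>C x b p) = ?C *\<^sub>R \<eta> b" if "b < n" for b
        proof -
          have "(\<Sum>p\<in>?I. e p *\<^sub>C x b p) = (\<Sum>b'<n. \<Sum>k\<in>F. e (b', k) *\<^sub>C x b (b', k))"
            by (simp add: sum.cartesian_product')
          also have "\<dots> = (\<Sum>b'<n. if b' = b then ?C *\<^sub>R \<eta> b else 0)"
            by (intro sum.cong refl)
              (auto simp: x_def \<eta>_def scaleC.zero_right scaleC.scaleR_right scaleR_sum_right)
          also have "\<dots> = ?C *\<^sub>R \<eta> b"
            using that by simp
          finally show ?thesis .
        qed
        then have "(\<Sum>b<n. (norm (\<Sum>p\<in>?I. e p *\<^sub>C x b p))\<^sup>2) = (\<Sum>b<n. ?C\<^sup>2 * (norm (\<eta> b))\<^sup>2)"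
          by (intro sum.cong refl) (simp add: power_mult_distrib)
        then show ?thesis
          by (simp add: power_mult_distrib vec_norm_sq sum_distrib_left)
      qed
      finally show ?thesis .
    qed
    show "cinner (Z a p) (Z a q) = cinner (z a p) (z a q) * (\<Prod>i\<in>{1..d} - {j}. cinner (snd p i) (snd q i))"
      if "a \<in> {..<n}" "p \<in> ?I" "q \<in> ?I" for a p q
    proof -
      have "snd p \<in> simple" "snd q \<in> simple" "fst p < n" "fst q < n" "a < n"
        using that F(2)[THEN subsetD] by (simp_all add: mem_Times_iff)
      then show ?thesis
        unfolding Z_def z_def by (intro cinner_t_upd j bounded_opsD(2) y)
    qed
    show "cinner (X b p) (X b q) = cinner (x b p) (x b q) * (\<Prod>i\<in>{1..d} - {j}. cinner (snd p i) (snd q i))"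
      if "b \<in> {..<n}" "p \<in> ?I" "q \<in> ?I" for b p q
    proof -
      have pq: "snd p \<in> simple" "snd q \<in> simple"
        using that F(2)[THEN subsetD] by (simp_all add: mem_Times_iff)
      then have "cinner (t (snd p)) (t (snd q)) = cinner (snd p j) (snd q j) * (\<Prod>i\<in>{1..d} - {j}. cinner (snd p i) (snd q i))"
        using cinner_t_upd[OF j pq, of "snd p j" "snd q j"] Pi_mem[OF pq(1) j] Pi_mem[OF pq(2) j] by simp
      then show ?thesis
        by (simp add: X_def x_def cinner.scaleR_left cinner.scaleR_right cinner.zero_left cinner.zero_right)
    qed
  qed
  also have "(\<Sum>b<n. (norm (\<Sum>p\<in>?I. ?c p *\<^sub>C X b p))\<^sup>2) = ?C\<^sup>2 * (\<Sum>b<n. (norm (\<Sum>k\<in>F. c b k *\<^sub>C t k))\<^sup>2)"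
  proof -
    have "(\<Sum>p\<in>?I. ?c p *\<^sub>C X b p) = ?C *\<^sub>R (\<Sum>k\<in>F. c b k *\<^sub>C t k)" if "b < n" for b
    proof -
      have "(\<Sum>p\<in>?I. ?c p *\<^sub>C X b p) = (\<Sum>b'<n. \<Sum>k\<in>F. c b' k *\<^sub>C X b (b', k))"
        by (simp add: sum.cartesian_product')
      also have "\<dots> = (\<Sum>b'<n. if b' = b then ?C *\<^sub>R (\<Sum>k\<in>F. c b k *\<^sub>C t k) else 0)"
        by (intro sum.cong refl)
          (auto simp: X_def scaleC.zero_right scaleC.scaleR_right scaleR_sum_right)
      also have "\<dots> = ?C *\<^sub>R (\<Sum>k\<in>F. c b k *\<^sub>C t k)"
        using that by simp
      finally show ?thesis .
    qed
    then have "(\<Sum>b<n. (norm (\<Sum>p\<in>?I. ?c p *\<^sub>C X b p))\<^sup>2) = (\<Sum>b<n. ?C\<^sup>2 * (norm (\<Sum>k\<in>F. c b k *\<^sub>C t k))\<^sup>2)"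
      by (intro sum.cong refl) (simp add: power_mult_distrib)
    then show ?thesis
      by (simp add: sum_distrib_left)
  qed
  also have "(\<Sum>a<n. (norm (\<Sum>p\<in>?I. ?c p *\<^sub>C Z a p))\<^sup>2)
      = (\<Sum>a<n. (norm (\<Sum>b<n. \<Sum>k\<in>F. c b k *\<^sub>C t (k(j := y a b (k j)))))\<^sup>2)"
    by (simp add: Z_def sum.cartesian_product')
  finally show ?thesis .
qed

declare One_nat_def [simp del]

text \<open>The vectors \<open>f k\<close> are arbitrary, so the same merged coefficients serve for
  the tensors and for their images; this makes the relation in \<open>position_exists\<close>
  additive.\<close>

lemma cspan_t_add:
  fixes c c' :: "(nat \<Rightarrow> 'h) \<Rightarrow> complex"
  assumes "finite F" "finite F'"
  defines "e \<equiv> \<lambda>k. (if k \<in> F then c k else 0) + (if k \<in> F' then c' k else 0)"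
  shows "(\<Sum>k\<in>F \<union> F'. e k *\<^sub>C f k) = (\<Sum>k\<in>F. c k *\<^sub>C f k) + (\<Sum>k\<in>F'. c' k *\<^sub>C (f k :: 'k))"
proof -
  have *: "(\<Sum>k\<in>F \<union> F'. (if k \<in> G then g k else 0) *\<^sub>C f k) = (\<Sum>k\<in>G. g k *\<^sub>C f k)"
    if "G \<subseteq> F \<union> F'" for G g
    using assms that by (intro sum.mono_neutral_cong_right) (auto simp: scaleC.zero_left)
  show ?thesis
    unfolding e_def scaleC_add_left sum.distrib by (subst (1 2) *) auto
qed

text \<open>A prescription on elementary tensors must respect the linear relations between them. The
  Schur estimate for a matrix of size \<open>1\<close> supplies the bound that settles this and
  continuity together.\<close>

lemma position_exists:
  assumes j: "j \<in> {1..d}" and X: "X \<in> bounded_ops (H j)"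
  shows "\<exists>T\<in>bounded_ops K. \<forall>\<xi>\<in>simple. T (t \<xi>) = t (\<xi>(j := X (\<xi> j)))"
proof -
  let ?u = "\<lambda>k. t (k(j := X (k j)))"
  define R where "R = {(\<Sum>k\<in>F. c k *\<^sub>C t k, \<Sum>k\<in>F. c k *\<^sub>C ?u k) | F c. finite F \<and> F \<subseteq> simple}"
  have RI: "(\<Sum>k\<in>F. c k *\<^sub>C t k, \<Sum>k\<in>F. c k *\<^sub>C ?u k) \<in> R" if "finite F" "F \<subseteq> simple" for F c
    unfolding R_def using that by blast
  have RE: "\<exists>F c. finite F \<and> F \<subseteq> simple \<and> v = (\<Sum>k\<in>F. c k *\<^sub>C t k) \<and> w = (\<Sum>k\<in>F. c k *\<^sub>C ?u k)"
    if "(v, w) \<in> R" for v w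
    using that unfolding R_def by blast
  have "\<exists>T\<in>bounded_ops K. \<forall>(v, w)\<in>R. blinfun_apply T v = w"
  proof (rule extend_bounded_relation[OF K])
    fix v w
    assume vw: "(v, w) \<in> R"
    then obtain F c where F: "finite F" "F \<subseteq> simple" and v: "v = (\<Sum>k\<in>F. c k *\<^sub>C t k)"
      and w: "w = (\<Sum>k\<in>F. c k *\<^sub>C ?u k)"
      using RE by blast
    show "(v + v', w + w') \<in> R" if "(v', w') \<in> R" for v' w'
    proof -
      obtain F' c' where F': "finite F'" "F' \<subseteq> simple" and v': "v' = (\<Sum>k\<in>F'. c' k *\<^sub>C t k)"
        and w': "w' = (\<Sum>k\<in>F'. c' k *\<^sub>C ?u k)"
        using RE[OF \<open>(v', w') \<in> R\<close>] by blast
      show ?thesis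
        unfolding v w v' w' cspan_t_add[OF F(1) F'(1), symmetric] using F F' by (intro RI) auto
    qed
    show "(e *\<^sub>C v, e *\<^sub>C w) \<in> R" for e
      using RI[OF F, of "\<lambda>k. e * c k"] by (simp add: v w scaleC.sum_right scaleC_scaleC)
    show "norm w \<le> mat_norm 1 (\<lambda>_ _. X) * norm v"
    proof (rule power2_le_imp_le)
      show "(norm w)\<^sup>2 \<le> (mat_norm 1 (\<lambda>_ _. X) * norm v)\<^sup>2"
        using amplified_bound_simple[OF j F, of 1 "\<lambda>_ _. X" "\<lambda>_. c"] X
        by (simp add: v w power_mult_distrib One_nat_def)
    qed (simp add: mat_norm_nonneg)
    have "?u k \<in> K" if "k \<in> F" for k
      using that F j bounded_opsD(2)[OF X] by (intro t_in_K fun_upd_simple) auto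
    then show "w \<in> K"
      unfolding w using K by (intro csubspace_sum[OF K]) (simp add: closed_csubspace_def)
  next
    have "Domain R = cspan (t ` simple)"
      unfolding cspan_t R_def by auto
    then show "closure (Domain R) = K"
      by (simp add: closure_cspan)
  qed
  then obtain T where T: "T \<in> bounded_ops K" "\<forall>(v, w)\<in>R. blinfun_apply T v = w"
    by blast
  have "T (t \<xi>) = ?u \<xi>" if "\<xi> \<in> simple" for \<xi>
    using bspec[OF T(2) RI[of "{\<xi>}" "\<lambda>_. 1"]] that by simp
  then show ?thesis
    using T(1) by blast
qed

abbreviation "simple_ops \<equiv> Pi {1..d} (\<lambda>j. bounded_ops (H j))"

lemma apply_simple: "x \<in> simple_ops \<Longrightarrow> \<xi> \<in> simple \<Longrightarrow> (\<lambda>j. x j (\<xi> j)) \<in> simple"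
  by (auto simp: Pi_def intro: bounded_opsD(2))

text \<open>The operators are applied in one position after the other: after \<open>m\<close> steps
  the coordinates up to \<open>m\<close> have been transformed. Changes outside
  \<open>{1..d}\<close> do not affect \<open>t\<close>.\<close>

lemma op_tensor_exists:
  assumes x: "x \<in> simple_ops"
  shows "\<exists>T\<in>bounded_ops K. \<forall>\<xi>\<in>simple. T (t \<xi>) = t (\<lambda>j. x j (\<xi> j))"
proof -
  have "\<exists>T\<in>bounded_ops K. \<forall>\<xi>\<in>simple. T (t \<xi>) = t (\<lambda>j. if j \<in> {1..m} then x j (\<xi> j) else \<xi> j)"
    if "m \<le> d" for m
    using that
  proof (induction m)
    case 0
    then show ?case
      using id_op[OF K] by (intro bexI[of _ "id_op K"]) (auto simp: t_in_K)
  next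
    case (Suc m)
    let ?\<eta> = "\<lambda>\<xi> m j. if j \<in> {1..m} then x j (\<xi> j) else \<xi> j"
    obtain T where T: "T \<in> bounded_ops K" "\<And>\<xi>. \<xi> \<in> simple \<Longrightarrow> T (t \<xi>) = t (?\<eta> \<xi> m)"
      using Suc by auto
    have m: "Suc m \<in> {1..d}"
      using Suc.prems by simp
    obtain S where S: "S \<in> bounded_ops K"
      "\<And>\<xi>. \<xi> \<in> simple \<Longrightarrow> S (t \<xi>) = t (\<xi>(Suc m := x (Suc m) (\<xi> (Suc m))))"
      using position_exists[OF m, of "x (Suc m)"] x m by blast
    have "(S o\<^sub>L T) (t \<xi>) = t (?\<eta> \<xi> (Suc m))" if \<xi>: "\<xi> \<in> simple" for \<xi>
    proof -
      have \<eta>: "?\<eta> \<xi> m \<in> simple"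
        using \<xi> x by (auto simp: Pi_def intro: bounded_opsD(2))
      have "(?\<eta> \<xi> m)(Suc m := x (Suc m) (?\<eta> \<xi> m (Suc m))) = ?\<eta> \<xi> (Suc m)"
        by (auto simp: fun_eq_iff le_Suc_eq)
      then show ?thesis
        using T(2)[OF \<xi>] S(2)[OF \<eta>] by (simp only: blinfun_apply_blinfun_compose)
    qed
    then show ?case
      using bounded_ops_closed(4)[OF K S(1) T(1)] by blast
  qed
  from this[OF order_refl] obtain T where T: "T \<in> bounded_ops K"
    "\<And>\<xi>. \<xi> \<in> simple \<Longrightarrow> T (t \<xi>) = t (\<lambda>j. if j \<in> {1..d} then x j (\<xi> j) else \<xi> j)"
    by blast
  have "t (\<lambda>j. if j \<in> {1..d} then x j (\<xi> j) else \<xi> j) = t (\<lambda>j. x j (\<xi> j))" if "\<xi> \<in> simple" for \<xi>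
    by (rule t_cong[symmetric, OF apply_simple[OF x that]]) simp
  then show ?thesis
    using T by auto
qed

abbreviation "ot \<equiv> op_tensor d H K t"

lemma op_tensor_eqI:
  fixes x :: "nat \<Rightarrow> 'h operator"
  assumes "T \<in> bounded_ops K" "\<And>\<xi>. \<xi> \<in> simple \<Longrightarrow> T (t \<xi>) = t (\<lambda>j. x j (\<xi> j))"
  shows "ot x = T"
  unfolding op_tensor_def using assms by (intro the_equality bounded_ops_tensor_eqI) auto

lemma op_tensor:
  assumes "x \<in> simple_ops"
  shows "ot x \<in> bounded_ops K" "\<xi> \<in> simple \<Longrightarrow> ot x (t \<xi>) = t (\<lambda>j. x j (\<xi> j))"
proof -
  obtain T where T: "T \<in> bounded_ops K" "\<And>\<xi>. \<xi> \<in> simple \<Longrightarrow> T (t \<xi>) = t (\<lambda>j. x j (\<xi> j))"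
    using op_tensor_exists[OF assms] by blast
  then have "ot x = T"
    by (rule op_tensor_eqI)
  then show "ot x \<in> bounded_ops K" "\<xi> \<in> simple \<Longrightarrow> ot x (t \<xi>) = t (\<lambda>j. x j (\<xi> j))"
    using T by auto
qed

lemma op_tensor_cong:
  assumes x: "x \<in> simple_ops" and eq: "\<And>j. j \<in> {1..d} \<Longrightarrow> x j = y j"
  shows "ot x = ot y"
proof (rule op_tensor_eqI[symmetric])
  show "ot x \<in> bounded_ops K"
    by (rule op_tensor(1)[OF x])
  show "ot x (t \<xi>) = t (\<lambda>j. y j (\<xi> j))" if "\<xi> \<in> simple" for \<xi>
    unfolding op_tensor(2)[OF x that] using apply_simple[OF x that] eq by (intro t_cong) auto
qed

lemma op_tensor_compose:
  assumes x: "x \<in> simple_ops" and y: "y \<in> simple_ops"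
  shows "ot x o\<^sub>L ot y = ot (\<lambda>j. x j o\<^sub>L y j)"
  using op_tensor(1)[OF x] op_tensor(1)[OF y]
  by (intro op_tensor_eqI[symmetric] bounded_ops_closed(4)[OF K])
    (simp_all add: op_tensor(2)[OF y] op_tensor(2)[OF x] apply_simple[OF y])

text \<open>An adjoint exists abstractly; testing it on elementary tensors moves each
  \<open>x j\<close> across its own factor and identifies it.\<close>

lemma op_tensor_adjoint:
  assumes x: "x \<in> simple_ops" and adj: "\<And>j. j \<in> {1..d} \<Longrightarrow> is_adjoint (x j) (y j)"
  shows "is_adjoint (ot x) (ot y)"
proof -
  have y: "y \<in> simple_ops"
    using x adj factor bounded_ops_adjoint by blast
  obtain S where S: "is_adjoint (ot x) S"
    using adjoint_exists bounded_opsD(1)[OF op_tensor(1)[OF x]] by metis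
  have SB: "S \<in> bounded_ops K"
    by (rule bounded_ops_adjoint[OF K op_tensor(1)[OF x] S])
  have "ot y = S"
  proof (rule op_tensor_eqI[OF SB], rule tensor_ext)
    fix \<xi>
    assume \<xi>: "\<xi> \<in> simple"
    show "S (t \<xi>) \<in> K" "t (\<lambda>j. y j (\<xi> j)) \<in> K"
      by (rule bounded_opsD(2)[OF SB], rule t_in_K[OF apply_simple[OF y \<xi>]])
    fix \<eta>
    assume \<eta>: "\<eta> \<in> simple"
    have "cinner (t \<eta>) (S (t \<xi>)) = cinner (ot x (t \<eta>)) (t \<xi>)"
      using is_adjoint_sym[OF S] by (simp add: is_adjoint_def)
    also have "\<dots> = (\<Prod>j=1..d. cinner (x j (\<eta> j)) (\<xi> j))"
      by (simp only: op_tensor(2)[OF x \<eta>] cinner_t[OF apply_simple[OF x \<eta>] \<xi>])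
    also have "\<dots> = (\<Prod>j=1..d. cinner (\<eta> j) (y j (\<xi> j)))"
      using is_adjoint_sym[OF adj] by (intro prod.cong refl) (simp add: is_adjoint_def)
    also have "\<dots> = cinner (t \<eta>) (t (\<lambda>j. y j (\<xi> j)))"
      by (simp only: cinner_t[OF \<eta> apply_simple[OF y \<xi>]])
    finally show "cinner (t \<eta>) (S (t \<xi>)) = cinner (t \<eta>) (t (\<lambda>j. y j (\<xi> j)))" .
  qed
  then show ?thesis
    using S by simp
qed

lemma id_op_simple: "(\<lambda>j. id_op (H j)) \<in> simple_ops"
  using id_op(1)[OF factor] by auto

lemma op_tensor_id: "ot (\<lambda>j. id_op (H j)) = id_op K"
proof (rule op_tensor_eqI[OF id_op(1)[OF K]])
  fix \<xi>
  assume \<xi>: "\<xi> \<in> simple"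
  have "t (\<lambda>j. id_op (H j) (\<xi> j)) = t \<xi>"
    using apply_simple[OF id_op_simple \<xi>] id_op(2)[OF factor] Pi_mem[OF \<xi>] by (intro t_cong) auto
  then show "id_op K (t \<xi>) = t (\<lambda>j. id_op (H j) (\<xi> j))"
    by (simp add: id_op(2)[OF K] t_in_K[OF \<xi>])
qed

text \<open>Elementary tensors are closed under products and adjoints, so their ultraweak span is a
  von Neumann algebra. Every competitor in the intersection contains that span, hence the two
  coincide.\<close>

lemma vn_tensor:
  assumes N: "\<And>j. j \<in> {1..d} \<Longrightarrow> von_neumann_algebra (H j) (N j)"
  shows "von_neumann_algebra K (vn_tensor d H K t N)"
    and "vn_tensor d H K t N = ultraweak_span (ot ` Pi {1..d} N)"
proof -
  let ?E = "ot ` Pi {1..d} N"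
  have NB: "Pi {1..d} N \<subseteq> simple_ops"
    using N by (intro Pi_mono) (simp add: von_neumann_algebra_def)
  have vn: "von_neumann_algebra K (ultraweak_span ?E)"
  proof (rule von_neumann_algebra_ultraweak_span[OF K])
    show "?E \<subseteq> bounded_ops K"
      using op_tensor(1) NB by blast
    have "(\<lambda>j. id_op (H j)) \<in> Pi {1..d} N"
      using N by (auto simp: von_neumann_algebra_def)
    then show "id_op K \<in> ?E"
      using op_tensor_id by (metis image_eqI)
    show "T o\<^sub>L S \<in> ?E" if "T \<in> ?E" "S \<in> ?E" for T S
    proof -
      from that obtain x y where x: "x \<in> Pi {1..d} N" and y: "y \<in> Pi {1..d} N" and TS: "T = ot x" "S = ot y"
        by blast
      have "(\<lambda>j. x j o\<^sub>L y j) \<in> Pi {1..d} N"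
        using N x y by (auto simp: von_neumann_algebra_def Pi_iff)
      then show ?thesis
        unfolding TS op_tensor_compose[OF subsetD[OF NB x] subsetD[OF NB y]] by (rule imageI)
    qed
    show "\<exists>S\<in>?E. is_adjoint T S" if "T \<in> ?E" for T
    proof -
      from that obtain x where x: "x \<in> Pi {1..d} N" and T: "T = ot x"
        by blast
      have "\<forall>j\<in>{1..d}. \<exists>y\<in>N j. is_adjoint (x j) y"
        using N x by (auto simp: von_neumann_algebra_def Pi_iff)
      then obtain y where y: "\<And>j. j \<in> {1..d} \<Longrightarrow> y j \<in> N j \<and> is_adjoint (x j) (y j)"
        by metis
      then have "is_adjoint T (ot y)"
        unfolding T using x NB by (intro op_tensor_adjoint) blast+
      then show ?thesis
        using y by blast
    qed
  qed
  show eq: "vn_tensor d H K t N = ultraweak_span ?E"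
  proof
    show "vn_tensor d H K t N \<subseteq> ultraweak_span ?E"
      unfolding vn_tensor_def using vn ultraweak_span_superset[of ?E] by blast
    show "ultraweak_span ?E \<subseteq> vn_tensor d H K t N"
      unfolding vn_tensor_def
      by (intro Inter_greatest ultraweak_span_least) (auto intro: von_neumann_algebra_closed_subspace)
  qed
  show "von_neumann_algebra K (vn_tensor d H K t N)"
    unfolding eq by (rule vn)
qed

section \<open>Operators in one tensor position\<close>

abbreviation "pos \<equiv> tensor_position d H K t"

lemma position_simple:
  "X \<in> bounded_ops (H j) \<Longrightarrow> (\<lambda>i. if i = j then X else id_op (H i)) \<in> simple_ops"
  using id_op(1)[OF factor] by auto

lemma position:
  assumes X: "X \<in> bounded_ops (H j)"
  shows "pos j X \<in> bounded_ops K" "\<xi> \<in> simple \<Longrightarrow> pos j X (t \<xi>) = t (\<xi>(j := X (\<xi> j)))"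
proof -
  show "pos j X \<in> bounded_ops K"
    unfolding tensor_position_def by (rule op_tensor(1)[OF position_simple[OF X]])
  show "pos j X (t \<xi>) = t (\<xi>(j := X (\<xi> j)))" if \<xi>: "\<xi> \<in> simple"
    unfolding tensor_position_def op_tensor(2)[OF position_simple[OF X] \<xi>]
    using apply_simple[OF position_simple[OF X] \<xi>] id_op(2)[OF factor] Pi_mem[OF \<xi>] by (intro t_cong) auto
qed

lemma position_compose:
  assumes "j \<in> {1..d}" "X \<in> bounded_ops (H j)" "Y \<in> bounded_ops (H j)"
  shows "pos j X o\<^sub>L pos j Y = pos j (X o\<^sub>L Y)"
  using assms bounded_ops_closed(4)[OF factor]
  by (intro bounded_ops_tensor_eqI bounded_ops_closed(4)[OF K] position(1))
    (simp_all add: position(2) fun_upd_simple bounded_opsD(2)[of Y])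

lemma position_commute:
  assumes "i \<noteq> j" "i \<in> {1..d}" "j \<in> {1..d}" "X \<in> bounded_ops (H i)" "Y \<in> bounded_ops (H j)"
  shows "pos i X o\<^sub>L pos j Y = pos j Y o\<^sub>L pos i X"
  using assms
  by (intro bounded_ops_tensor_eqI bounded_ops_closed(4)[OF K] position(1))
    (simp_all add: position(2) fun_upd_simple bounded_opsD(2)[of X] bounded_opsD(2)[of Y] fun_upd_twist)

text \<open>Linearity of \<open>t\<close> in one coordinate comes from the inner product formula,
  since inner products with elementary tensors separate the points of \<open>K\<close>.\<close>

lemma t_upd_diff:
  assumes j: "j \<in> {1..d}" and \<xi>: "\<xi> \<in> simple" and v: "v \<in> H j" "w \<in> H j"
  shows "t (\<xi>(j := v - w)) = t (\<xi>(j := v)) - t (\<xi>(j := w))"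
proof (rule tensor_ext)
  have vw: "v - w \<in> H j"
    by (rule csubspace_diff[OF factor[OF j] v])
  show "t (\<xi>(j := v - w)) \<in> K" "t (\<xi>(j := v)) - t (\<xi>(j := w)) \<in> K"
    using vw v \<xi> by (auto intro!: csubspace_diff[OF K] t_in_K fun_upd_simple)
  fix \<eta>
  assume \<eta>: "\<eta> \<in> simple"
  have "cinner (t \<eta>) (t (\<xi>(j := u))) = cinner (\<eta> j) u * (\<Prod>i\<in>{1..d} - {j}. cinner (\<eta> i) (\<xi> i))"
    if "u \<in> H j" for u
    using cinner_t_upd[OF j \<eta> \<xi> Pi_mem[OF \<eta> j] that] by simp
  then show "cinner (t \<eta>) (t (\<xi>(j := v - w))) = cinner (t \<eta>) (t (\<xi>(j := v)) - t (\<xi>(j := w)))"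
    using v vw by (simp add: cinner.diff_right left_diff_distrib)
qed

lemma position_diff:
  assumes j: "j \<in> {1..d}" and X: "X \<in> bounded_ops (H j)" and Y: "Y \<in> bounded_ops (H j)"
  shows "pos j (X - Y) = pos j X - pos j Y"
proof (rule bounded_ops_tensor_eqI)
  have XY: "X - Y \<in> bounded_ops (H j)"
    by (rule bounded_ops_closed(5)[OF factor[OF j] X Y])
  show "pos j (X - Y) \<in> bounded_ops K" "pos j X - pos j Y \<in> bounded_ops K"
    using X Y XY by (auto intro: bounded_ops_closed(5)[OF K] position(1))
  show "pos j (X - Y) (t \<xi>) = (pos j X - pos j Y) (t \<xi>)" if "\<xi> \<in> simple" for \<xi>
    using that by (simp add: position(2) X Y XY blinfun.diff_left t_upd_diff[OF j] bounded_opsD(2)[OF X] bounded_opsD(2)[OF Y])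
qed

lemma position_adjoint:
  assumes "X \<in> bounded_ops (H j)" "is_adjoint X Y"
  shows "is_adjoint (pos j X) (pos j Y)"
  unfolding tensor_position_def
  using assms is_adjoint_id_op[OF factor] by (intro op_tensor_adjoint position_simple) auto

lemma position_in_vn_tensor:
  assumes N: "\<And>j. j \<in> {1..d} \<Longrightarrow> von_neumann_algebra (H j) (N j)" and "X \<in> N j"
  shows "pos j X \<in> vn_tensor d H K t N"
proof -
  have "(\<lambda>i. if i = j then X else id_op (H i)) \<in> Pi {1..d} N"
    using assms by (auto simp: von_neumann_algebra_def)
  then show ?thesis
    using vn_tensor(2)[of N] N ultraweak_span_superset[of "ot ` Pi {1..d} N"]
    by (auto simp: tensor_position_def)
qed

text \<open>The Schur estimate covers combinations of elementary tensors; closure and compression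
  carry it to all vectors. The constant is independent of the other factors, as is needed to control
  commutators on the tensor product.\<close>

lemma position_amplified_bound:
  assumes j: "j \<in> {1..d}" and y: "\<And>a b. a < n \<Longrightarrow> b < n \<Longrightarrow> y a b \<in> bounded_ops (H j)"
  shows "mat_norm n (\<lambda>a b. pos j (y a b)) \<le> mat_norm n y"
proof -
  let ?C = "mat_norm n y" and ?Y = "\<lambda>a b. pos j (y a b)"
  have YB: "?Y a b \<in> bounded_ops K" if "a < n" "b < n" for a b
    by (rule position(1)[OF y[OF that]])
  have span: "vec_norm n (mat_apply n ?Y v) \<le> ?C * vec_norm n v"
    if v: "\<And>b. b < n \<Longrightarrow> v b \<in> cspan (t ` simple)" for v
  proof -
    have "\<exists>F c. finite F \<and> F \<subseteq> simple \<and> v b = (\<Sum>k\<in>F. c k *\<^sub>C t k)" if "b < n" for b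
      using v[OF that] unfolding cspan_t mem_Collect_eq by metis
    then obtain F c where F: "\<And>b. b < n \<Longrightarrow> finite (F b) \<and> F b \<subseteq> simple"
      and vF: "\<And>b. b < n \<Longrightarrow> v b = (\<Sum>k\<in>F b. c b k *\<^sub>C t k)"
      by metis
    \<comment> \<open>The Schur estimate wants one finite family for all coordinates of
      \<open>v\<close>; missing coefficients are set to \<open>0\<close>.\<close>
    let ?F = "\<Union>b<n. F b"
    define e where "e = (\<lambda>b k. if k \<in> F b then c b k else 0)"
    have F': "finite ?F" "?F \<subseteq> simple"
      using F by auto
    have v_eq: "v b = (\<Sum>k\<in>?F. e b k *\<^sub>C t k)" if "b < n" for b
      unfolding vF[OF that] e_def using F' that
      by (intro sum.mono_neutral_cong_left) (auto simp: scaleC.zero_left)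
    have "mat_apply n ?Y v a = (\<Sum>b<n. \<Sum>k\<in>?F. e b k *\<^sub>C t (k(j := y a b (k j))))" if "a < n" for a
      unfolding mat_apply_def
    proof (intro sum.cong refl)
      fix b
      assume "b \<in> {..<n}"
      then have b: "b < n"
        by simp
      have "?Y a b (t k) = t (k(j := y a b (k j)))" if "k \<in> ?F" for k
        using F'(2) that by (intro position(2) y \<open>a < n\<close> b) blast
      then show "?Y a b (v b) = (\<Sum>k\<in>?F. e b k *\<^sub>C t (k(j := y a b (k j))))"
        unfolding v_eq[OF b] blinfun.sum_right bounded_opsD(1)[OF YB[OF \<open>a < n\<close> b]]
        by (intro sum.cong refl) simp
    qed
    then have "(vec_norm n (mat_apply n ?Y v))\<^sup>2
        = (\<Sum>a<n. (norm (\<Sum>b<n. \<Sum>k\<in>?F. e b k *\<^sub>C t (k(j := y a b (k j)))))\<^sup>2)"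
      unfolding vec_norm_sq by (intro sum.cong refl) simp
    also have "\<dots> \<le> ?C\<^sup>2 * (\<Sum>b<n. (norm (\<Sum>k\<in>?F. e b k *\<^sub>C t k))\<^sup>2)"
      by (rule amplified_bound_simple[OF j F' y])
    also have "\<dots> = (?C * vec_norm n v)\<^sup>2"
      unfolding power_mult_distrib vec_norm_sq using v_eq by simp
    finally show ?thesis
      by (rule power2_le_imp_le) (simp add: mat_norm_nonneg)
  qed
  have inK: "vec_norm n (mat_apply n ?Y v) \<le> ?C * vec_norm n v" if v: "\<And>b. v b \<in> K" for v
  proof -
    have "\<exists>s. (\<forall>m. s m \<in> cspan (t ` simple)) \<and> s \<longlonglongrightarrow> v b" for b
      using v[of b] closure_cspan closure_sequential by metis
    then obtain s where s: "\<And>b m. s b m \<in> cspan (t ` simple)" "\<And>b. s b \<longlonglongrightarrow> v b"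
      by metis
    show ?thesis
    proof (rule LIMSEQ_le)
      show "(\<lambda>m. vec_norm n (mat_apply n ?Y (\<lambda>b. s b m))) \<longlonglongrightarrow> vec_norm n (mat_apply n ?Y v)"
        unfolding L2_set_def mat_apply_def by (intro tendsto_intros s)
      show "(\<lambda>m. ?C * vec_norm n (\<lambda>b. s b m)) \<longlonglongrightarrow> ?C * vec_norm n v"
        unfolding L2_set_def by (intro tendsto_intros s)
      show "\<exists>M. \<forall>m\<ge>M. vec_norm n (mat_apply n ?Y (\<lambda>b. s b m)) \<le> ?C * vec_norm n (\<lambda>b. s b m)"
        using span[of "\<lambda>b. s b _"] s(1) by blast
    qed
  qed
  show ?thesis
  proof (rule mat_norm_le[OF _ mat_norm_nonneg])
    fix v :: "nat \<Rightarrow> 'k"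
    let ?Pv = "\<lambda>b. id_op K (v b)"
    \<comment> \<open>Components orthogonal to \<open>K\<close> are annihilated by every entry, and
      projecting does not increase the norm of the vector.\<close>
    have "vec_norm n (mat_apply n ?Y v) = vec_norm n (mat_apply n ?Y ?Pv)"
      by (intro L2_set_cong refl arg_cong[of _ _ norm])
        (auto simp: mat_apply_def bounded_ops_id_op[OF K YB])
    also have "\<dots> \<le> ?C * vec_norm n ?Pv"
      by (rule inK) (rule bounded_opsD(2)[OF id_op(1)[OF K]])
    also have "\<dots> \<le> ?C * vec_norm n v"
      by (intro mult_left_mono L2_set_mono norm_id_op_le[OF K] mat_norm_nonneg) auto
    finally show "vec_norm n (mat_apply n ?Y v) \<le> ?C * vec_norm n v" .
  qed
qed

end

section \<open>Subadditivity for compositions of channels\<close>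

lemma amplify_comp: "amplify (f \<circ> g) x = amplify f (amplify g x)"
  by (simp add: amplify_def)

lemma channel_comp:
  assumes f: "channel K M f" and g: "channel K M g"
  shows "channel K M (f \<circ> g)"
proof -
  have "amplify g x \<in> matrices n M" if "x \<in> matrices n M" for n x
    using g that by (auto simp: channel_def matrices_def amplify_def)
  then have "completely_positive M (f \<circ> g)"
    using f g by (simp add: channel_def completely_positive_def amplify_comp)
  moreover have "linear_map_on M (f \<circ> g)" "f \<circ> g \<in> M \<rightarrow> M"
    using f g by (auto simp: channel_def linear_map_on_def Pi_iff)
  moreover have "normal_map M M (f \<circ> g)"
    using f g unfolding channel_def normal_map_def by (blast intro: continuous_map_compose)
  ultimately show ?thesis
    using f g by (simp add: channel_def)
qed

lemma channel_id: "channel K M id"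
  by (simp add: channel_def linear_map_on_def completely_positive_def amplify_def normal_map_def)

text \<open>The last channel acts first. The displacement then splits as
  \<open>F (g x - x) + (F x - x)\<close> with \<open>F\<close> the product of the earlier ones, and
  the induction hypothesis applies to the same \<open>x\<close>.\<close>

primrec channel_prod :: "(nat \<Rightarrow> 'a \<Rightarrow> 'a) \<Rightarrow> nat \<Rightarrow> 'a \<Rightarrow> 'a" where
  "channel_prod f 0 = id"
| "channel_prod f (Suc m) = channel_prod f m \<circ> f (Suc m)"

lemma channel_channel_prod:
  "(\<And>j. j \<in> {1..m} \<Longrightarrow> channel K M (f j)) \<Longrightarrow> channel K M (channel_prod f m)"
  by (induction m) (auto intro!: channel_comp channel_id simp del: One_nat_def)

lemma channel_prod_displacement:
  assumes vn: "von_neumann_algebra K M" and ch: "\<And>j. j \<in> {1..m} \<Longrightarrow> channel K M (f j)"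
    and x: "x \<in> matrices n M" "mat_selfadjoint n x"
  shows "mat_norm n (\<lambda>a b. amplify (channel_prod f m) x a b - x a b)
    \<le> (\<Sum>j=1..m. mat_norm n (\<lambda>a b. amplify (f j) x a b - x a b))"
  using ch
proof (induction m)
  case 0
  then show ?case
    by (simp add: amplify_def)
next
  case (Suc m)
  let ?F = "channel_prod f m" and ?g = "f (Suc m)"
  let ?y = "\<lambda>a b. amplify ?g x a b - x a b"
  have sub: "ultraweakly_closed_subspace M"
    using vn by (rule von_neumann_algebra_closed_subspace)
  have F: "channel K M ?F" and g: "channel K M ?g"
    using Suc.prems by (auto intro!: channel_channel_prod)
  note gx = channel_selfadjoint_contraction[OF vn g x]
  \<comment> \<open>The displacement of \<open>?g\<close> is again self-adjoint, which is what the
    contraction property of \<open>?F\<close> requires.\<close>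
  have y: "?y \<in> matrices n M" "mat_selfadjoint n ?y"
    by (intro matrices_diff[OF sub gx(1) x(1)] mat_selfadjoint_diff gx(2) x(2))+
  have "mat_norm n (\<lambda>a b. amplify (channel_prod f (Suc m)) x a b - x a b)
      = mat_norm n (\<lambda>a b. amplify ?F ?y a b + (amplify ?F x a b - x a b))"
  proof (rule mat_norm_cong)
    fix a b
    assume "a < n" "b < n"
    then have "amplify ?g x a b \<in> M" "x a b \<in> M"
      using gx(1) x(1) by (auto simp: matrices_def)
    moreover have "linear_map_on M ?F"
      using F by (simp add: channel_def)
    ultimately have "?F (amplify ?g x a b - x a b) = ?F (amplify ?g x a b) - ?F (x a b)"
      by (intro linear_map_on_diff[OF sub])
    then show "amplify (channel_prod f (Suc m)) x a b - x a b = amplify ?F ?y a b + (amplify ?F x a b - x a b)"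
      by (simp add: amplify_def)
  qed
  also have "\<dots> \<le> mat_norm n (amplify ?F ?y) + mat_norm n (\<lambda>a b. amplify ?F x a b - x a b)"
    by (rule mat_norm_triangle)
  also have "\<dots> \<le> mat_norm n ?y + (\<Sum>j=1..m. mat_norm n (\<lambda>a b. amplify (f j) x a b - x a b))"
    using Suc by (intro add_mono channel_selfadjoint_contraction(3)[OF vn F y]) auto
  finally show ?case
    by (simp add: add.commute o_def)
qed

lemma cost_cb_upper:
  assumes "n \<ge> 1" "x \<in> matrices n N" "mat_selfadjoint n x" "resource_seminorm n S x \<le> 1"
  shows "ennreal (mat_norm n (\<lambda>i j. amplify \<Phi> x i j - x i j)) \<le> cost_cb N S \<Phi>"
  unfolding cost_cb_def using assms by (intro SUP_upper2[of n] SUP_upper) auto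

lemma cost_cb_least:
  assumes "\<And>n x. n \<ge> 1 \<Longrightarrow> x \<in> matrices n N \<Longrightarrow> mat_selfadjoint n x \<Longrightarrow> resource_seminorm n S x \<le> 1 \<Longrightarrow>
    ennreal (mat_norm n (\<lambda>i j. amplify \<Phi> x i j - x i j)) \<le> C"
  shows "cost_cb N S \<Phi> \<le> C"
  unfolding cost_cb_def using assms by (intro SUP_least) auto

lemma resource_seminorm_mono: "S \<subseteq> S' \<Longrightarrow> resource_seminorm n S x \<le> resource_seminorm n S' x"
  unfolding resource_seminorm_def by (rule SUP_subset_mono) auto

text \<open>The joint semi-norm dominates each single one, so an \<open>x\<close> that competes for
  the joint cost competes for every summand, where its displacement is bounded.\<close>

lemma cost_cb_channel_prod_le:
  assumes vn: "von_neumann_algebra K M" and ch: "\<And>j. j \<in> {1..m} \<Longrightarrow> channel K M (f j)"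
    and \<Psi>: "\<And>x. x \<in> M \<Longrightarrow> \<Psi> x = channel_prod f m x"
  shows "cost_cb M (\<Union>j\<in>{1..m}. S j) \<Psi> \<le> (\<Sum>j=1..m. cost_cb M (S j) (f j))"
proof (rule cost_cb_least)
  fix n x
  assume x: "n \<ge> 1" "x \<in> matrices n M" "mat_selfadjoint n x"
    and S: "resource_seminorm n (\<Union>j\<in>{1..m}. S j) x \<le> 1"
  have "mat_norm n (\<lambda>a b. amplify \<Psi> x a b - x a b)
      = mat_norm n (\<lambda>a b. amplify (channel_prod f m) x a b - x a b)"
    using x(2) by (intro mat_norm_cong) (simp add: amplify_def matrices_def \<Psi>)
  also have "\<dots> \<le> (\<Sum>j=1..m. mat_norm n (\<lambda>a b. amplify (f j) x a b - x a b))"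
    by (rule channel_prod_displacement[OF vn ch x(2,3)])
  finally have "ennreal (mat_norm n (\<lambda>a b. amplify \<Psi> x a b - x a b))
      \<le> (\<Sum>j=1..m. ennreal (mat_norm n (\<lambda>a b. amplify (f j) x a b - x a b)))"
    by (simp add: sum_ennreal mat_norm_nonneg ennreal_leI)
  also have "\<dots> \<le> (\<Sum>j=1..m. cost_cb M (S j) (f j))"
  proof (rule sum_mono)
    fix j
    assume "j \<in> {1..m}"
    then have "S j \<subseteq> (\<Union>j\<in>{1..m}. S j)"
      by blast
    then have "resource_seminorm n (S j) x \<le> 1"
      by (rule order_trans[OF resource_seminorm_mono S])
    then show "ennreal (mat_norm n (\<lambda>a b. amplify (f j) x a b - x a b)) \<le> cost_cb M (S j) (f j)"
      using x by (intro cost_cb_upper)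
  qed
  finally show "ennreal (mat_norm n (\<lambda>a b. amplify \<Psi> x a b - x a b)) \<le> (\<Sum>j=1..m. cost_cb M (S j) (f j))" .
qed

section \<open>The cost as a supremum of numerical values\<close>

lemma mat_form_scaleR: "mat_form n x (\<lambda>i. r *\<^sub>R \<xi> i) (\<lambda>i. r *\<^sub>R \<xi> i) = complex_of_real (r\<^sup>2) * mat_form n x \<xi> \<xi>"
  by (simp add: mat_form_def mat_apply_scaleR cinner.scaleR_left cinner.scaleR_right sum_distrib_left
      scaleR_conv_of_real power2_eq_square mult_ac)

text \<open>A vector is projected to \<open>H\<close> and normalised; if its projection vanishes, so
  does the form.\<close>

lemma mat_norm_le_unit_vectors:
  fixes H :: "'h::chilbert_space set"
  assumes H: "closed_csubspace H" and x: "x \<in> matrices n (bounded_ops H)" "mat_selfadjoint n x"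
    and c: "c \<ge> 0"
    and num: "\<And>\<xi>. (\<And>i. \<xi> i \<in> H) \<Longrightarrow> vec_norm n \<xi> = 1 \<Longrightarrow> \<bar>Re (mat_form n x \<xi> \<xi>)\<bar> \<le> c"
  shows "mat_norm n x \<le> c"
proof (rule mat_norm_le_numerical_radius[OF x(2) c])
  fix \<xi> :: "nat \<Rightarrow> 'h"
  define \<eta> where "\<eta> = (\<lambda>i. id_op H (\<xi> i))"
  have \<eta>H: "\<eta> i \<in> H" for i
    unfolding \<eta>_def by (rule bounded_opsD(2)[OF id_op(1)[OF H]])
  have "\<bar>Re (mat_form n x \<eta> \<eta>)\<bar> \<le> c * (vec_norm n \<eta>)\<^sup>2"
  proof (cases "vec_norm n \<eta> = 0")
    case True
    then show ?thesis
      using abs_mat_form_le_mat_norm[of n x \<eta>] by simp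
  next
    case False
    let ?r = "1 / vec_norm n \<eta>"
    have "\<bar>Re (mat_form n x (\<lambda>i. ?r *\<^sub>R \<eta> i) (\<lambda>i. ?r *\<^sub>R \<eta> i))\<bar> \<le> c"
    proof (rule num)
      show "?r *\<^sub>R \<eta> i \<in> H" for i
        using H \<eta>H unfolding closed_csubspace_def scaleC_of_real[symmetric] by blast
      show "vec_norm n (\<lambda>i. ?r *\<^sub>R \<eta> i) = 1"
        using False unfolding vec_norm_scaleR by simp
    qed
    then have "?r\<^sup>2 * \<bar>Re (mat_form n x \<eta> \<eta>)\<bar> \<le> c"
      unfolding mat_form_scaleR by (simp add: abs_mult del: of_real_power)
    then show ?thesis
      using False by (simp add: field_simps)
  qed
  also have "\<dots> \<le> c * (vec_norm n \<xi>)\<^sup>2"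
    unfolding \<eta>_def by (intro mult_left_mono power_mono L2_set_mono norm_id_op_le[OF H] c) auto
  finally show "\<bar>Re (mat_form n x \<xi> \<xi>)\<bar> \<le> c * (vec_norm n \<xi>)\<^sup>2"
    unfolding \<eta>_def mat_form_id_op[OF H x(1), of \<xi> \<xi>, symmetric] .
qed

definition displacement_value :: "('h::chilbert_space operator \<Rightarrow> 'h operator) \<Rightarrow>
    nat \<times> 'h opmat \<times> (nat \<Rightarrow> 'h) \<Rightarrow> real" where
  "displacement_value \<Phi> = (\<lambda>(n, x, \<xi>). Re (mat_form n (\<lambda>i j. amplify \<Phi> x i j - x i j) \<xi> \<xi>))"

text \<open>The sign condition keeps displacement values faithful when they are cast to
  \<open>ennreal\<close>, so that casting commutes with their sum. It loses nothing in the supremum,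
  because \<open>x\<close> may be replaced by its negative.\<close>

definition admissible :: "'h::chilbert_space set \<Rightarrow> 'h operator set \<Rightarrow> 'h operator set \<Rightarrow>
    ('h operator \<Rightarrow> 'h operator) \<Rightarrow> (nat \<times> 'h opmat \<times> (nat \<Rightarrow> 'h)) set" where
  "admissible H N S \<Phi> = {(n, x, \<xi>). n \<ge> 1 \<and> x \<in> matrices n N \<and> mat_selfadjoint n x
     \<and> resource_seminorm n S x \<le> 1 \<and> (\<forall>i. \<xi> i \<in> H) \<and> vec_norm n \<xi> = 1
     \<and> displacement_value \<Phi> (n, x, \<xi>) \<ge> 0}"

lemma resource_seminorm_uminus: "resource_seminorm n S (\<lambda>i j. - x i j) = resource_seminorm n S x"
proof -
  have "mat_norm n (mat_commutator n (mat_diag s) (\<lambda>i j. - x i j)) = mat_norm n (mat_commutator n (mat_diag s) x)" for s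
  proof -
    have "mat_norm n (mat_commutator n (mat_diag s) (\<lambda>i j. - x i j))
        = mat_norm n (\<lambda>i j. - mat_commutator n (mat_diag s) x i j)"
      by (intro mat_norm_cong blinfun_eqI)
        (simp add: mat_commutator_diag blinfun.minus_left blinfun.minus_right blinfun.diff_left)
    then show ?thesis
      by (simp only: mat_norm_uminus)
  qed
  then show ?thesis
    by (simp add: resource_seminorm_def)
qed

lemma cost_cb_le_SUP_displacement:
  fixes H :: "'h::chilbert_space set"
  assumes vn: "von_neumann_algebra H N" and ch: "channel H N \<Phi>"
  shows "cost_cb N S \<Phi> \<le> (SUP p\<in>admissible H N S \<Phi>. ennreal (displacement_value \<Phi> p))"
    (is "_ \<le> ?sup")
proof (rule cost_cb_least)
  fix n x
  assume x: "n \<ge> 1" "x \<in> matrices n N" "mat_selfadjoint n x" and S: "resource_seminorm n S x \<le> 1"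
  have sub: "ultraweakly_closed_subspace N"
    using vn by (rule von_neumann_algebra_closed_subspace)
  have H: "closed_csubspace H" and NB: "N \<subseteq> bounded_ops H"
    using vn by (auto simp: von_neumann_algebra_def)
  note \<Phi>x = channel_selfadjoint_contraction[OF vn ch x(2,3)]
  let ?y = "\<lambda>x i j. amplify \<Phi> x i j - x i j"
  have "?y x \<in> matrices n N"
    by (rule matrices_diff[OF sub \<Phi>x(1) x(2)])
  then have y: "?y x \<in> matrices n (bounded_ops H)" "mat_selfadjoint n (?y x)"
    using NB mat_selfadjoint_diff[OF \<Phi>x(2) x(3)] by (auto simp: matrices_def)
  show "ennreal (mat_norm n (?y x)) \<le> ?sup"
  \<comment> \<open>A finite supremum is a real bound for all displacement values; an infinite one
    bounds everything.\<close>
  proof (cases ?sup rule: ennreal_cases)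
    case (real s)
    have upper: "displacement_value \<Phi> p \<le> s" if "p \<in> admissible H N S \<Phi>" for p
    proof -
      have "ennreal (displacement_value \<Phi> p) \<le> ennreal s"
        unfolding real(2)[symmetric] using that by (rule SUP_upper)
      then show ?thesis
        using real(1) by (simp add: ennreal_le_iff)
    qed
    have "mat_norm n (?y x) \<le> s"
    proof (rule mat_norm_le_unit_vectors[OF H y real(1)])
      fix \<xi> :: "nat \<Rightarrow> 'h"
      assume \<xi>: "\<And>i. \<xi> i \<in> H" "vec_norm n \<xi> = 1"
      let ?x' = "\<lambda>i j. - x i j"
      have x': "?x' \<in> matrices n N" "mat_selfadjoint n ?x'" "resource_seminorm n S ?x' \<le> 1"
        using x closed_subspace_uminus[OF sub] S
        by (auto simp: matrices_def resource_seminorm_uminus mat_selfadjoint_def is_adjoint_def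
            blinfun.minus_left cinner.minus_left cinner.minus_right)
      have lin: "linear_map_on N \<Phi>"
        using ch by (simp add: channel_def)
      have "mat_form n (?y ?x') \<xi> \<xi> = mat_form n (\<lambda>i j. - ?y x i j) \<xi> \<xi>"
        unfolding mat_form_expand using x(2) linear_map_on_uminus[OF lin]
        by (intro sum.cong refl) (simp add: amplify_def matrices_def)
      \<comment> \<open>Linearity of \<open>\<Phi>\<close> makes the value odd in \<open>x\<close>,
        so at least one of \<open>x\<close> and \<open>?x'\<close> gives an admissible
        triple.\<close>
      then have neg: "displacement_value \<Phi> (n, ?x', \<xi>) = - displacement_value \<Phi> (n, x, \<xi>)"
        by (simp only: displacement_value_def case_prod_conv mat_form_uminus uminus_complex.sel)
      show "\<bar>Re (mat_form n (?y x) \<xi> \<xi>)\<bar> \<le> s"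
      proof (cases "displacement_value \<Phi> (n, x, \<xi>) \<ge> 0")
        case True
        then have "(n, x, \<xi>) \<in> admissible H N S \<Phi>"
          using x S \<xi> by (simp add: admissible_def)
        then show ?thesis
          using upper True by (fastforce simp: displacement_value_def)
      next
        case False
        then have "(n, ?x', \<xi>) \<in> admissible H N S \<Phi>"
          using x x' \<xi> neg by (simp add: admissible_def)
        then show ?thesis
          using upper[of "(n, ?x', \<xi>)"] neg False by (simp add: displacement_value_def)
      qed
    qed
    then show ?thesis
      unfolding real(2) by (rule ennreal_leI)
  next
    case top
    then show ?thesis
      by (simp only: top_greatest)
  qed
qed

text \<open>Joint choices from all factors exist only if no admissible set is empty. The zero matrix
  of size \<open>1\<close> with any unit vector of \<open>H\<close> is always available.\<close>

lemma admissible_nonempty: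
  assumes vn: "von_neumann_algebra H N" and lin: "linear_map_on N \<Phi>" and v: "v \<in> H" "v \<noteq> 0"
  shows "admissible H N S \<Phi> \<noteq> {}"
proof -
  have sub: "ultraweakly_closed_subspace N"
    using vn by (rule von_neumann_algebra_closed_subspace)
  have H: "closed_csubspace H" and P: "id_op H \<in> N"
    using vn by (auto simp: von_neumann_algebra_def)
  let ?\<xi> = "\<lambda>_::nat. (1 / norm v) *\<^sub>R v" and ?x = "\<lambda>(_::nat) (_::nat). 0 :: 'a operator"
  have "(1 / norm v) *\<^sub>R v \<in> H"
    using H v unfolding closed_csubspace_def scaleC_of_real[symmetric] by blast
  moreover have "vec_norm 1 ?\<xi> = 1"
    using v by (simp add: L2_set_def)
  moreover have "resource_seminorm 1 S ?x \<le> 1"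
  proof -
    have "mat_norm 1 (mat_commutator 1 (mat_diag s) ?x) = mat_norm 1 ?x" for s
      by (intro mat_norm_cong blinfun_eqI) (simp add: mat_commutator_diag blinfun.zero_right)
    then show ?thesis
      by (simp add: resource_seminorm_def SUP_le_iff)
  qed
  moreover have "displacement_value \<Phi> (1, ?x, ?\<xi>) = 0"
    using linear_map_on_diff[OF sub lin P P]
    by (simp add: displacement_value_def mat_form_expand amplify_def cinner.zero_right)
  ultimately have "(1, ?x, ?\<xi>) \<in> admissible H N S \<Phi>"
    using closed_subspace_0[OF sub P] by (simp add: admissible_def matrices_def mat_selfadjoint_def)
  then show ?thesis
    by blast
qed

text \<open>The suprema are taken one index at a time; \<open>c\<close> collects the terms whose
  argument has already been fixed, so the induction generalises over it. Nonempty \<open>P j\<close>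
  are needed for a constant to move through a supremum.\<close>

lemma sum_SUP_le_ennreal:
  fixes f :: "'j \<Rightarrow> 'p \<Rightarrow> ennreal"
  assumes "finite A" "\<And>j. j \<in> A \<Longrightarrow> P j \<noteq> {}"
    and "\<And>p. (\<And>j. j \<in> A \<Longrightarrow> p j \<in> P j) \<Longrightarrow> c + (\<Sum>j\<in>A. f j (p j)) \<le> C"
  shows "c + (\<Sum>j\<in>A. SUP q\<in>P j. f j q) \<le> C"
  using assms
proof (induction A arbitrary: c)
  case empty
  then show ?case
    by auto
next
  case (insert a A)
  let ?s = "\<Sum>j\<in>A. SUP q\<in>P j. f j q"
  have "(c + f a q) + ?s \<le> C" if q: "q \<in> P a" for q
  proof (rule insert.IH)
    show "(c + f a q) + (\<Sum>j\<in>A. f j (p j)) \<le> C" if p: "\<And>j. j \<in> A \<Longrightarrow> p j \<in> P j" for p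
    proof -
      have "(\<Sum>j\<in>A. f j ((p(a := q)) j)) = (\<Sum>j\<in>A. f j (p j))"
        using insert.hyps by (intro sum.cong) auto
      moreover have "(p(a := q)) j \<in> P j" if "j \<in> insert a A" for j
        using p q that by auto
      ultimately show ?thesis
        using insert.prems(2)[of "p(a := q)"] insert.hyps by (simp add: add.assoc)
    qed
  qed (use insert.prems in auto)
  then have "(SUP q\<in>P a. (c + ?s) + f a q) \<le> C"
    by (intro SUP_least) (simp add: add_ac)
  then have "(c + ?s) + (SUP q\<in>P a. f a q) \<le> C"
    using insert.prems(1)[of a] by (simp add: ennreal_SUP_add_right)
  then show ?case
    using insert.hyps by (simp add: add_ac)
qed

lemma linear_map_on_sum:
  assumes sub: "ultraweakly_closed_subspace M" and lin: "linear_map_on M \<Psi>" and "finite A" "A \<noteq> {}"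
    and x: "\<And>j. j \<in> A \<Longrightarrow> x j \<in> M"
  shows "(\<Sum>j\<in>A. x j) \<in> M" "\<Psi> (\<Sum>j\<in>A. x j) = (\<Sum>j\<in>A. \<Psi> (x j))"
proof -
  have "(\<Sum>j\<in>A. x j) \<in> M \<and> \<Psi> (\<Sum>j\<in>A. x j) = (\<Sum>j\<in>A. \<Psi> (x j))"
    using assms(3,4) x
    by (induction A rule: finite_ne_induct)
      (use sub lin in \<open>auto simp: ultraweakly_closed_subspace_def linear_map_on_def\<close>)
  then show "(\<Sum>j\<in>A. x j) \<in> M" "\<Psi> (\<Sum>j\<in>A. x j) = (\<Sum>j\<in>A. \<Psi> (x j))"
    by auto
qed

section \<open>Sums of operators in different tensor positions\<close>

lemma prod_sum2_PiE:
  fixes f :: "'i \<Rightarrow> 'a \<Rightarrow> 'a \<Rightarrow> 'c::comm_semiring_1"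
  assumes "finite A" "\<And>i. i \<in> A \<Longrightarrow> finite (B i)"
  shows "(\<Sum>\<alpha>\<in>PiE A B. \<Sum>\<beta>\<in>PiE A B. \<Prod>i\<in>A. f i (\<alpha> i) (\<beta> i)) = (\<Prod>i\<in>A. \<Sum>a\<in>B i. \<Sum>b\<in>B i. f i a b)"
  by (simp add: prod_sum_PiE[OF assms])

text \<open>Singles out the coordinate on which a block acts; the remaining coordinates
  \<open>g\<close> label copies of it.\<close>

lemma sum_PiE_remove:
  fixes f :: "('i \<Rightarrow> 'a) \<Rightarrow> 'c::comm_monoid_add"
  assumes "j \<in> A"
  shows "(\<Sum>\<alpha>\<in>PiE A B. f \<alpha>) = (\<Sum>a\<in>B j. \<Sum>g\<in>PiE (A - {j}) B. f (g(j := a)))"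
proof -
  have "PiE A B = (\<lambda>(a, g). g(j := a)) ` (B j \<times> PiE (A - {j}) B)"
    using PiE_insert_eq[of j "A - {j}" B] assms by (simp add: insert_absorb)
  moreover have "inj_on (\<lambda>(a, g). g(j := a)) (B j \<times> PiE (A - {j}) B)"
    by (rule inj_combinator) simp
  ultimately show ?thesis
    by (simp add: sum.reindex case_prod_unfold sum.cartesian_product)
qed

context hilbert_tensor_product
begin

abbreviation "idx n \<equiv> PiE {1..d} (\<lambda>i. {..<n i :: nat})"

text \<open>The entries of the matrix of \<open>y\<close> acting in position \<open>j\<close>, as a matrix over
  \<open>\<bbbM>\<^bsub>n 1\<^esub> \<otimes> \<dots> \<otimes> \<bbbM>\<^bsub>n d\<^esub>\<close>, whose indices are the multi-indices.\<close>

definition block :: "nat \<Rightarrow> 'h opmat \<Rightarrow> (nat \<Rightarrow> nat) \<Rightarrow> (nat \<Rightarrow> nat) \<Rightarrow> 'k operator" where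
  "block j y \<alpha> \<beta> = (if \<forall>i\<in>{1..d} - {j}. \<alpha> i = \<beta> i then pos j (y (\<alpha> j) (\<beta> j)) else 0)"

text \<open>Once coordinate \<open>j\<close> is separated, the block matrix is a direct sum of
  copies of \<open>y\<close> in position \<open>j\<close>, one copy for each choice \<open>g\<close>
  of the other coordinates. A direct sum of copies obeys the same norm bound.\<close>

lemma block_bound:
  assumes j: "j \<in> {1..d}" and y: "y \<in> matrices (n j) (bounded_ops (H j))"
  shows "(\<Sum>\<alpha>\<in>idx n. (norm (\<Sum>\<beta>\<in>idx n. block j y \<alpha> \<beta> (v \<beta>)))\<^sup>2)
    \<le> (mat_norm (n j) y)\<^sup>2 * (\<Sum>\<beta>\<in>idx n. (norm (v \<beta>))\<^sup>2)"
proof -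
  let ?G = "PiE ({1..d} - {j}) (\<lambda>i. {..<n i})" and ?Y = "\<lambda>a b. pos j (y a b)"
  note split = sum_PiE_remove[OF j]
  have finG: "finite ?G"
    by (intro finite_PiE) auto
  have inner: "(\<Sum>\<beta>\<in>idx n. block j y (g(j := a)) \<beta> (v \<beta>)) = mat_apply (n j) ?Y (\<lambda>b. v (g(j := b))) a"
    if g: "g \<in> ?G" for g a
  proof -
    have "block j y (g(j := a)) (g'(j := b)) (v (g'(j := b))) = (if g' = g then ?Y a b (v (g(j := b))) else 0)"
      if g': "g' \<in> ?G" for g' b
    proof -
      have "(\<forall>i\<in>{1..d} - {j}. (g(j := a)) i = (g'(j := b)) i) \<longleftrightarrow> g' = g"
        using PiE_ext[OF g' g] by auto
      then show ?thesis
        by (auto simp: block_def)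
    qed
    then have "(\<Sum>\<beta>\<in>idx n. block j y (g(j := a)) \<beta> (v \<beta>))
        = (\<Sum>b<n j. \<Sum>g'\<in>?G. if g' = g then ?Y a b (v (g(j := b))) else 0)"
      unfolding split by (intro sum.cong refl) auto
    then show ?thesis
      using g finG by (simp add: mat_apply_def)
  qed
  have "(\<Sum>\<alpha>\<in>idx n. (norm (\<Sum>\<beta>\<in>idx n. block j y \<alpha> \<beta> (v \<beta>)))\<^sup>2)
      = (\<Sum>a<n j. \<Sum>g\<in>?G. (norm (mat_apply (n j) ?Y (\<lambda>b. v (g(j := b))) a))\<^sup>2)"
    unfolding split[where f = "\<lambda>\<alpha>. (norm (\<Sum>\<beta>\<in>idx n. block j y \<alpha> \<beta> (v \<beta>)))\<^sup>2"]
    by (intro sum.cong refl) (simp only: inner)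
  also have "\<dots> = (\<Sum>g\<in>?G. (vec_norm (n j) (mat_apply (n j) ?Y (\<lambda>b. v (g(j := b)))))\<^sup>2)"
    unfolding vec_norm_sq by (rule sum.swap)
  also have "\<dots> \<le> (\<Sum>g\<in>?G. (mat_norm (n j) y)\<^sup>2 * (vec_norm (n j) (\<lambda>b. v (g(j := b))))\<^sup>2)"
  proof (rule sum_mono)
    fix g
    have "mat_norm (n j) ?Y \<le> mat_norm (n j) y"
      using y by (intro position_amplified_bound[OF j]) (auto simp: matrices_def)
    then have "vec_norm (n j) (mat_apply (n j) ?Y (\<lambda>b. v (g(j := b)))) \<le> mat_norm (n j) y * vec_norm (n j) (\<lambda>b. v (g(j := b)))"
      by (intro order_trans[OF mat_norm_bound] mult_right_mono) auto
    then show "(vec_norm (n j) (mat_apply (n j) ?Y (\<lambda>b. v (g(j := b)))))\<^sup>2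
        \<le> (mat_norm (n j) y)\<^sup>2 * (vec_norm (n j) (\<lambda>b. v (g(j := b))))\<^sup>2"
      unfolding power_mult_distrib[symmetric] by (intro power_mono) auto
  qed
  also have "\<dots> = (mat_norm (n j) y)\<^sup>2 * (\<Sum>\<beta>\<in>idx n. (norm (v \<beta>))\<^sup>2)"
    unfolding split[where f = "\<lambda>\<beta>. (norm (v \<beta>))\<^sup>2"] vec_norm_sq sum_distrib_left by (rule sum.swap)
  finally show ?thesis .
qed

text \<open>\<open>mat_norm\<close> is for matrices indexed by numbers below \<open>m\<close>, so
  \<open>e\<close> enumerates the multi-indices.\<close>

lemma mat_norm_block_le:
  assumes j: "j \<in> {1..d}" and y: "y \<in> matrices (n j) (bounded_ops (H j))"
    and e: "bij_betw e {..<m} (idx n)"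
  shows "mat_norm m (\<lambda>p q. block j y (e p) (e q)) \<le> mat_norm (n j) y"
proof (rule mat_norm_le[OF _ mat_norm_nonneg])
  fix v :: "nat \<Rightarrow> 'k"
  let ?v = "\<lambda>\<beta>. v (inv_into {..<m} e \<beta>)"
  have v: "?v (e q) = v q" if "q < m" for q
    using e that by (simp add: bij_betw_def)
  have "mat_apply m (\<lambda>p q. block j y (e p) (e q)) v p = (\<Sum>\<beta>\<in>idx n. block j y (e p) \<beta> (?v \<beta>))" for p
    unfolding mat_apply_def sum.reindex_bij_betw[OF e, symmetric] using v by (intro sum.cong) auto
  then have "(vec_norm m (mat_apply m (\<lambda>p q. block j y (e p) (e q)) v))\<^sup>2
      = (\<Sum>\<alpha>\<in>idx n. (norm (\<Sum>\<beta>\<in>idx n. block j y \<alpha> \<beta> (?v \<beta>)))\<^sup>2)"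
    unfolding vec_norm_sq
    using sum.reindex_bij_betw[OF e, of "\<lambda>\<alpha>. (norm (\<Sum>\<beta>\<in>idx n. block j y \<alpha> \<beta> (?v \<beta>)))\<^sup>2"] by simp
  also have "\<dots> \<le> (mat_norm (n j) y)\<^sup>2 * (\<Sum>\<beta>\<in>idx n. (norm (?v \<beta>))\<^sup>2)"
    by (rule block_bound[where n = n, OF j y])
  also have "(\<Sum>\<beta>\<in>idx n. (norm (?v \<beta>))\<^sup>2) = (vec_norm m v)\<^sup>2"
    unfolding vec_norm_sq sum.reindex_bij_betw[OF e, symmetric] using v by (intro sum.cong) auto
  also have "(mat_norm (n j) y)\<^sup>2 * (vec_norm m v)\<^sup>2 = (mat_norm (n j) y * vec_norm m v)\<^sup>2"
    by (simp add: power_mult_distrib)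
  finally show "vec_norm m (mat_apply m (\<lambda>p q. block j y (e p) (e q)) v) \<le> mat_norm (n j) y * vec_norm m v"
    by (rule power2_le_imp_le) (simp add: mat_norm_nonneg)
qed

lemma product_vector_simple:
  assumes "\<And>i a. i \<in> {1..d} \<Longrightarrow> \<xi> i a \<in> H i"
  shows "(\<lambda>i. \<xi> i (\<alpha> i)) \<in> simple"
  using assms by auto

lemma product_vector_norm:
  assumes \<xi>: "\<And>i a. i \<in> {1..d} \<Longrightarrow> \<xi> i a \<in> H i"
    and unit: "\<And>i. i \<in> {1..d} \<Longrightarrow> vec_norm (n i) (\<xi> i) = 1"
  shows "(\<Sum>\<alpha>\<in>idx n. (norm (t (\<lambda>i. \<xi> i (\<alpha> i))))\<^sup>2) = 1"
proof -
  have "complex_of_real ((norm (t (\<lambda>i. \<xi> i (\<alpha> i))))\<^sup>2) = complex_of_real (\<Prod>i=1..d. (norm (\<xi> i (\<alpha> i)))\<^sup>2)" for \<alpha>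
  proof -
    have "(\<lambda>i. \<xi> i (\<alpha> i)) \<in> simple"
      using \<xi> by (rule product_vector_simple)
    from cinner_t[OF this this] show ?thesis
      by (simp only: cinner_self of_real_prod)
  qed
  then have "(\<Sum>\<alpha>\<in>idx n. (norm (t (\<lambda>i. \<xi> i (\<alpha> i))))\<^sup>2) = (\<Sum>\<alpha>\<in>idx n. \<Prod>i=1..d. (norm (\<xi> i (\<alpha> i)))\<^sup>2)"
    unfolding of_real_eq_iff by simp
  also have "\<dots> = (\<Prod>i=1..d. (vec_norm (n i) (\<xi> i))\<^sup>2)"
    unfolding vec_norm_sq by (rule prod_sum_PiE[symmetric]) auto
  also have "\<dots> = 1"
    using unit by (intro prod.neutral) simp
  finally show ?thesis .
qed

text \<open>The form factorises over the positions. Each position other than \<open>j\<close>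
  contributes the squared norm of a unit vector, that is \<open>1\<close>.\<close>

lemma product_vector_form:
  assumes j: "j \<in> {1..d}" and y: "y \<in> matrices (n j) (bounded_ops (H j))"
    and \<xi>: "\<And>i a. i \<in> {1..d} \<Longrightarrow> \<xi> i a \<in> H i"
    and unit: "\<And>i. i \<in> {1..d} \<Longrightarrow> vec_norm (n i) (\<xi> i) = 1"
  shows "(\<Sum>\<alpha>\<in>idx n. \<Sum>\<beta>\<in>idx n. cinner (t (\<lambda>i. \<xi> i (\<alpha> i))) (block j y \<alpha> \<beta> (t (\<lambda>i. \<xi> i (\<beta> i)))))
    = mat_form (n j) y (\<xi> j) (\<xi> j)"
proof -
  \<comment> \<open>The factor of position \<open>i\<close>: the form of \<open>y\<close> where the
    block acts, and elsewhere the diagonal Gram term, with \<open>0\<close> off the diagonal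
    encoding the unit matrix.\<close>
  define f where "f = (\<lambda>i a b. if i = j then cinner (\<xi> i a) (y a b (\<xi> i b))
    else if a = b then complex_of_real ((norm (\<xi> i a))\<^sup>2) else 0)"
  let ?\<Omega> = "\<lambda>\<alpha>. t (\<lambda>i. \<xi> i (\<alpha> i))"
  have entry: "cinner (?\<Omega> \<alpha>) (block j y \<alpha> \<beta> (?\<Omega> \<beta>)) = (\<Prod>i=1..d. f i (\<alpha> i) (\<beta> i))"
    if \<alpha>: "\<alpha> \<in> idx n" and \<beta>: "\<beta> \<in> idx n" for \<alpha> \<beta>
  proof (cases "\<forall>i\<in>{1..d} - {j}. \<alpha> i = \<beta> i")
    case True
    let ?y = "y (\<alpha> j) (\<beta> j)"
    have yB: "?y \<in> bounded_ops (H j)"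
      using y PiE_mem[OF \<alpha> j] PiE_mem[OF \<beta> j] by (auto simp: matrices_def)
    have "(\<lambda>i. \<xi> i (\<beta> i)) \<in> simple"
      using \<xi> by (rule product_vector_simple)
    note pos_\<Omega> = position(2)[OF yB this]
    have "cinner (?\<Omega> \<alpha>) (block j y \<alpha> \<beta> (?\<Omega> \<beta>))
        = cinner (t ((\<lambda>i. \<xi> i (\<alpha> i))(j := \<xi> j (\<alpha> j)))) (t ((\<lambda>i. \<xi> i (\<beta> i))(j := ?y (\<xi> j (\<beta> j)))))"
      using True by (simp add: block_def pos_\<Omega> fun_upd_idem)
    also have "\<dots> = cinner (\<xi> j (\<alpha> j)) (?y (\<xi> j (\<beta> j))) * (\<Prod>i\<in>{1..d} - {j}. cinner (\<xi> i (\<alpha> i)) (\<xi> i (\<beta> i)))"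
      by (intro cinner_t_upd j product_vector_simple \<xi> bounded_opsD(2)[OF yB])
    also have "\<dots> = f j (\<alpha> j) (\<beta> j) * (\<Prod>i\<in>{1..d} - {j}. f i (\<alpha> i) (\<beta> i))"
      using True by (intro arg_cong2[of _ _ _ _ times] prod.cong) (auto simp: f_def cinner_self)
    also have "\<dots> = (\<Prod>i=1..d. f i (\<alpha> i) (\<beta> i))"
      using j by (intro prod.remove[symmetric]) auto
    finally show ?thesis .
  next
    case False
    then obtain i where "i \<in> {1..d}" "i \<noteq> j" "\<alpha> i \<noteq> \<beta> i"
      by blast
    then have "(\<Prod>i=1..d. f i (\<alpha> i) (\<beta> i)) = 0"
      by (intro prod_zero bexI[of _ i]) (auto simp: f_def)
    moreover have "block j y \<alpha> \<beta> = 0"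
      unfolding block_def using False by (rule if_not_P)
    ultimately show ?thesis
      by (simp add: cinner.zero_right)
  qed
  have other: "(\<Sum>a<n i. \<Sum>b<n i. f i a b) = 1" if i: "i \<in> {1..d}" "i \<noteq> j" for i
  proof -
    have "(\<Sum>a<n i. \<Sum>b<n i. f i a b) = (\<Sum>a<n i. complex_of_real ((norm (\<xi> i a))\<^sup>2))"
      using i by (simp add: f_def)
    also have "\<dots> = complex_of_real ((vec_norm (n i) (\<xi> i))\<^sup>2)"
      by (simp add: vec_norm_sq)
    finally show ?thesis
      using unit[OF i(1)] by simp
  qed
  have "(\<Sum>\<alpha>\<in>idx n. \<Sum>\<beta>\<in>idx n. cinner (?\<Omega> \<alpha>) (block j y \<alpha> \<beta> (?\<Omega> \<beta>)))
      = (\<Sum>\<alpha>\<in>idx n. \<Sum>\<beta>\<in>idx n. \<Prod>i=1..d. f i (\<alpha> i) (\<beta> i))"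
    by (intro sum.cong refl entry)
  also have "\<dots> = (\<Prod>i=1..d. \<Sum>a<n i. \<Sum>b<n i. f i a b)"
    by (rule prod_sum2_PiE) auto
  also have "\<dots> = (\<Sum>a<n j. \<Sum>b<n j. f j a b) * (\<Prod>i\<in>{1..d} - {j}. \<Sum>a<n i. \<Sum>b<n i. f i a b)"
    using j by (intro prod.remove) auto
  also have "(\<Prod>i\<in>{1..d} - {j}. \<Sum>a<n i. \<Sum>b<n i. f i a b) = 1"
    using other by (intro prod.neutral) auto
  finally show ?thesis
    by (simp add: f_def mat_form_expand)
qed

section \<open>Blocks under adjoints, commutators and tensor channels\<close>

lemma block_in_vn_tensor:
  assumes N: "\<And>j. j \<in> {1..d} \<Longrightarrow> von_neumann_algebra (H j) (N j)"
    and "j \<in> {1..d}" "y \<in> matrices (n j) (N j)" "\<alpha> \<in> idx n" "\<beta> \<in> idx n"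
  shows "block j y \<alpha> \<beta> \<in> vn_tensor d H K t N"
proof -
  have vn: "von_neumann_algebra K (vn_tensor d H K t N)"
    using N by (rule vn_tensor(1))
  have "y (\<alpha> j) (\<beta> j) \<in> N j"
    using assms by (auto simp: matrices_def PiE_iff)
  then have "pos j (y (\<alpha> j) (\<beta> j)) \<in> vn_tensor d H K t N"
    using N by (intro position_in_vn_tensor[where N = N]) auto
  moreover from this have "0 \<in> vn_tensor d H K t N"
    by (rule closed_subspace_0[OF von_neumann_algebra_closed_subspace[OF vn]])
  ultimately show ?thesis
    by (simp add: block_def)
qed

lemma block_adjoint:
  assumes y: "y \<in> matrices (n j) (bounded_ops (H j))" "mat_selfadjoint (n j) y"
    and "j \<in> {1..d}" "\<alpha> \<in> idx n" "\<beta> \<in> idx n"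
  shows "is_adjoint (block j y \<alpha> \<beta>) (block j y \<beta> \<alpha>)"
proof -
  have "\<alpha> j < n j" "\<beta> j < n j"
    using assms by (auto simp: PiE_iff)
  then have "is_adjoint (pos j (y (\<alpha> j) (\<beta> j))) (pos j (y (\<beta> j) (\<alpha> j)))"
    using y by (intro position_adjoint) (auto simp: matrices_def mat_selfadjoint_def)
  then show ?thesis
    by (auto simp: block_def)
qed

lemma block_commutator:
  assumes i: "i \<in> {1..d}" and j: "j \<in> {1..d}" and s: "s \<in> bounded_ops (H j)"
    and y: "y \<in> matrices (n i) (bounded_ops (H i))" and \<alpha>: "\<alpha> \<in> idx n" and \<beta>: "\<beta> \<in> idx n"
  shows "(pos j s o\<^sub>L block i y \<alpha> \<beta>) - (block i y \<alpha> \<beta> o\<^sub>L pos j s)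
    = (if i = j then block j (mat_commutator (n j) (mat_diag s) y) \<alpha> \<beta> else 0)"
proof -
  have ab: "\<alpha> i < n i" "\<beta> i < n i"
    using i \<alpha> \<beta> by (auto simp: PiE_iff)
  then have yB: "y (\<alpha> i) (\<beta> i) \<in> bounded_ops (H i)"
    using y by (auto simp: matrices_def)
  have zero: "(T o\<^sub>L 0) - (0 o\<^sub>L T) = 0" for T :: "'k operator"
    by (rule blinfun_eqI) (simp add: blinfun.diff_left blinfun.zero_right)
  show ?thesis
  proof (cases "i = j")
    case True
    let ?z = "y (\<alpha> j) (\<beta> j)"
    have z: "?z \<in> bounded_ops (H j)"
      using yB True by simp
    note ops = bounded_ops_closed(4)[OF factor[OF j]]
    have "(pos j s o\<^sub>L pos j ?z) - (pos j ?z o\<^sub>L pos j s) = pos j ((s o\<^sub>L ?z) - (?z o\<^sub>L s))"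
      by (simp only: position_compose[OF j s z] position_compose[OF j z s] position_diff[OF j ops[OF s z] ops[OF z s]])
    also have "(s o\<^sub>L ?z) - (?z o\<^sub>L s) = mat_commutator (n j) (mat_diag s) y (\<alpha> j) (\<beta> j)"
      using ab True by (simp add: mat_commutator_diag)
    finally have "(pos j s o\<^sub>L pos j ?z) - (pos j ?z o\<^sub>L pos j s)
        = pos j (mat_commutator (n j) (mat_diag s) y (\<alpha> j) (\<beta> j))" .
    then show ?thesis
      using True zero by (simp add: block_def)
  next
    case False
    then show ?thesis
      using position_commute[OF _ j i s yB] zero by (simp add: block_def)
  qed
qed

text \<open>The other channels are unital, so they leave the identity operators in their positions
  unchanged.\<close>

lemma tensor_channel_position:
  assumes N: "\<And>j. j \<in> {1..d} \<Longrightarrow> von_neumann_algebra (H j) (N j)"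
    and ch: "\<And>j. j \<in> {1..d} \<Longrightarrow> channel (H j) (N j) (\<Phi> j)"
    and \<Psi>: "is_tensor_channel d H K t N \<Phi> \<Psi>" and j: "j \<in> {1..d}" and X: "X \<in> N j"
  shows "\<Psi> (pos j X) = pos j (\<Phi> j X)"
proof -
  let ?x = "\<lambda>X i. if i = j then X else id_op (H i)"
  have "?x X \<in> Pi {1..d} N"
    using N X by (auto simp: von_neumann_algebra_def)
  then have "\<Psi> (pos j X) = ot (\<lambda>i. \<Phi> i (?x X i))"
    using \<Psi> by (simp add: is_tensor_channel_def tensor_position_def)
  also have "\<dots> = pos j (\<Phi> j X)"
    unfolding tensor_position_def
  proof (rule op_tensor_cong[symmetric])
    have "\<Phi> j X \<in> bounded_ops (H j)"
      using ch[OF j] N[OF j] X by (auto simp: channel_def von_neumann_algebra_def)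
    then show "?x (\<Phi> j X) \<in> simple_ops"
      by (rule position_simple)
    show "?x (\<Phi> j X) i = \<Phi> i (?x X i)" if "i \<in> {1..d}" for i
      using ch[OF that] by (simp add: channel_def)
  qed
  finally show ?thesis .
qed

lemma block_diff:
  assumes "j \<in> {1..d}" "x \<in> matrices (n j) (bounded_ops (H j))" "y \<in> matrices (n j) (bounded_ops (H j))"
    and "\<alpha> \<in> idx n" "\<beta> \<in> idx n"
  shows "block j (\<lambda>a b. x a b - y a b) \<alpha> \<beta> = block j x \<alpha> \<beta> - block j y \<alpha> \<beta>"
proof -
  have "\<alpha> j < n j" "\<beta> j < n j"
    using assms by (auto simp: PiE_iff)
  then show ?thesis
    using assms by (auto simp: block_def matrices_def intro!: position_diff)
qed

text \<open>One choice \<open>p j\<close> for each factor yields a single competitor on the tensor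
  product, so the inequality holds before any supremum is taken.\<close>

lemma displacement_le_cost_tensor:
  assumes d: "d \<ge> 1"
    and N: "\<And>j. j \<in> {1..d} \<Longrightarrow> von_neumann_algebra (H j) (N j)"
    and ch: "\<And>j. j \<in> {1..d} \<Longrightarrow> channel (H j) (N j) (\<Phi> j)"
    and S: "\<And>j. j \<in> {1..d} \<Longrightarrow> S j \<subseteq> bounded_ops (H j)"
    and \<Psi>: "is_tensor_channel d H K t N \<Phi> \<Psi>"
    and p: "\<And>j. j \<in> {1..d} \<Longrightarrow> p j \<in> admissible (H j) (N j) (S j) (\<Phi> j)"
  shows "ennreal (\<Sum>j=1..d. displacement_value (\<Phi> j) (p j))
    \<le> cost_cb (vn_tensor d H K t N) (resource_join d H K t S) \<Psi>"
proof -
  let ?M = "vn_tensor d H K t N"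
  define n where "n = (\<lambda>j. fst (p j))"
  define x where "x = (\<lambda>j. fst (snd (p j)))"
  define \<xi> where "\<xi> = (\<lambda>j. snd (snd (p j)))"
  have p_eq: "p j = (n j, x j, \<xi> j)" for j
    by (simp add: n_def x_def \<xi>_def)
  have adm: "(n j, x j, \<xi> j) \<in> admissible (H j) (N j) (S j) (\<Phi> j)" if "j \<in> {1..d}" for j
    using p[OF that] by (simp only: p_eq)
  have n1: "n j \<ge> 1" and xN: "x j \<in> matrices (n j) (N j)" and xsa: "mat_selfadjoint (n j) (x j)"
    and xS: "resource_seminorm (n j) (S j) (x j) \<le> 1" and \<xi>H: "\<And>a. \<xi> j a \<in> H j"
    and unit: "vec_norm (n j) (\<xi> j) = 1"
    if "j \<in> {1..d}" for j
    using adm[OF that] by (auto simp: admissible_def)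
  have NB: "N j \<subseteq> bounded_ops (H j)" if "j \<in> {1..d}" for j
    using N[OF that] by (simp add: von_neumann_algebra_def)
  have xB: "x j \<in> matrices (n j) (bounded_ops (H j))" if "j \<in> {1..d}" for j
    using xN[OF that] NB[OF that] by (auto simp: matrices_def)
  have \<Phi>xN: "amplify (\<Phi> j) (x j) \<in> matrices (n j) (N j)" if "j \<in> {1..d}" for j
    using ch[OF that] xN[OF that] by (auto simp: channel_def matrices_def amplify_def)
  then have \<Phi>xB: "amplify (\<Phi> j) (x j) \<in> matrices (n j) (bounded_ops (H j))" if "j \<in> {1..d}" for j
    using that NB[OF that] by (auto simp: matrices_def)
  define y where "y = (\<lambda>j a b. amplify (\<Phi> j) (x j) a b - x j a b)"
  have yB: "y j \<in> matrices (n j) (bounded_ops (H j))" if "j \<in> {1..d}" for j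
    using xB[OF that] \<Phi>xB[OF that] bounded_ops_closed(5)[OF factor[OF that]] by (auto simp: y_def matrices_def)
  have vnM: "von_neumann_algebra K ?M"
    using N by (rule vn_tensor(1))
  then have subM: "ultraweakly_closed_subspace ?M" and PM: "id_op K \<in> ?M"
    by (auto simp: von_neumann_algebra_def intro: von_neumann_algebra_closed_subspace[OF vnM])
  have lin\<Psi>: "linear_map_on ?M \<Psi>"
    using \<Psi> by (simp add: is_tensor_channel_def channel_def)
  have blockM: "block j (x j) \<alpha> \<beta> \<in> ?M" if "j \<in> {1..d}" "\<alpha> \<in> idx n" "\<beta> \<in> idx n" for j \<alpha> \<beta>
    using N that xN by (intro block_in_vn_tensor[where n = n]) auto
  have \<Psi>_block: "\<Psi> (block j (x j) \<alpha> \<beta>) = block j (amplify (\<Phi> j) (x j)) \<alpha> \<beta>"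
    if j: "j \<in> {1..d}" and \<alpha>: "\<alpha> \<in> idx n" and \<beta>: "\<beta> \<in> idx n" for j \<alpha> \<beta>
  proof -
    have "x j (\<alpha> j) (\<beta> j) \<in> N j"
      using xN[OF j] PiE_mem[OF \<alpha> j] PiE_mem[OF \<beta> j] by (auto simp: matrices_def)
    then have "\<Psi> (pos j (x j (\<alpha> j) (\<beta> j))) = pos j (\<Phi> j (x j (\<alpha> j) (\<beta> j)))"
      using N ch by (intro tensor_channel_position[OF _ _ \<Psi> j]) auto
    moreover have "\<Psi> 0 = 0"
      using linear_map_on_diff[OF subM lin\<Psi> PM PM] by simp
    ultimately show ?thesis
      by (simp add: block_def amplify_def)
  qed
  have "finite (idx n)"
    by (intro finite_PiE) auto
  \<comment> \<open>The cost uses matrices indexed by numbers, hence the enumeration of the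
    multi-indices.\<close>
  then obtain e where e: "bij_betw e {..<card (idx n)} (idx n)"
    using ex_bij_betw_nat_finite by (metis lessThan_atLeast0)
  define m where "m = card (idx n)"
  note e = e[folded m_def]
  have e_idx: "e k \<in> idx n" if "k < m" for k
    using bij_betwE[OF e] that by auto
  \<comment> \<open>Every \<open>n j\<close> is positive, so a multi-index exists; the supremum in
    \<open>cost_cb\<close> starts at size \<open>1\<close>.\<close>
  have m1: "m \<ge> 1"
  proof -
    have "idx n \<noteq> {}"
      using n1 by (fastforce simp: PiE_eq_empty_iff lessThan_empty_iff)
    then show ?thesis
      using \<open>finite (idx n)\<close> by (simp add: m_def Suc_le_eq card_gt_0_iff One_nat_def)
  qed
  \<comment> \<open>Each summand is \<open>x j\<close> in position \<open>j\<close>, tensored with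
    the unit matrices of the other sizes.\<close>
  define X where "X = (\<lambda>k l. \<Sum>j=1..d. block j (x j) (e k) (e l))"
  have ne: "finite {1..d}" "{1..d} \<noteq> {}"
    using d by auto
  have X_M: "X \<in> matrices m ?M"
    unfolding matrices_def X_def using e_idx
    by (intro CollectI allI impI linear_map_on_sum(1)[OF subM lin\<Psi> ne] blockM) auto
  have X_sa: "mat_selfadjoint m X"
    unfolding mat_selfadjoint_def X_def using e_idx xB xsa
    by (intro allI impI is_adjoint_sum block_adjoint) auto
  have X_S: "resource_seminorm m (resource_join d H K t S) X \<le> 1"
    unfolding resource_seminorm_def
  proof (rule SUP_least)
    fix s'
    assume "s' \<in> resource_join d H K t S"
    then obtain j s where j: "j \<in> {1..d}" and s: "s \<in> S j" and s': "s' = pos j s"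
      by (auto simp: resource_join_def)
    have sB: "s \<in> bounded_ops (H j)"
      using S[OF j] s by blast
    let ?c = "mat_commutator (n j) (mat_diag s) (x j)"
    \<comment> \<open>The blocks of the other positions commute with \<open>s'\<close>, so the
      commutator is one block, whose norm is controlled by the commutator of \<open>s\<close> with
      \<open>x j\<close>.\<close>
    have "mat_norm m (mat_commutator m (mat_diag s') X) = mat_norm m (\<lambda>k l. block j ?c (e k) (e l))"
    proof (rule mat_norm_cong)
      fix k l
      assume kl: "k < m" "l < m"
      have "mat_commutator m (mat_diag s') X k l = (s' o\<^sub>L X k l) - (X k l o\<^sub>L s')"
        by (rule mat_commutator_diag[OF kl])
      also have "\<dots> = (\<Sum>i=1..d. (s' o\<^sub>L block i (x i) (e k) (e l)) - (block i (x i) (e k) (e l) o\<^sub>L s'))"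
        by (rule blinfun_eqI)
          (simp add: X_def blinfun.diff_left blinfun.sum_left blinfun.sum_right sum_subtractf)
      also have "\<dots> = (\<Sum>i=1..d. if i = j then block j ?c (e k) (e l) else 0)"
      proof (intro sum.cong refl)
        fix i
        assume "i \<in> {1..d}"
        then show "(s' o\<^sub>L block i (x i) (e k) (e l)) - (block i (x i) (e k) (e l) o\<^sub>L s')
            = (if i = j then block j ?c (e k) (e l) else 0)"
          using block_commutator[OF _ j sB xB e_idx[OF kl(1)] e_idx[OF kl(2)], of i] s' by auto
      qed
      also have "\<dots> = block j ?c (e k) (e l)"
        using j by simp
      finally show "mat_commutator m (mat_diag s') X k l = block j ?c (e k) (e l)" .
    qed
    also have "\<dots> \<le> mat_norm (n j) ?c"
    proof (rule mat_norm_block_le[OF j _ e])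
      have "?c a b \<in> bounded_ops (H j)" if "a < n j" "b < n j" for a b
        unfolding mat_commutator_diag[OF that] using that xB[OF j] sB
        by (intro bounded_ops_closed(4,5)[OF factor[OF j]]) (auto simp: matrices_def)
      then show "?c \<in> matrices (n j) (bounded_ops (H j))"
        by (simp add: matrices_def)
    qed
    finally have "ennreal (mat_norm m (mat_commutator m (mat_diag s') X)) \<le> ennreal (mat_norm (n j) ?c)"
      by (rule ennreal_leI)
    also have "\<dots> \<le> resource_seminorm (n j) (S j) (x j)"
      unfolding resource_seminorm_def using s by (rule SUP_upper)
    also have "\<dots> \<le> 1"
      by (rule xS[OF j])
    finally show "ennreal (mat_norm m (mat_commutator m (mat_diag s') X)) \<le> 1" .
  qed
  let ?Y = "\<lambda>k l. amplify \<Psi> X k l - X k l"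
  have Y: "?Y k l = (\<Sum>j=1..d. block j (y j) (e k) (e l))" if kl: "k < m" "l < m" for k l
  proof -
    have "\<Psi> (X k l) = (\<Sum>j=1..d. \<Psi> (block j (x j) (e k) (e l)))"
      unfolding X_def by (rule linear_map_on_sum(2)[OF subM lin\<Psi> ne]) (intro blockM e_idx kl)
    then have "?Y k l = (\<Sum>j=1..d. \<Psi> (block j (x j) (e k) (e l)) - block j (x j) (e k) (e l))"
      by (simp add: amplify_def X_def sum_subtractf)
    also have "\<dots> = (\<Sum>j=1..d. block j (y j) (e k) (e l))"
    proof (rule sum.cong[OF refl])
      fix j
      assume j: "j \<in> {1..d}"
      show "\<Psi> (block j (x j) (e k) (e l)) - block j (x j) (e k) (e l) = block j (y j) (e k) (e l)"
        unfolding y_def block_diff[OF j \<Phi>xB[OF j] xB[OF j] e_idx[OF kl(1)] e_idx[OF kl(2)]]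
          \<Psi>_block[OF j e_idx[OF kl(1)] e_idx[OF kl(2)]] ..
    qed
    finally show ?thesis .
  qed
  \<comment> \<open>The coordinates, by multi-index, of the tensor product of the unit vectors
    \<open>\<xi> i\<close>.\<close>
  define \<Omega> where "\<Omega> = (\<lambda>\<alpha>. t (\<lambda>i. \<xi> i (\<alpha> i)))"
  have \<Omega>1: "vec_norm m (\<lambda>k. \<Omega> (e k)) = 1"
  proof -
    have "(vec_norm m (\<lambda>k. \<Omega> (e k)))\<^sup>2 = (\<Sum>\<alpha>\<in>idx n. (norm (\<Omega> \<alpha>))\<^sup>2)"
      unfolding vec_norm_sq by (rule sum.reindex_bij_betw[OF e])
    also have "\<dots> = 1"
      unfolding \<Omega>_def using \<xi>H unit by (intro product_vector_norm) auto
    finally show ?thesis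
      by (simp add: power2_eq_1_iff) (metis L2_set_nonneg neg_0_le_iff_le not_one_le_zero)
  qed
  have "mat_form m ?Y (\<lambda>k. \<Omega> (e k)) (\<lambda>k. \<Omega> (e k))
      = (\<Sum>k<m. \<Sum>l<m. \<Sum>j=1..d. cinner (\<Omega> (e k)) (block j (y j) (e k) (e l) (\<Omega> (e l))))"
    unfolding mat_form_expand by (intro sum.cong refl) (simp add: Y blinfun.sum_left cinner.sum_right)
  also have "\<dots> = (\<Sum>k<m. \<Sum>j=1..d. \<Sum>l<m. cinner (\<Omega> (e k)) (block j (y j) (e k) (e l) (\<Omega> (e l))))"
    by (intro sum.cong refl sum.swap)
  also have "\<dots> = (\<Sum>j=1..d. \<Sum>k<m. \<Sum>l<m. cinner (\<Omega> (e k)) (block j (y j) (e k) (e l) (\<Omega> (e l))))"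
    by (rule sum.swap)
  also have "\<dots> = (\<Sum>j=1..d. mat_form (n j) (y j) (\<xi> j) (\<xi> j))"
  proof (rule sum.cong[OF refl])
    fix j
    assume j: "j \<in> {1..d}"
    have "(\<Sum>k<m. \<Sum>l<m. cinner (\<Omega> (e k)) (block j (y j) (e k) (e l) (\<Omega> (e l))))
        = (\<Sum>k<m. \<Sum>\<beta>\<in>idx n. cinner (\<Omega> (e k)) (block j (y j) (e k) \<beta> (\<Omega> \<beta>)))"
      by (intro sum.cong refl sum.reindex_bij_betw[OF e])
    also have "\<dots> = (\<Sum>\<alpha>\<in>idx n. \<Sum>\<beta>\<in>idx n. cinner (\<Omega> \<alpha>) (block j (y j) \<alpha> \<beta> (\<Omega> \<beta>)))"
      by (rule sum.reindex_bij_betw[OF e])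
    also have "\<dots> = mat_form (n j) (y j) (\<xi> j) (\<xi> j)"
      unfolding \<Omega>_def using \<xi>H unit by (intro product_vector_form j yB) auto
    finally show "(\<Sum>k<m. \<Sum>l<m. cinner (\<Omega> (e k)) (block j (y j) (e k) (e l) (\<Omega> (e l))))
        = mat_form (n j) (y j) (\<xi> j) (\<xi> j)" .
  qed
  finally have "Re (mat_form m ?Y (\<lambda>k. \<Omega> (e k)) (\<lambda>k. \<Omega> (e k))) = (\<Sum>j=1..d. displacement_value (\<Phi> j) (p j))"
    by (simp add: displacement_value_def p_eq y_def)
  moreover have "Re (mat_form m ?Y (\<lambda>k. \<Omega> (e k)) (\<lambda>k. \<Omega> (e k))) \<le> mat_norm m ?Y"
    using Re_mat_form_le_mat_norm[of m ?Y "\<lambda>k. \<Omega> (e k)"] by (simp add: \<Omega>1)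
  ultimately have "ennreal (\<Sum>j=1..d. displacement_value (\<Phi> j) (p j)) \<le> ennreal (mat_norm m ?Y)"
    by (intro ennreal_leI) simp
  also have "\<dots> \<le> cost_cb ?M (resource_join d H K t S) \<Psi>"
    by (rule cost_cb_upper[OF m1 X_M X_sa X_S])
  finally show ?thesis .
qed

section \<open>The tensor channel as a composition of single-position channels\<close>

lemma tensor_channel_eq_channel_prod:
  assumes N: "\<And>j. j \<in> {1..d} \<Longrightarrow> von_neumann_algebra (H j) (N j)"
    and ch: "\<And>j. j \<in> {1..d} \<Longrightarrow> channel (H j) (N j) (\<Phi> j)"
    and \<Psi>: "is_tensor_channel d H K t N \<Phi> \<Psi>"
    and \<Phi>t: "\<And>j. j \<in> {1..d} \<Longrightarrow> is_position_channel d H K t N j (\<Phi> j) (\<Phi>t j)"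
    and x: "x \<in> vn_tensor d H K t N"
  shows "\<Psi> x = channel_prod \<Phi>t d x"
proof -
  let ?M = "vn_tensor d H K t N"
  \<comment> \<open>The channel of position \<open>Suc m\<close> acts first and changes the
    elementary tensor, so the induction has to be over all \<open>x\<close>.\<close>
  have elementary: "channel_prod \<Phi>t m (ot x) = ot (\<lambda>j. if j \<in> {1..m} then \<Phi> j (x j) else x j)"
    if "m \<le> d" "x \<in> Pi {1..d} N" for m x
    using that
  proof (induction m arbitrary: x)
    case 0
    then show ?case
      by simp
  next
    case (Suc m)
    let ?x = "\<lambda>i. (if i = Suc m then \<Phi> (Suc m) else id) (x i)"
    have m: "Suc m \<in> {1..d}"
      using Suc.prems by simp
    have x': "?x \<in> Pi {1..d} N"
      using Suc.prems(2) ch[OF m] by (auto simp: channel_def Pi_iff)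
    have "\<Phi>t (Suc m) (ot x) = ot ?x"
      using \<Phi>t[OF m] Suc.prems(2) by (simp add: is_position_channel_def is_tensor_channel_def)
    moreover have "(\<lambda>j. if j \<in> {1..m} then \<Phi> j (?x j) else ?x j) = (\<lambda>j. if j \<in> {1..Suc m} then \<Phi> j (x j) else x j)"
      by (auto simp: fun_eq_iff le_Suc_eq)
    ultimately show ?case
      using Suc.IH[OF _ x'] Suc.prems(1) by simp
  qed
  have NB: "Pi {1..d} N \<subseteq> simple_ops"
    using N by (intro Pi_mono) (simp add: von_neumann_algebra_def)
  have vnM: "von_neumann_algebra K ?M" and M: "?M = ultraweak_span (ot ` Pi {1..d} N)"
    using N by (auto intro!: vn_tensor)
  have F: "channel K ?M (channel_prod \<Phi>t d)"
    using \<Phi>t by (intro channel_channel_prod) (auto simp: is_position_channel_def is_tensor_channel_def)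
  have G: "channel K ?M \<Psi>"
    using \<Psi> by (simp add: is_tensor_channel_def)
  have eq: "\<Psi> T = channel_prod \<Phi>t d T" if "T \<in> ot ` Pi {1..d} N" for T
  proof -
    from that obtain x where x: "x \<in> Pi {1..d} N" and T: "T = ot x"
      by blast
    have \<Phi>x: "(\<lambda>j. \<Phi> j (x j)) \<in> Pi {1..d} N"
      using x ch by (auto simp: channel_def Pi_iff)
    have "\<Psi> T = ot (\<lambda>j. \<Phi> j (x j))"
      using \<Psi> x by (simp add: T is_tensor_channel_def)
    also have "\<dots> = ot (\<lambda>j. if j \<in> {1..d} then \<Phi> j (x j) else x j)"
      using \<Phi>x NB by (intro op_tensor_cong) auto
    also have "\<dots> = channel_prod \<Phi>t d T"
      unfolding T by (rule elementary[OF order_refl x, symmetric])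
    finally show ?thesis .
  qed
  show ?thesis
    using F G by (intro normal_linear_maps_eq[OF von_neumann_algebra_closed_subspace[OF vnM] M _ _ _ _ eq x])
      (simp_all add: channel_def)
qed

text \<open>Settles the case without unit vectors: a zero coordinate makes the inner product of an
  elementary tensor with itself vanish, and these tensors span a dense subspace.\<close>

lemma trivial_factor:
  assumes "j \<in> {1..d}" "H j \<subseteq> {0}"
  shows "K = {0}"
proof -
  have t0: "t \<xi> = 0" if \<xi>: "\<xi> \<in> simple" for \<xi>
  proof -
    have "\<xi> j = 0"
      using Pi_mem[OF \<xi> assms(1)] assms(2) by auto
    then have "(\<Prod>i=1..d. cinner (\<xi> i) (\<xi> i)) = 0"
      using assms(1) by (intro prod_zero bexI[of _ j]) auto
    then have "cinner (t \<xi>) (t \<xi>) = 0"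
      by (simp add: cinner_t[OF \<xi> \<xi>])
    then show ?thesis
      by simp
  qed
  have "v = 0" if "v \<in> K" for v
  proof (rule closed_contains_K[where P = "\<lambda>v. v = 0", OF _ _ that])
    show "(\<Sum>k\<in>F. c k *\<^sub>C t k) = 0" if "F \<subseteq> simple" for F c
      using that t0 by (intro sum.neutral ballI) (auto simp: scaleC.zero_right)
  qed simp
  then show ?thesis
    using K by (auto simp: closed_csubspace_def)
qed

end

lemma cost_cb_trivial_space:
  assumes vn: "von_neumann_algebra {0} M" and ch: "channel {0} M \<Phi>"
  shows "cost_cb M S \<Phi> = 0"
proof -
  have M0: "T = 0" if "T \<in> M" for T
  proof (rule blinfun_eqI)
    have "T \<in> bounded_ops {0}"
      using vn that by (auto simp: von_neumann_algebra_def)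
    then show "T v = blinfun_apply 0 v" for v
      using bounded_opsD(2) by fastforce
  qed
  have "cost_cb M S \<Phi> \<le> 0"
  proof (rule cost_cb_least)
    fix n x
    assume x: "x \<in> matrices n M"
    have "\<Phi> T = 0" if "T \<in> M" for T
      using ch that M0 by (auto simp: channel_def)
    then have "mat_norm n (\<lambda>i j. amplify \<Phi> x i j - x i j) = mat_norm n (\<lambda>i j. 0 :: 'a operator)"
      using x by (intro mat_norm_cong) (simp add: matrices_def amplify_def M0)
    then show "ennreal (mat_norm n (\<lambda>i j. amplify \<Phi> x i j - x i j)) \<le> 0"
      by simp
  qed
  then show ?thesis
    by simp
qed

theorem proposition3p9:
  fixes d :: nat
    and H :: "nat \<Rightarrow> 'h::chilbert_space set"
    and N S :: "nat \<Rightarrow> 'h operator set"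
    and \<Phi> :: "nat \<Rightarrow> 'h operator \<Rightarrow> 'h operator"
    and K :: "'k::chilbert_space set"
    and t :: "(nat \<Rightarrow> 'h) \<Rightarrow> 'k"
    and \<Psi> :: "'k operator \<Rightarrow> 'k operator"
    and \<Phi>t :: "nat \<Rightarrow> 'k operator \<Rightarrow> 'k operator"
  assumes "d \<ge> 1"
    and "\<And>j. j \<in> {1..d} \<Longrightarrow> von_neumann_algebra (H j) (N j)"
    and "\<And>j. j \<in> {1..d} \<Longrightarrow> channel (H j) (N j) (\<Phi> j)"
    and "\<And>j. j \<in> {1..d} \<Longrightarrow> resource_set (H j) (N j) (S j)"
    and "hilbert_tensor d H K t"
    and "is_tensor_channel d H K t N \<Phi> \<Psi>"
    and "\<And>j. j \<in> {1..d} \<Longrightarrow> is_position_channel d H K t N j (\<Phi> j) (\<Phi>t j)"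
  shows "cost_cb (vn_tensor d H K t N) (resource_join d H K t S) \<Psi>
           \<le> (\<Sum>j=1..d. cost_cb (vn_tensor d H K t N) (tensor_position d H K t j ` S j) (\<Phi>t j))
      \<and> ((\<forall>j\<in>{1..d}. cost_cb (vn_tensor d H K t N) (tensor_position d H K t j ` S j) (\<Phi>t j)
                       = cost_cb (N j) (S j) (\<Phi> j))
          \<longrightarrow> cost_cb (vn_tensor d H K t N) (resource_join d H K t S) \<Psi>
              = (\<Sum>j=1..d. cost_cb (N j) (S j) (\<Phi> j)))"
proof -
  have "closed_csubspace (H j)" if "j \<in> {1..d}" for j
    using assms(2)[OF that] by (simp add: von_neumann_algebra_def)
  then interpret hilbert_tensor_product d H K t
    by (rule hilbert_tensor_product.intro[OF assms(5)])
  let ?M = "vn_tensor d H K t N" and ?J = "resource_join d H K t S"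
  have vnM: "von_neumann_algebra K ?M"
    using assms(2) by (rule vn_tensor(1))
  have ch_t: "channel K ?M (\<Phi>t j)" if "j \<in> {1..d}" for j
    using assms(7)[OF that] by (simp add: is_position_channel_def is_tensor_channel_def)
  have upper: "cost_cb ?M ?J \<Psi> \<le> (\<Sum>j=1..d. cost_cb ?M (tensor_position d H K t j ` S j) (\<Phi>t j))"
    unfolding resource_join_def
  proof (rule cost_cb_channel_prod_le[OF vnM ch_t])
    show "\<Psi> x = channel_prod \<Phi>t d x" if "x \<in> ?M" for x
      using assms(2,3,6,7) that by (rule tensor_channel_eq_channel_prod)
  qed
  have lower: "(\<Sum>j=1..d. cost_cb (N j) (S j) (\<Phi> j)) \<le> cost_cb ?M ?J \<Psi>"
    if eq: "\<forall>j\<in>{1..d}. cost_cb ?M (tensor_position d H K t j ` S j) (\<Phi>t j) = cost_cb (N j) (S j) (\<Phi> j)"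
  \<comment> \<open>A factor that is zero has no unit vectors, hence no admissible triples. In that
    case \<open>K\<close> is zero, the costs on it vanish, and \<open>eq\<close> passes this on to
    the costs of the factors.\<close>
  proof (cases "\<exists>j\<in>{1..d}. H j \<subseteq> {0}")
    case True
    then obtain i where "i \<in> {1..d}" "H i \<subseteq> {0}"
      by blast
    then have "K = {0}"
      by (rule trivial_factor)
    then have "cost_cb (N j) (S j) (\<Phi> j) = 0" if "j \<in> {1..d}" for j
      using bspec[OF eq that] vnM ch_t[OF that] unfolding \<open>K = {0}\<close>
      by (simp only: cost_cb_trivial_space)
    then have "(\<Sum>j=1..d. cost_cb (N j) (S j) (\<Phi> j)) = 0"
      by (intro sum.neutral) blast
    then show ?thesis
      by simp
  next
    case False
    let ?P = "\<lambda>j. admissible (H j) (N j) (S j) (\<Phi> j)"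
    have SB: "S j \<subseteq> bounded_ops (H j)" if "j \<in> {1..d}" for j
      using assms(4)[OF that] by (simp add: resource_set_def)
    \<comment> \<open>The summand \<open>0\<close> is the initial value of the accumulator
      \<open>c\<close> in \<open>sum_SUP_le_ennreal\<close>.\<close>
    have "(\<Sum>j=1..d. cost_cb (N j) (S j) (\<Phi> j)) \<le> 0 + (\<Sum>j=1..d. SUP q\<in>?P j. ennreal (displacement_value (\<Phi> j) q))"
      unfolding add_0 using assms(2,3) by (intro sum_mono cost_cb_le_SUP_displacement)
    also have "\<dots> \<le> cost_cb ?M ?J \<Psi>"
    proof (rule sum_SUP_le_ennreal)
      show "?P j \<noteq> {}" if j: "j \<in> {1..d}" for j
      proof -
        obtain v where "v \<in> H j" "v \<noteq> 0"
          using False j by blast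
        moreover have "linear_map_on (N j) (\<Phi> j)"
          using assms(3)[OF j] by (simp add: channel_def)
        ultimately show ?thesis
          by (intro admissible_nonempty[OF assms(2)[OF j]])
      qed
      fix p
      assume p: "\<And>j. j \<in> {1..d} \<Longrightarrow> p j \<in> ?P j"
      \<comment> \<open>Here the sign condition in \<open>admissible\<close> enters: the cast to
        \<open>ennreal\<close> is additive on nonnegative reals.\<close>
      have "(\<Sum>j=1..d. ennreal (displacement_value (\<Phi> j) (p j))) = ennreal (\<Sum>j=1..d. displacement_value (\<Phi> j) (p j))"
      proof (rule sum_ennreal)
        show "0 \<le> displacement_value (\<Phi> j) (p j)" if "j \<in> {1..d}" for j
          using p[OF that] by (cases "p j") (simp add: admissible_def)
      qed
      also have "\<dots> \<le> cost_cb ?M ?J \<Psi>"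
        using assms(1-3) SB assms(6) p by (rule displacement_le_cost_tensor)
      finally show "0 + (\<Sum>j=1..d. ennreal (displacement_value (\<Phi> j) (p j))) \<le> cost_cb ?M ?J \<Psi>"
        by simp
    qed simp
    finally show ?thesis .
  qed
  show ?thesis
  proof (intro conjI impI upper)
    assume eq: "\<forall>j\<in>{1..d}. cost_cb ?M (tensor_position d H K t j ` S j) (\<Phi>t j) = cost_cb (N j) (S j) (\<Phi> j)"
    have "(\<Sum>j=1..d. cost_cb ?M (tensor_position d H K t j ` S j) (\<Phi>t j)) = (\<Sum>j=1..d. cost_cb (N j) (S j) (\<Phi> j))"
      using eq by (intro sum.cong refl) blast
    with upper lower[OF eq] show "cost_cb ?M ?J \<Psi> = (\<Sum>j=1..d. cost_cb (N j) (S j) (\<Phi> j))"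
      by (intro antisym) simp_all
  qed
qed

end
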